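(* Let $m\ge 1$, $a,c\in\mathbb{C}$, $b=(b_1,\dots,b_m)\in\mathbb{C}^m$ satisfy $a\notin\mathbb{Z}$, $c-a\notin\mathbb{Z}$, $b_k\notin\mathbb{Z}$ $(1\le k\le m)$, $c-\sum_{j=1}^m b_j\notin\mathbb{Z}$ and $c\notin\{0,-1,-2,\dots\}$. Let $x=(x_1,\dots,x_m)$ with $|x_i|<1$ and with $0,x_1,\dots,x_m,1$ pairwise distinct. Let $F(a,b,c;x)$, $C(a,b,c)$ and $Q_k(a,b,c;x)$ $(0\le k\le m+1)$ be as defined in the context, and let $e_k$ be the $k$-th unit vector of $\mathbb{C}^m$. Then \begin{align*} F(a-1,b,c;x)&=D_a(a,b,c;x)\,F(a,b,c;x),\\ F(a,b,c-1;x)&=D_c(a,b,c;x)\,F(a,b,c;x)\quad (\text{assuming also } c-1\notin\{0,-1,-2,\dots\}),\\ F(a,b-e_k,c;x)&=D_k(a,b,c;x)\,F(a,b,c;x)\qquad(1\le k\le m), \end{align*} where \begin{align*} D_a(a,b,c;x)&:=\frac{a-1}{c-a}\; Q_{m+1}(a,b,c;x)\; C(a,b,c)^{-1},\\ D_c(a,b,c;x)&:=\frac{c-a-1}{c-1}\; Q_0(a+1,b,c;x)\; Q_{m+1}(a+1,b,c;x)^{-1},\\ D_k(a,b,c;x)&:=Q_k(a+1,b,c+1;x)\; Q_0(a+1,b,c+1;x)^{-1}. \end{align*}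
   Context: Lauricella's series is $F_D(a,b,c;x)=\sum_{n_1,\dots,n_m\ge0}\frac{(a,n_1+\cdots+n_m)(b_1,n_1)\cdots(b_m,n_m)}{(c,n_1+\cdots+n_m)\,n_1!\cdots n_m!}x_1^{n_1}\cdots x_m^{n_m}$, with $(a,n)=\Gamma(a+n)/\Gamma(a)$, convergent for $|x_i|<1$. Define the column vector of size $m+1$ $$F(a,b,c;x)={}^t\Big(F_D(a,b,c;x),\ \tfrac{x_1-1}{-b_1}\tfrac{\partial F_D}{\partial x_1}(a,b,c;x),\dots,\tfrac{x_m-1}{-b_m}\tfrac{\partial F_D}{\partial x_m}(a,b,c;x)\Big).$$ Put $x_0=0$, $x_{m+1}=1$, $\alpha_0=-c+\sum_{j=1}^m b_j$, $\alpha_k=-b_k$ $(1\le k\le m)$, $\alpha_{m+1}=c-a$, $\alpha_{m+2}=a$; all $\alpha_k\notin\mathbb{Z}$. Let $T_x=\mathbb{C}\setminus\{x_0,\dots,x_{m+1}\}$, $u_x(t)=\prod_{i=0}^{m+1}(t-x_i)^{\alpha_i}$, $\omega=d\log u_x$, $\nabla_{\pm\omega}=d\pm\omega\wedge$ ($d$ with respect to $t$). $H^1(T_x,\nabla_{\pm\omega})$ is the cohomology $\ker(\nabla_{\pm\omega}:\mathcal{E}^1\to\mathcal{E}^2)/\nabla_{\pm\omega}(\mathcal{E}^0)$ of smooth forms on $T_x$, and $H^1_c(T_x,\nabla_\omega)$ the analogous group for compactly supported forms. There is a canonical isomorphism $\jmath:H^1(T_x,\nabla_\omega)\to H^1_c(T_x,\nabla_\omega)$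 (inverse of the natural map), and the intersection form is $I_c(\psi,\psi')=\int_{T_x}\jmath(\psi)\wedge\psi'$ for $\psi\in H^1(T_x,\nabla_\omega)$, $\psi'\in H^1(T_x,\nabla_{-\omega})$. Let $\varphi_0=\frac{dt}{t-1}$, $\varphi_k=\frac{dt}{t-1}-\frac{dt}{t-x_k}=\frac{(1-x_k)dt}{(t-x_k)(t-1)}$ $(1\le k\le m)$. The $(m+1)\times(m+1)$ matrices (indices $0,\dots,m$) are $C(a,b,c)=(I_c(\varphi_i,\varphi_j))_{i,j}$ and $Q_k(a,b,c;x)=(I_c((t-x_k)\varphi_i,\varphi_j))_{i,j}$ for $0\le k\le m+1$. Matrices with shifted parameters are obtained by substituting the shifted $(a,b,c)$ in these definitions (the $\alpha_i$ change accordingly). Known fact: writing $\varphi_{i,m+2}=\frac{dt}{t-x_i}$, $\varphi_{i,j}=\varphi_{i,m+2}-\varphi_{j,m+2}$, one has $I_c(\varphi_{i,j},\varphi_{p,q})=2\pi\sqrt{-1}\big(\frac{\delta_{i,p}-\delta_{i,q}}{\alpha_i}-\frac{\delta_{j,p}-\delta_{j,q}}{\alpha_j}\big)$; in particular $C(a,b,c)=2\pi\sqrt{-1}\{\frac{1}{\alpha_{m+1}}N+\mathrm{diag}(\frac1{\alpha_{m+2}},\frac1{\alpha_1},\dots,\frac1{\alpha_m})\}$, $N$ the all-ones matrix, and $C(a,b,c)$ is invertible. *)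

theory Defs
  imports "HOL-Analysis.Analysis"
begin

section \<open>Lauricella's series\<close>

text \<open>
  The number of variables is \<open>CARD('m)\<close>.  The symbol \<open>(a,n)\<close> is \<^const>\<open>pochhammer\<close>; it agrees with
  \<open>\<Gamma>(a+n)/\<Gamma>(a)\<close> whenever \<open>a\<close> is not a nonpositive integer (theorem \<open>pochhammer_Gamma\<close>).
\<close>

definition FD :: "complex \<Rightarrow> complex ^ 'm::finite \<Rightarrow> complex \<Rightarrow> complex ^ 'm \<Rightarrow> complex" where
  "FD a b c x = (\<Sum>\<^sub>\<infinity> n\<in>(UNIV :: ('m \<Rightarrow> nat) set).
     pochhammer a (\<Sum>i\<in>UNIV. n i) * (\<Prod>i\<in>UNIV. pochhammer (b $ i) (n i)) /
     (pochhammer c (\<Sum>i\<in>UNIV. n i) * (\<Prod>i\<in>UNIV. fact (n i))) *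
     (\<Prod>i\<in>UNIV. (x $ i) ^ n i))"

definition FD_partial ::
    "complex \<Rightarrow> complex ^ 'm::finite \<Rightarrow> complex \<Rightarrow> 'm \<Rightarrow> complex ^ 'm \<Rightarrow> complex" where
  "FD_partial a b c k x = deriv (\<lambda>s. FD a b c (\<chi> j. if j = k then s else x $ j)) (x $ k)"

text \<open>
  Vectors and matrices of size \<open>m + 1\<close> are indexed by \<open>'m option\<close>: \<^const>\<open>None\<close> is the index \<open>0\<close>
  and \<open>Some k\<close> is the index \<open>k\<close> with \<open>1 \<le> k \<le> m\<close>.
\<close>

definition Fvec ::
    "complex \<Rightarrow> complex ^ 'm::finite \<Rightarrow> complex \<Rightarrow> complex ^ 'm \<Rightarrow> complex ^ 'm option" where
  "Fvec a b c x = (\<chi> i. case i of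
       None \<Rightarrow> FD a b c x
     | Some k \<Rightarrow> (x $ k - 1) / (- (b $ k)) * FD_partial a b c k x)"

section \<open>Singular points and exponents\<close>

text \<open>The constructors stand for the indices \<open>0\<close>, \<open>k\<close> (with \<open>1 \<le> k \<le> m\<close>) and \<open>m + 1\<close>.\<close>

datatype 'm idx = Idx0 | Idx 'm | Idx1

instance idx :: (finite) finite
proof
  have "x \<in> insert Idx0 (insert Idx1 (range Idx))" for x :: "'a idx"
    by (cases x) simp_all
  then have "(UNIV :: 'a idx set) \<subseteq> insert Idx0 (insert Idx1 (range Idx))"
    by (rule subsetI)
  then show "finite (UNIV :: 'a idx set)"
    by (rule finite_subset) simp
qed

fun pt :: "complex ^ 'm::finite \<Rightarrow> 'm idx \<Rightarrow> complex" where
  "pt x Idx0 = 0"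
| "pt x (Idx k) = x $ k"
| "pt x Idx1 = 1"

fun expo :: "complex \<Rightarrow> complex ^ 'm::finite \<Rightarrow> complex \<Rightarrow> 'm idx \<Rightarrow> complex" where
  "expo a b c Idx0 = - c + (\<Sum>j\<in>UNIV. b $ j)"
| "expo a b c (Idx k) = - (b $ k)"
| "expo a b c Idx1 = c - a"

definition Tx :: "(complex ^ 'm::finite) \<Rightarrow> complex set" where
  "Tx x = - range (pt x)"

text \<open>
  The coefficient of \<open>dt\<close> in \<open>\<omega> = d log u\<close>, where \<open>u(t)\<close> is the (multivalued) product of the powers
  \<open>(t - x\<^sub>i)\<close> to the exponents \<open>\<alpha>\<^sub>i\<close>.
\<close>

definition omega ::
    "complex \<Rightarrow> complex ^ 'm::finite \<Rightarrow> complex \<Rightarrow> complex ^ 'm \<Rightarrow> complex \<Rightarrow> complex" where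
  "omega a b c x t = (\<Sum>i\<in>UNIV. expo a b c i / (t - pt x i))"

section \<open>Twisted cohomology of an open subset of the plane\<close>

text \<open>
  Smoothness is meant in the real sense: the pair \<open>(p, q)\<close> below consists of the partial derivatives
  with respect to the real and the imaginary part.  Functions and forms on an open set \<open>T\<close> are
  represented by total functions whose values outside \<open>T\<close> are irrelevant.
\<close>

primrec Ck :: "nat \<Rightarrow> complex set \<Rightarrow> (complex \<Rightarrow> complex) \<Rightarrow> bool" where
  "Ck 0 T f \<longleftrightarrow> continuous_on T f"
| "Ck (Suc n) T f \<longleftrightarrow> (\<exists>p q. Ck n T p \<and> Ck n T q \<and>
     (\<forall>z\<in>T. (f has_derivative (\<lambda>h. Re h *\<^sub>R p z + Im h *\<^sub>R q z)) (at z)))"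

definition smooth :: "complex set \<Rightarrow> (complex \<Rightarrow> complex) \<Rightarrow> bool" where
  "smooth T f \<longleftrightarrow> (\<forall>n. Ck n T f)"

text \<open>The Wirtinger derivatives with respect to \<open>t\<close> and to its conjugate.\<close>

definition d_t :: "(complex \<Rightarrow> complex) \<Rightarrow> complex \<Rightarrow> complex" where
  "d_t f z = (frechet_derivative f (at z) 1 - \<i> * frechet_derivative f (at z) \<i>) / 2"

definition d_tbar :: "(complex \<Rightarrow> complex) \<Rightarrow> complex \<Rightarrow> complex" where
  "d_tbar f z = (frechet_derivative f (at z) 1 + \<i> * frechet_derivative f (at z) \<i>) / 2"

text \<open>
  The 1-form \<open>P dt + Q dtbar\<close> is represented by \<open>\<lambda>t. (P t, Q t)\<close>, a 2-form by its coefficient with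
  respect to \<open>dt \<and> dtbar\<close>.  The functions \<open>nabla0\<close> and \<open>nabla1\<close> are the operator \<open>d + w dt \<and>\<close> on
  functions and on 1-forms.
\<close>

type_synonym form1 = "complex \<Rightarrow> complex \<times> complex"

definition smooth_form :: "complex set \<Rightarrow> form1 \<Rightarrow> bool" where
  "smooth_form T \<psi> \<longleftrightarrow> smooth T (\<lambda>z. fst (\<psi> z)) \<and> smooth T (\<lambda>z. snd (\<psi> z))"

definition nabla0 :: "(complex \<Rightarrow> complex) \<Rightarrow> (complex \<Rightarrow> complex) \<Rightarrow> form1" where
  "nabla0 w f = (\<lambda>z. (d_t f z + w z * f z, d_tbar f z))"

definition nabla1 :: "(complex \<Rightarrow> complex) \<Rightarrow> form1 \<Rightarrow> complex \<Rightarrow> complex" where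
  "nabla1 w \<psi> = (\<lambda>z. d_t (\<lambda>s. snd (\<psi> s)) z - d_tbar (\<lambda>s. fst (\<psi> s)) z + w z * snd (\<psi> z))"

definition cpt_supp :: "complex set \<Rightarrow> (complex \<Rightarrow> 'a::zero) \<Rightarrow> bool" where
  "cpt_supp T f \<longleftrightarrow> (\<exists>K. compact K \<and> K \<subseteq> T \<and> (\<forall>z\<in>T - K. f z = 0))"

definition Z1 :: "complex set \<Rightarrow> (complex \<Rightarrow> complex) \<Rightarrow> form1 set" where
  "Z1 T w = {\<psi>. smooth_form T \<psi> \<and> (\<forall>z\<in>T. nabla1 w \<psi> z = 0)}"

definition Z1c :: "complex set \<Rightarrow> (complex \<Rightarrow> complex) \<Rightarrow> form1 set" where
  "Z1c T w = {\<psi> \<in> Z1 T w. cpt_supp T \<psi>}"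

definition cohom :: "complex set \<Rightarrow> (complex \<Rightarrow> complex) \<Rightarrow> (form1 \<times> form1) set" where
  "cohom T w = {(\<psi>, \<psi>'). \<psi> \<in> Z1 T w \<and> \<psi>' \<in> Z1 T w \<and>
     (\<exists>f. smooth T f \<and> (\<forall>z\<in>T. \<psi> z = \<psi>' z + nabla0 w f z))}"

definition cohom_c :: "complex set \<Rightarrow> (complex \<Rightarrow> complex) \<Rightarrow> (form1 \<times> form1) set" where
  "cohom_c T w = {(\<psi>, \<psi>'). \<psi> \<in> Z1c T w \<and> \<psi>' \<in> Z1c T w \<and>
     (\<exists>f. smooth T f \<and> cpt_supp T f \<and> (\<forall>z\<in>T. \<psi> z = \<psi>' z + nabla0 w f z))}"

definition H1 :: "complex set \<Rightarrow> (complex \<Rightarrow> complex) \<Rightarrow> form1 set set" where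
  "H1 T w = Z1 T w // cohom T w"

definition H1c :: "complex set \<Rightarrow> (complex \<Rightarrow> complex) \<Rightarrow> form1 set set" where
  "H1c T w = Z1c T w // cohom_c T w"

text \<open>
  The natural map from \<open>H1c\<close> to \<open>H1\<close> (the image of a class under the coarser relation is the class
  of any of its members), and its inverse \<open>jmath\<close>.
\<close>

definition natmap :: "complex set \<Rightarrow> (complex \<Rightarrow> complex) \<Rightarrow> form1 set \<Rightarrow> form1 set" where
  "natmap T w \<Psi> = cohom T w `` \<Psi>"

definition jmath :: "complex set \<Rightarrow> (complex \<Rightarrow> complex) \<Rightarrow> form1 set \<Rightarrow> form1 set" where
  "jmath T w = inv_into (H1c T w) (natmap T w)"

text \<open>
  The integral of \<open>\<psi> \<and> \<psi>'\<close> over \<open>T\<close> with its complex orientation: \<open>dt \<and> dtbar = -2 \<i> dx \<and> dy\<close>.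
\<close>

definition wedge_integral :: "complex set \<Rightarrow> form1 \<Rightarrow> form1 \<Rightarrow> complex" where
  "wedge_integral T \<psi> \<psi>' =
     - 2 * \<i> * (LINT z:T|lborel. fst (\<psi> z) * snd (\<psi>' z) - snd (\<psi> z) * fst (\<psi>' z))"

text \<open>
  The intersection form on classes \<open>\<Psi> \<in> H1 T w\<close> and \<open>\<Psi>' \<in> H1 T (-w)\<close>: the common value of the
  integral over all representatives of \<open>jmath T w \<Psi>\<close> and of \<open>\<Psi>'\<close>.
\<close>

definition intersection ::
    "complex set \<Rightarrow> (complex \<Rightarrow> complex) \<Rightarrow> form1 set \<Rightarrow> form1 set \<Rightarrow> complex" where
  "intersection T w \<Psi> \<Psi>' =
     (THE v. \<forall>\<psi>\<in>jmath T w \<Psi>. \<forall>\<psi>'\<in>\<Psi>'. wedge_integral T \<psi> \<psi>' = v)"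

section \<open>Intersection matrices\<close>

definition I_c :: "complex \<Rightarrow> complex ^ 'm::finite \<Rightarrow> complex \<Rightarrow> complex ^ 'm \<Rightarrow>
    form1 \<Rightarrow> form1 \<Rightarrow> complex" where
  "I_c a b c x \<psi> \<psi>' =
     (let T = Tx x; w = omega a b c x; w' = (\<lambda>t. - omega a b c x t)
      in intersection T w (cohom T w `` {\<psi>}) (cohom T w' `` {\<psi>'}))"

text \<open>The coefficient of \<open>dt\<close> in the form with index \<open>i\<close> of the basis.\<close>

definition phi :: "complex ^ 'm::finite \<Rightarrow> 'm option \<Rightarrow> complex \<Rightarrow> complex" where
  "phi x i t = (case i of
       None \<Rightarrow> 1 / (t - 1)
     | Some k \<Rightarrow> 1 / (t - 1) - 1 / (t - x $ k))"

text \<open>As functions of \<open>x\<close>, the entries of \<open>Cmat\<close> turn out to be constant.\<close>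

definition Cmat :: "complex \<Rightarrow> complex ^ 'm::finite \<Rightarrow> complex \<Rightarrow> complex ^ 'm \<Rightarrow>
    complex ^ 'm option ^ 'm option" where
  "Cmat a b c x = (\<chi> i j. I_c a b c x (\<lambda>t. (phi x i t, 0)) (\<lambda>t. (phi x j t, 0)))"

definition Qmat :: "'m idx \<Rightarrow> complex \<Rightarrow> complex ^ 'm::finite \<Rightarrow> complex \<Rightarrow> complex ^ 'm \<Rightarrow>
    complex ^ 'm option ^ 'm option" where
  "Qmat k a b c x =
     (\<chi> i j. I_c a b c x (\<lambda>t. ((t - pt x k) * phi x i t, 0)) (\<lambda>t. (phi x j t, 0)))"

text \<open>Scalar multiples of matrices are taken with \<open>mat s\<close>, the scalar matrix with diagonal \<open>s\<close>.\<close>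

definition D_a :: "complex \<Rightarrow> complex ^ 'm::finite \<Rightarrow> complex \<Rightarrow> complex ^ 'm \<Rightarrow>
    complex ^ 'm option ^ 'm option" where
  "D_a a b c x = mat ((a - 1) / (c - a)) ** Qmat Idx1 a b c x ** matrix_inv (Cmat a b c x)"

definition D_c :: "complex \<Rightarrow> complex ^ 'm::finite \<Rightarrow> complex \<Rightarrow> complex ^ 'm \<Rightarrow>
    complex ^ 'm option ^ 'm option" where
  "D_c a b c x = mat ((c - a - 1) / (c - 1)) ** Qmat Idx0 (a + 1) b c x **
     matrix_inv (Qmat Idx1 (a + 1) b c x)"

definition D_b :: "'m \<Rightarrow> complex \<Rightarrow> complex ^ 'm::finite \<Rightarrow> complex \<Rightarrow> complex ^ 'm \<Rightarrow>
    complex ^ 'm option ^ 'm option" where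
  "D_b k a b c x = Qmat (Idx k) (a + 1) b (c + 1) x ** matrix_inv (Qmat Idx0 (a + 1) b (c + 1) x)"

end

theory Submission
  imports Defs "HOL-Complex_Analysis.Complex_Analysis"
begin

text \<open>
  Every class in \<open>H\<^sup>1(T, \<nabla>\<^sub>\<omega>)\<close> represented by a form with at most simple poles has a compactly
  supported representative: subtract the covariant derivative of cut-off local solutions of
  \<open>\<nabla>\<^sub>\<omega> f = \<psi>\<close> at the points \<open>x\<^sub>i\<close> and at infinity, which exist because no exponent is an
  integer. The representative is unique up to covariant derivatives of compactly supported functions
  because a local horizontal section has nontrivial monodromy. Hence the intersection form is a sum
  of residues, so that \<open>C\<close> is invertible, and \<open>Q\<^sub>k = M\<^sub>k C\<close>, where \<open>M\<^sub>k\<close> is the explicit matrix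
  of multiplication by \<open>t - x\<^sub>k\<close> on cohomology.
  The matrix \<open>C\<close> cancels in \<open>Q\<^sub>k Q\<^sub>l\<^sup>-\<^sup>1\<close>, and the theorem reduces to three relations of the shape
  \<open>F(shifted) = s M\<^sub>k F\<close>, which are compared coefficientwise.
\<close>

section \<open>Wirtinger calculus for smooth functions\<close>

text \<open>Multiplication by t - x_k raises the exponent \<alpha>_k by one and lowers the exponent
  a at infinity by one. In the parameters this is the shift to a - 1 for k = m+1, to (a - 1, c - 1)
  for k = 0, and to (a - 1, b - e_k, c - 1) for the other k. All three relations therefore lower a.
  The shifts of c or of b alone arise by starting from a vector at a + 1 and eliminating it between
  two relations; this is the origin of a + 1 and c + 1 in \<open>D_c\<close> and \<open>D_b\<close>.
  Infinity needs special care twice. The form \<phi>_0 has a residue there, so the residue sum is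
  first proved against forms without residue at infinity, and \<phi>_0 is moved into this range by a
  multiple of \<omega>. The product (t - x_k) \<phi>_0 has a double pole there, which is removed by
  the covariant derivative of a multiple of t. The common factor of all intersection numbers appears
  as the total mass of a radial density. It cancels together with C, so it is enough that it is
  nonzero.\<close>

definition wirtinger :: "(complex \<Rightarrow> complex) \<Rightarrow> complex \<Rightarrow> complex \<Rightarrow> complex \<Rightarrow> bool" where
  "wirtinger f A B z \<longleftrightarrow> (f has_derivative (\<lambda>h. A * h + B * cnj h)) (at z)"

lemma real_linear_wirtinger:
  "Re h *\<^sub>R p + Im h *\<^sub>R q = (p - \<i> * q) / 2 * h + (p + \<i> * q) / 2 * cnj h"
  by (simp add: complex_eq_iff algebra_simps add_divide_distrib diff_divide_distrib)

lemma wirtinger_frechet: "wirtinger f A B z \<Longrightarrow> frechet_derivative f (at z) = (\<lambda>h. A * h + B * cnj h)"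
  unfolding wirtinger_def by (metis frechet_derivative_at)

lemma wirtinger_d_t: assumes "wirtinger f A B z" shows "d_t f z = A"
  unfolding d_t_def wirtinger_frechet[OF assms] by (simp add: algebra_simps)

lemma wirtinger_d_tbar: assumes "wirtinger f A B z" shows "d_tbar f z = B"
  unfolding d_tbar_def wirtinger_frechet[OF assms] by (simp add: algebra_simps)

lemma wirtinger_differentiable: "wirtinger f A B z \<Longrightarrow> f differentiable (at z)"
  unfolding wirtinger_def differentiable_def by blast

lemma differentiable_wirtinger:
  assumes "f differentiable (at z)"
  shows "wirtinger f (d_t f z) (d_tbar f z) z"
proof -
  let ?D = "frechet_derivative f (at z)"
  have D: "(f has_derivative ?D) (at z)" using assms by (simp add: frechet_derivative_works)
  interpret linear ?D using D has_derivative_linear by blast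
  have "?D h = d_t f z * h + d_tbar f z * cnj h" for h
  proof -
    have "h = Re h *\<^sub>R 1 + Im h *\<^sub>R \<i>" by (simp add: complex_eq_iff)
    then have "?D h = Re h *\<^sub>R ?D 1 + Im h *\<^sub>R ?D \<i>" by (metis add scale)
    then show ?thesis unfolding real_linear_wirtinger d_t_def d_tbar_def .
  qed
  then have "?D = (\<lambda>h. d_t f z * h + d_tbar f z * cnj h)" by (rule ext)
  with D show ?thesis unfolding wirtinger_def by simp
qed

lemma wirtinger_const: "wirtinger (\<lambda>_. c) 0 0 z"
  unfolding wirtinger_def by simp

lemma wirtinger_add: "wirtinger f A B z \<Longrightarrow> wirtinger g C D z \<Longrightarrow> wirtinger (\<lambda>z. f z + g z) (A + C) (B + D) z"
  unfolding wirtinger_def by (drule (1) has_derivative_add) (simp add: algebra_simps)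

lemma wirtinger_mult:
  "wirtinger f A B z \<Longrightarrow> wirtinger g C D z \<Longrightarrow> wirtinger (\<lambda>z. f z * g z) (A * g z + f z * C) (B * g z + f z * D) z"
  unfolding wirtinger_def by (drule (1) has_derivative_mult) (simp add: algebra_simps)

lemma wirtinger_cmult: "wirtinger f A B z \<Longrightarrow> wirtinger (\<lambda>z. c * f z) (c * A) (c * B) z"
  using wirtinger_mult[OF wirtinger_const] by fastforce

lemma wirtinger_minus: "wirtinger f A B z \<Longrightarrow> wirtinger (\<lambda>z. - f z) (- A) (- B) z"
  using wirtinger_cmult[of f A B z "-1"] by simp

lemma wirtinger_diff: "wirtinger f A B z \<Longrightarrow> wirtinger g C D z \<Longrightarrow> wirtinger (\<lambda>z. f z - g z) (A - C) (B - D) z"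
  using wirtinger_add[OF _ wirtinger_minus, of f A B z g C D] by simp

lemma wirtinger_sum:
  "(\<And>i. i \<in> I \<Longrightarrow> wirtinger (f i) (A i) (B i) z) \<Longrightarrow>
    wirtinger (\<lambda>z. \<Sum>i\<in>I. f i z) (\<Sum>i\<in>I. A i) (\<Sum>i\<in>I. B i) z"
proof (induction I rule: infinite_finite_induct)
  case (insert i I)
  then show ?case using wirtinger_add[of "f i" "A i" "B i" z "\<lambda>z. \<Sum>i\<in>I. f i z"] by auto
qed (auto intro: wirtinger_const)

lemma wirtinger_field_derivative: "(f has_field_derivative D) (at z) \<Longrightarrow> wirtinger f D 0 z"
  unfolding wirtinger_def has_field_derivative_def by simp

lemma wirtinger_imp_field_derivative: "wirtinger f D 0 z \<Longrightarrow> (f has_field_derivative D) (at z)"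
  unfolding wirtinger_def has_field_derivative_def by simp

lemma wirtinger_cong_open:
  "wirtinger f A B z \<Longrightarrow> open S \<Longrightarrow> z \<in> S \<Longrightarrow> (\<And>y. y \<in> S \<Longrightarrow> f y = g y) \<Longrightarrow> wirtinger g A B z"
  unfolding wirtinger_def by (rule has_derivative_transform_within_open)

lemma wirtinger_of_real_comp:
  assumes "(h has_real_derivative D) (at (r z))" and "wirtinger (\<lambda>z. of_real (r z)) A B z"
  shows "wirtinger (\<lambda>z. of_real (h (r z))) (of_real D * A) (of_real D * B) z"
proof -
  have "(r has_derivative (\<lambda>v. Re (A * v + B * cnj v))) (at z)"
    using has_derivative_Re[OF assms(2)[unfolded wirtinger_def]] by simp
  from has_derivative_compose[OF this assms(1)[unfolded has_field_derivative_def]]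
  have 1: "((\<lambda>z. h (r z)) has_derivative (\<lambda>v. D * Re (A * v + B * cnj v))) (at z)" .
  \<comment> \<open>The differential of a real-valued function is real, so
    \<open>A * v + B * cnj v\<close> equals its own real part and the real chain rule extends to the
    Wirtinger pair.\<close>
  have im: "Im (A * v + B * cnj v) = 0" for v
  proof -
    have "((\<lambda>z. 0) has_derivative (\<lambda>v. Im (A * v + B * cnj v))) (at z)"
      using has_derivative_Im[OF assms(2)[unfolded wirtinger_def]] by simp
    from has_derivative_unique[OF this has_derivative_const] show ?thesis by metis
  qed
  have "((\<lambda>z. of_real (h (r z))::complex) has_derivative (\<lambda>v. of_real (D * Re (A * v + B * cnj v)))) (at z)"
    by (rule has_derivative_of_real[OF 1])
  also have "(\<lambda>v. of_real (D * Re (A * v + B * cnj v))) = (\<lambda>v. of_real D * A * v + of_real D * B * cnj v)"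
  proof
    fix v
    have "of_real (Re (A * v + B * cnj v)) = A * v + B * cnj v"
      using im[of v] by (simp only: complex_eq_iff Re_complex_of_real Im_complex_of_real)
    then show "of_real (D * Re (A * v + B * cnj v)) = of_real D * A * v + of_real D * B * cnj v"
      by (simp only: of_real_mult distrib_left mult.assoc)
  qed
  finally show ?thesis unfolding wirtinger_def .
qed

section \<open>Functions of class C^k and their closure properties\<close>

lemma Ck_imp_continuous: "Ck n T f \<Longrightarrow> continuous_on T f"
  by (cases n) (auto intro!: continuous_at_imp_continuous_on dest: has_derivative_continuous)


lemma Ck_cong: "open T \<Longrightarrow> Ck n T f \<Longrightarrow> (\<And>z. z \<in> T \<Longrightarrow> f z = g z) \<Longrightarrow> Ck n T g"
proof (cases n)
  case 0
  assume "Ck n T f" "(\<And>z. z \<in> T \<Longrightarrow> f z = g z)"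
  with 0 show ?thesis by (simp cong: continuous_on_cong)
next
  case (Suc m)
  assume *: "open T" "Ck n T f" "(\<And>z. z \<in> T \<Longrightarrow> f z = g z)"
  with Suc obtain p q where "Ck m T p" "Ck m T q" and
    "\<And>z. z\<in>T \<Longrightarrow> (f has_derivative (\<lambda>h. Re h *\<^sub>R p z + Im h *\<^sub>R q z)) (at z)" by auto
  moreover have "(g has_derivative (\<lambda>h. Re h *\<^sub>R p z + Im h *\<^sub>R q z)) (at z)" if "z \<in> T" for z
    using calculation(3)[OF that] *(1) that *(3) by (rule has_derivative_transform_within_open)
  ultimately show ?thesis unfolding Suc Ck.simps by blast
qed

lemma Ck_subset: "Ck n T f \<Longrightarrow> S \<subseteq> T \<Longrightarrow> Ck n S f"
proof (induction n arbitrary: f)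
  case 0 then show ?case by (auto intro: continuous_on_subset)
next
  case (Suc n) then show ?case by simp (meson subset_eq)
qed

lemma Ck_const: "Ck n T (\<lambda>_. c)"
proof (induction n arbitrary: c)
  case (Suc n)
  then show ?case by (auto intro!: exI[of _ "\<lambda>_. 0"])
qed simp

lemma Ck_SucD: "Ck (Suc n) T f \<Longrightarrow> Ck n T f"
proof (induction n arbitrary: f)
  case 0 then show ?case using Ck_imp_continuous by (metis Ck.simps(1))
next
  case (Suc n)
  from Suc.prems obtain p q where *: "Ck (Suc n) T p" "Ck (Suc n) T q"
    "\<forall>z\<in>T. (f has_derivative (\<lambda>h. Re h *\<^sub>R p z + Im h *\<^sub>R q z)) (at z)"
    unfolding Ck.simps(2)[of "Suc n"] by blast
  show ?case unfolding Ck.simps(2)[of n] using Suc.IH * by blast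
qed

lemma Ck_add: "Ck n T f \<Longrightarrow> Ck n T g \<Longrightarrow> Ck n T (\<lambda>z. f z + g z)"
proof (induction n arbitrary: f g)
  case 0 then show ?case by (auto intro: continuous_intros)
next
  case (Suc n)
  from Suc.prems obtain p q p' q' where *: "Ck n T p" "Ck n T q" "Ck n T p'" "Ck n T q'"
    and f: "\<And>z. z\<in>T \<Longrightarrow> (f has_derivative (\<lambda>h. Re h *\<^sub>R p z + Im h *\<^sub>R q z)) (at z)"
    and g: "\<And>z. z\<in>T \<Longrightarrow> (g has_derivative (\<lambda>h. Re h *\<^sub>R p' z + Im h *\<^sub>R q' z)) (at z)"
    by auto
  have "((\<lambda>z. f z + g z) has_derivative (\<lambda>h. Re h *\<^sub>R (p z + p' z) + Im h *\<^sub>R (q z + q' z))) (at z)"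
    if "z \<in> T" for z
    using has_derivative_add[OF f[OF that] g[OF that]] by (simp add: algebra_simps)
  with Suc.IH[OF *(1,3)] Suc.IH[OF *(2,4)] show ?case
    unfolding Ck.simps by blast
qed

lemma Ck_mult: "Ck n T f \<Longrightarrow> Ck n T g \<Longrightarrow> Ck n T (\<lambda>z. f z * g z)"
proof (induction n arbitrary: f g)
  case 0 then show ?case by (auto intro: continuous_intros)
next
  case (Suc n)
  from Suc.prems obtain p q p' q' where *: "Ck n T p" "Ck n T q" "Ck n T p'" "Ck n T q'"
    and f: "\<And>z. z\<in>T \<Longrightarrow> (f has_derivative (\<lambda>h. Re h *\<^sub>R p z + Im h *\<^sub>R q z)) (at z)"
    and g: "\<And>z. z\<in>T \<Longrightarrow> (g has_derivative (\<lambda>h. Re h *\<^sub>R p' z + Im h *\<^sub>R q' z)) (at z)"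
    by auto
  note fg = Ck_SucD[OF Suc.prems(1)] Ck_SucD[OF Suc.prems(2)]
  have "((\<lambda>z. f z * g z) has_derivative
      (\<lambda>h. Re h *\<^sub>R (f z * p' z + p z * g z) + Im h *\<^sub>R (f z * q' z + q z * g z))) (at z)"
    if "z \<in> T" for z
    using has_derivative_mult[OF f[OF that] g[OF that]] by (simp add: algebra_simps)
  with Ck_add[OF Suc.IH[OF fg(1) *(3)] Suc.IH[OF *(1) fg(2)]]
    Ck_add[OF Suc.IH[OF fg(1) *(4)] Suc.IH[OF *(2) fg(2)]] show ?case
    unfolding Ck.simps by blast
qed

text \<open>On an open set the existential witnesses \<open>p\<close>, \<open>q\<close> of
  \<open>Ck\<close> are the two partial derivatives, hence constant combinations of
  \<open>d_t f\<close> and \<open>d_tbar f\<close>. This replaces them by functions that depend on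
  \<open>f\<close> alone, so that the class C^k can be localized and glued.\<close>

lemma Ck_Suc_iff:
  assumes "open T"
  shows "Ck (Suc n) T f \<longleftrightarrow> Ck n T (d_t f) \<and> Ck n T (d_tbar f) \<and> (\<forall>z\<in>T. f differentiable (at z))"
proof
  assume "Ck (Suc n) T f"
  then obtain p q where *: "Ck n T p" "Ck n T q" and
    D: "\<And>z. z\<in>T \<Longrightarrow> (f has_derivative (\<lambda>h. Re h *\<^sub>R p z + Im h *\<^sub>R q z)) (at z)" by auto
  have wirtinger: "wirtinger f (1/2 * p z + (- \<i> / 2) * q z) (1/2 * p z + (\<i> / 2) * q z) z" if "z \<in> T" for z
  proof -
    have "1/2 * p z + (- \<i> / 2) * q z = (p z - \<i> * q z) / 2"
      "1/2 * p z + (\<i> / 2) * q z = (p z + \<i> * q z) / 2" by (simp_all add: field_simps)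
    then show ?thesis using D[OF that] unfolding wirtinger_def real_linear_wirtinger by (simp only:)
  qed
  have 1: "Ck n T (\<lambda>z. 1/2 * p z + (- \<i> / 2) * q z)" "Ck n T (\<lambda>z. 1/2 * p z + (\<i> / 2) * q z)"
    by (intro Ck_add Ck_mult Ck_const *)+
  have "Ck n T (d_t f)" by (rule Ck_cong[OF assms 1(1)]) (simp add: wirtinger_d_t[OF wirtinger])
  moreover have "Ck n T (d_tbar f)" by (rule Ck_cong[OF assms 1(2)]) (simp add: wirtinger_d_tbar[OF wirtinger])
  ultimately show "Ck n T (d_t f) \<and> Ck n T (d_tbar f) \<and> (\<forall>z\<in>T. f differentiable (at z))"
    using wirtinger wirtinger_differentiable by blast
next
  assume *: "Ck n T (d_t f) \<and> Ck n T (d_tbar f) \<and> (\<forall>z\<in>T. f differentiable (at z))"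
  have "(f has_derivative (\<lambda>h. Re h *\<^sub>R (d_t f z + d_tbar f z) +
      Im h *\<^sub>R (\<i> * d_t f z + (- \<i>) * d_tbar f z))) (at z)" if "z \<in> T" for z
  proof -
    have "f differentiable (at z)" using * that by blast
    from differentiable_wirtinger[OF this, unfolded wirtinger_def] show ?thesis
      by (rule has_derivative_eq_rhs) (auto simp: fun_eq_iff complex_eq_iff algebra_simps)
  qed
  moreover have "Ck n T (\<lambda>z. d_t f z + d_tbar f z)" "Ck n T (\<lambda>z. \<i> * d_t f z + (- \<i>) * d_tbar f z)"
    using * by (intro Ck_add Ck_mult Ck_const; blast)+
  ultimately show "Ck (Suc n) T f" unfolding Ck.simps by blast
qed

lemma Ck_SucI:
  assumes "open T" "Ck n T A" "Ck n T B" "\<And>z. z \<in> T \<Longrightarrow> wirtinger f (A z) (B z) z"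
  shows "Ck (Suc n) T f"
  unfolding Ck_Suc_iff[OF assms(1)]
  using Ck_cong[OF assms(1,2), of "d_t f"] Ck_cong[OF assms(1,3), of "d_tbar f"]
    wirtinger_d_t[OF assms(4)] wirtinger_d_tbar[OF assms(4)] wirtinger_differentiable[OF assms(4)]
  by auto

lemma Ck_holomorphic: "f holomorphic_on T \<Longrightarrow> open T \<Longrightarrow> Ck n T f"
proof (induction n arbitrary: f)
  case 0 then show ?case by (simp add: holomorphic_on_imp_continuous_on)
next
  case (Suc n)
  show ?case
    by (rule Ck_SucI[OF Suc.prems(2) Suc.IH[OF holomorphic_deriv[OF Suc.prems] Suc.prems(2)] Ck_const[of _ _ 0]])
       (use Suc.prems in \<open>auto intro!: wirtinger_field_derivative holomorphic_derivI\<close>)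
qed

lemma Ck_Un: "open S \<Longrightarrow> open T \<Longrightarrow> Ck n S f \<Longrightarrow> Ck n T f \<Longrightarrow> Ck n (S \<union> T) f"
proof (induction n arbitrary: f)
  case 0 then show ?case by (simp add: continuous_on_open_Un)
next
  case (Suc n)
  then show ?case unfolding Ck_Suc_iff[OF Suc.prems(1)] Ck_Suc_iff[OF Suc.prems(2)]
      Ck_Suc_iff[OF open_Un[OF Suc.prems(1,2)]] by blast
qed

section \<open>Smooth functions\<close>

lemma smooth_imp_differentiable: "smooth T f \<Longrightarrow> open T \<Longrightarrow> z \<in> T \<Longrightarrow> f differentiable (at z)"
  using Ck_Suc_iff unfolding smooth_def by blast

lemma smooth_wirtinger: "smooth T f \<Longrightarrow> open T \<Longrightarrow> z \<in> T \<Longrightarrow> wirtinger f (d_t f z) (d_tbar f z) z"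
  by (intro differentiable_wirtinger smooth_imp_differentiable)

lemma smooth_d_t: "smooth T f \<Longrightarrow> open T \<Longrightarrow> smooth T (d_t f)"
  using Ck_Suc_iff unfolding smooth_def by blast

lemma smooth_d_tbar: "smooth T f \<Longrightarrow> open T \<Longrightarrow> smooth T (d_tbar f)"
  using Ck_Suc_iff unfolding smooth_def by blast

lemma smooth_continuous: "smooth T f \<Longrightarrow> continuous_on T f"
  unfolding smooth_def using Ck_imp_continuous by blast

lemma smooth_cong: "open T \<Longrightarrow> smooth T f \<Longrightarrow> (\<And>z. z \<in> T \<Longrightarrow> f z = g z) \<Longrightarrow> smooth T g"
  unfolding smooth_def using Ck_cong by blast

lemma smooth_subset: "smooth T f \<Longrightarrow> S \<subseteq> T \<Longrightarrow> smooth S f"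
  unfolding smooth_def using Ck_subset by blast

lemma smooth_const: "smooth T (\<lambda>_. c)"
  by (simp add: smooth_def Ck_const)

lemma smooth_add: "smooth T f \<Longrightarrow> smooth T g \<Longrightarrow> smooth T (\<lambda>z. f z + g z)"
  by (simp add: smooth_def Ck_add)

lemma smooth_mult: "smooth T f \<Longrightarrow> smooth T g \<Longrightarrow> smooth T (\<lambda>z. f z * g z)"
  by (simp add: smooth_def Ck_mult)

lemma smooth_minus: "smooth T f \<Longrightarrow> smooth T (\<lambda>z. - f z)"
  using smooth_mult[OF smooth_const[of T "-1"], of f] by simp

lemma smooth_diff: "smooth T f \<Longrightarrow> smooth T g \<Longrightarrow> smooth T (\<lambda>z. f z - g z)"
  using smooth_add[OF _ smooth_minus, of T f g] by simp

lemma smooth_sum: "(\<And>i. i \<in> I \<Longrightarrow> smooth T (f i)) \<Longrightarrow> smooth T (\<lambda>z. \<Sum>i\<in>I. f i z)"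
  by (induction I rule: infinite_finite_induct) (auto intro: smooth_const smooth_add)

lemma smooth_holomorphic: "f holomorphic_on T \<Longrightarrow> open T \<Longrightarrow> smooth T f"
  by (simp add: smooth_def Ck_holomorphic)

lemma smooth_Un: "open S \<Longrightarrow> open T \<Longrightarrow> smooth S f \<Longrightarrow> smooth T f \<Longrightarrow> smooth (S \<union> T) f"
  by (simp add: smooth_def Ck_Un)

section \<open>Stokes' theorem for compactly supported functions\<close>

lemma lborel_integral_translation:
  fixes f :: "complex \<Rightarrow> complex"
  assumes "f \<in> borel_measurable borel"
  shows "(LINT z|lborel. f (t + z)) = (LINT z|lborel. f z)"
proof -
  have "(LINT z|lborel. f z) = (LINT z|distr lborel borel ((+) t). f z)"
    by (simp add: lborel_distr_plus)
  also have "\<dots> = (LINT z|lborel. f (t + z))"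
    by (rule integral_distr) (use assms in auto)
  finally show ?thesis ..
qed

text \<open>Translation invariance makes the integrals of the difference quotients vanish.\<close>

lemma integral_directional_derivative_eq_0:
  fixes g :: "complex \<Rightarrow> complex"
  assumes g: "\<And>z. (g has_derivative g' z) (at z)"
    and cont: "continuous_on UNIV (\<lambda>z. g' z v)"
    and supp: "\<And>z. z \<notin> K \<Longrightarrow> g z = 0" and K: "compact K"
  shows "(LINT z|lborel. g' z v) = 0"
proof -
  have g'0: "g' z v = 0" if "z \<notin> K" for z
  proof -
    have "open (- K)" using K compact_imp_closed by blast
    then have "((\<lambda>_. 0) has_derivative g' z) (at z)"
      using has_derivative_transform_within_open[OF g, of "- K" z "\<lambda>_. 0"] supp that by auto
    from has_derivative_unique[OF this has_derivative_const] show ?thesis by simp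
  qed
  have "bounded ((\<lambda>z. g' z v) ` K)"
    by (intro compact_imp_bounded compact_continuous_image continuous_on_subset[OF cont] K) auto
  then obtain M0 where M0: "\<And>z. z \<in> K \<Longrightarrow> norm (g' z v) \<le> M0" unfolding bounded_iff by auto
  define M where "M = max M0 0"
  have M: "norm (g' z v) \<le> M" for z using M0 g'0 unfolding M_def by (cases "z \<in> K") fastforce+
  have M_nonneg: "0 \<le> M" unfolding M_def by simp
  \<comment> \<open>The mean value inequality along the segment, with the sup bound M, dominates the
    difference quotients uniformly in n.\<close>
  have lip: "norm (g (z + s *\<^sub>R v) - g z) \<le> M * s" if "0 \<le> s" for z s
  proof -
    have "norm ((\<lambda>t. g (z + t *\<^sub>R v)) s - (\<lambda>t. g (z + t *\<^sub>R v)) 0) \<le> M * norm (s - 0)"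
    proof (rule differentiable_bound[where S = "{0..s}" and f' = "\<lambda>t h. h *\<^sub>R g' (z + t *\<^sub>R v) v"])
      fix t
      have "((\<lambda>t. z + t *\<^sub>R v) has_derivative (\<lambda>h. h *\<^sub>R v)) (at t)"
        by (auto intro!: derivative_eq_intros)
      from has_derivative_compose[OF this g]
      have "((\<lambda>t. g (z + t *\<^sub>R v)) has_derivative (\<lambda>h. g' (z + t *\<^sub>R v) (h *\<^sub>R v))) (at t)" .
      also have "(\<lambda>h. g' (z + t *\<^sub>R v) (h *\<^sub>R v)) = (\<lambda>h. h *\<^sub>R g' (z + t *\<^sub>R v) v)"
        using linear_scale[OF has_derivative_linear[OF g]] by auto
      finally show "((\<lambda>t. g (z + t *\<^sub>R v)) has_derivative (\<lambda>h. h *\<^sub>R g' (z + t *\<^sub>R v) v)) (at t within {0..s})"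
        by (rule has_derivative_at_withinI)
      show "onorm (\<lambda>h. h *\<^sub>R g' (z + t *\<^sub>R v) v) \<le> M"
        by (rule onorm_le) (use M[of "z + t *\<^sub>R v"] in \<open>simp add: mult.commute[of M] mult_left_mono\<close>)
    qed (use that in auto)
    then show ?thesis using that by simp
  qed
  define D where "D n z = (g (z + inverse (real (Suc n)) *\<^sub>R v) - g z) * of_nat (Suc n)" for n z
  have contg: "continuous_on UNIV g"
    using g by (auto intro!: continuous_at_imp_continuous_on dest: has_derivative_continuous)
  then have gm: "g \<in> borel_measurable borel" by (rule borel_measurable_continuous_onI)
  have int_g: "integrable lborel g"
  proof -
    have "integrable lborel (\<lambda>z. indicator K z *\<^sub>R g z)"
      by (intro borel_integrable_compact K continuous_on_subset[OF contg]) auto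
    also have "(\<lambda>z. indicator K z *\<^sub>R g z) = g" using supp by (auto simp: indicator_def fun_eq_iff)
    finally show ?thesis .
  qed
  have int_gt: "integrable lborel (\<lambda>z. g (t + z))" for t
  proof -
    have "integrable (distr lborel borel ((+) t)) g" using int_g by (simp add: lborel_distr_plus)
    then show ?thesis by (subst (asm) integrable_distr_eq) (use gm in auto)
  qed
  have D0: "(LINT z|lborel. D n z) = 0" for n
    unfolding D_def using int_gt[of "inverse (real (Suc n)) *\<^sub>R v"] int_g
      lborel_integral_translation[OF gm, of "inverse (real (Suc n)) *\<^sub>R v"]
    by (simp add: add.commute)
  obtain R where R: "R > 0" "\<And>z. z \<in> K \<Longrightarrow> norm z \<le> R"
    using compact_imp_bounded[OF K] unfolding bounded_pos by auto
  have "(\<lambda>n. LINT z|lborel. D n z) \<longlonglongrightarrow> (LINT z|lborel. g' z v)"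
  proof (rule integral_dominated_convergence)
    show "(\<lambda>z. g' z v) \<in> borel_measurable lborel"
      using borel_measurable_continuous_onI[OF cont] by simp
    show "D n \<in> borel_measurable lborel" for n
      unfolding D_def using gm by measurable
    \<comment> \<open>The steps 1/(n+1) are at most 1, so every difference quotient lives on one
      fixed enlargement of K.\<close>
    have "integrable lborel (\<lambda>z. indicator (cball 0 (R + norm v)) z *\<^sub>R M)"
      by (intro borel_integrable_compact continuous_on_const compact_cball)
    then show "integrable lborel (\<lambda>z::complex. indicator (cball 0 (R + norm v)) z * M)" by simp
    show "AE z in lborel. (\<lambda>n. D n z) \<longlonglongrightarrow> g' z v"
    proof (rule AE_I2)
      fix z
      have "((\<lambda>t. z + t *\<^sub>R v) has_derivative (\<lambda>h. h *\<^sub>R v)) (at 0)"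
        by (auto intro!: derivative_eq_intros)
      from has_derivative_compose[OF this, of g "g' z"] g[of z]
      have "((\<lambda>t. g (z + t *\<^sub>R v)) has_derivative (\<lambda>h. g' z (h *\<^sub>R v))) (at 0)" by simp
      then have "(\<lambda>h. norm (g (z + h *\<^sub>R v) - g z - h *\<^sub>R g' z v) / norm h) \<midarrow>0\<rightarrow> 0"
        unfolding has_derivative_at using linear_scale[OF has_derivative_linear[OF g]] by simp
      then have "(\<lambda>h. norm ((g (z + h *\<^sub>R v) - g z) /\<^sub>R h - g' z v)) \<midarrow>0\<rightarrow> 0"
      proof (rule Lim_transform_eventually)
        show "\<forall>\<^sub>F h in at 0. norm (g (z + h *\<^sub>R v) - g z - h *\<^sub>R g' z v) / norm h =
            norm ((g (z + h *\<^sub>R v) - g z) /\<^sub>R h - g' z v)"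
          unfolding eventually_at
        proof (intro exI[of _ 1] conjI ballI impI)
          fix h :: real assume "h \<noteq> 0 \<and> dist h 0 < 1"
          then have "(g (z + h *\<^sub>R v) - g z) /\<^sub>R h - g' z v = (g (z + h *\<^sub>R v) - g z - h *\<^sub>R g' z v) /\<^sub>R h"
            by (simp add: scaleR_diff_right)
          then show "norm (g (z + h *\<^sub>R v) - g z - h *\<^sub>R g' z v) / norm h =
            norm ((g (z + h *\<^sub>R v) - g z) /\<^sub>R h - g' z v)" by (simp add: divide_inverse mult.commute)
        qed simp
      qed
      then have "((\<lambda>h. (g (z + h *\<^sub>R v) - g z) /\<^sub>R h) \<longlongrightarrow> g' z v) (at 0)"
        by (rule LIM_zero_cancel[OF tendsto_norm_zero_cancel])
      moreover have "filterlim (\<lambda>n. inverse (real (Suc n))) (at 0) sequentially"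
        unfolding filterlim_at using LIMSEQ_inverse_real_of_nat by (auto intro!: eventuallyI)
      ultimately have "(\<lambda>n. (g (z + inverse (real (Suc n)) *\<^sub>R v) - g z) /\<^sub>R inverse (real (Suc n)))
          \<longlonglongrightarrow> g' z v" by (rule filterlim_compose)
      then show "(\<lambda>n. D n z) \<longlonglongrightarrow> g' z v"
        unfolding D_def by (simp add: scaleR_conv_of_real mult.commute)
    qed
    show "AE z in lborel. norm (D n z) \<le> indicator (cball 0 (R + norm v)) z * M" for n
    proof (rule AE_I2)
      fix z
      let ?s = "inverse (real (Suc n))"
      show "norm (D n z) \<le> indicator (cball 0 (R + norm v)) z * M"
      proof (cases "z \<in> cball 0 (R + norm v)")
        case True
        have "norm (D n z) \<le> M * ?s * real (Suc n)"
          unfolding D_def norm_mult norm_of_nat using lip[of ?s z] by (intro mult_right_mono) auto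
        also have "\<dots> = M" by (simp add: field_simps del: of_nat_Suc)
        finally show ?thesis using True by simp
      next
        case False
        have s: "norm (?s *\<^sub>R v) \<le> norm v" by (simp add: field_simps mult_left_le_one_le)
        have "z \<notin> K" using False R(2)[of z] norm_ge_zero[of v] by (auto simp: not_le)
        moreover have "z + ?s *\<^sub>R v \<notin> K"
        proof
          assume "z + ?s *\<^sub>R v \<in> K"
          then have "norm z - norm (?s *\<^sub>R v) \<le> R"
            using R(2) norm_diff_ineq[of z "?s *\<^sub>R v"] by force
          with s False show False by simp
        qed
        ultimately show ?thesis using False supp unfolding D_def by simp
      qed
    qed
  qed
  then have "(\<lambda>n::nat. 0) \<longlonglongrightarrow> (LINT z|lborel. g' z v)" unfolding D0 .
  then show ?thesis by (simp add: LIMSEQ_const_iff)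
qed

section \<open>Set integrals of Wirtinger derivatives\<close>

lemma set_integrable_cpt_supp:
  fixes F :: "complex \<Rightarrow> complex"
  assumes "continuous_on T F" "compact K" "K \<subseteq> T" "\<And>z. z \<in> T - K \<Longrightarrow> F z = 0"
  shows "set_integrable lborel T F"
proof -
  have "integrable lborel (\<lambda>z. indicator K z *\<^sub>R F z)"
    by (intro borel_integrable_compact assms continuous_on_subset[OF assms(1)])
  also have "(\<lambda>z. indicator K z *\<^sub>R F z) = (\<lambda>z. indicator T z *\<^sub>R F z)"
    using assms by (auto simp: indicator_def fun_eq_iff)
  finally show ?thesis unfolding set_integrable_def .
qed

text \<open>The derivatives of the extension by zero along 1 and along \<i> integrate to zero, which
  reads \<integral>A + \<integral>B = 0 and \<integral>A = \<integral>B; together these make both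
  integrals vanish.\<close>

lemma stokes:
  assumes T: "open T" and K: "compact K" "K \<subseteq> T"
    and g: "\<And>z. z \<in> T \<Longrightarrow> wirtinger g (A z) (B z) z"
    and cont: "continuous_on T A" "continuous_on T B"
    and supp: "\<And>z. z \<in> T - K \<Longrightarrow> g z = 0"
  shows "set_integrable lborel T A" "(LINT z:T|lborel. A z) = 0"
    "set_integrable lborel T B" "(LINT z:T|lborel. B z) = 0"
proof -
  have oK: "open (- K)" using K compact_imp_closed by blast
  have AB0: "A z = 0 \<and> B z = 0" if "z \<in> T - K" for z
  proof -
    have "wirtinger (\<lambda>_. 0) (A z) (B z) z"
      by (rule wirtinger_cong_open[OF g, of z "T - K"]) (use that supp T K compact_imp_closed in auto)
    then show ?thesis using wirtinger_d_t wirtinger_d_tbar wirtinger_const by metis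
  qed
  show iA: "set_integrable lborel T A" and iB: "set_integrable lborel T B"
    using AB0 by (auto intro!: set_integrable_cpt_supp[OF cont(1) K] set_integrable_cpt_supp[OF cont(2) K])
  \<comment> \<open>Extension by zero: \<open>g\<close>, \<open>A\<close> and \<open>B\<close>
    vanish on T - K, so the extension is differentiable on the open cover of the plane by T and -
    K.\<close>
  let ?z = "\<lambda>F z. if z \<in> K then F z else 0 :: complex"
  have wirtinger: "wirtinger (?z g) (?z A z) (?z B z) z" for z
  proof (cases "z \<in> T")
    case True
    have "wirtinger (?z g) (A z) (B z) z"
      by (rule wirtinger_cong_open[OF g[OF True] T True]) (use supp in auto)
    then show ?thesis using AB0[of z] True by auto
  next
    case False
    then have "z \<in> - K" using K by auto
    then show ?thesis using wirtinger_cong_open[OF wirtinger_const[of 0 z] oK, of "?z g"] by auto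
  qed
  have cz: "continuous_on UNIV (?z F)" if "continuous_on T F" "\<And>z. z \<in> T - K \<Longrightarrow> F z = 0" for F
  proof -
    have "continuous_on (T \<union> - K) (?z F)"
    proof (rule continuous_on_open_Un[OF T oK])
      show "continuous_on T (?z F)"
        using that by (subst continuous_on_cong[OF refl, of T _ F]) auto
      show "continuous_on (- K) (?z F)"
        by (subst continuous_on_cong[OF refl, of "- K" _ "\<lambda>_. 0"]) auto
    qed
    then show ?thesis by (rule continuous_on_subset) (use K in auto)
  qed
  have cA: "continuous_on UNIV (?z A)" and cB: "continuous_on UNIV (?z B)"
    using cz[OF cont(1)] cz[OF cont(2)] AB0 by blast+
  have eq: "(LINT z:T|lborel. F z) = (LINT z|lborel. ?z F z)" if "\<And>z. z \<in> T - K \<Longrightarrow> F z = 0" for F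
    unfolding set_lebesgue_integral_def
    by (rule Bochner_Integration.integral_cong) (use that K in \<open>auto simp: indicator_def\<close>)
  have intz: "integrable lborel (?z F)" if "continuous_on UNIV (?z F)" for F
  proof -
    have "integrable lborel (\<lambda>z. indicator K z *\<^sub>R ?z F z)"
      by (intro borel_integrable_compact K continuous_on_subset[OF that]) auto
    also have "(\<lambda>z. indicator K z *\<^sub>R ?z F z) = ?z F" by (auto simp: indicator_def fun_eq_iff)
    finally show ?thesis .
  qed
  have dir: "(LINT z|lborel. ?z A z * v + ?z B z * cnj v) = 0" for v
    by (rule integral_directional_derivative_eq_0[where g = "?z g" and K = K
          and g' = "\<lambda>z h. ?z A z * h + ?z B z * cnj h"])
       (use wirtinger[unfolded wirtinger_def] K cA cB in \<open>auto intro!: continuous_on_add continuous_on_mult continuous_on_const\<close>)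
  have split: "(LINT z|lborel. ?z A z * v + ?z B z * cnj v) =
      (LINT z|lborel. ?z A z) * v + (LINT z|lborel. ?z B z) * cnj v" for v
    using intz[OF cA] intz[OF cB] by (subst Bochner_Integration.integral_add) auto
  have 1: "(LINT z|lborel. ?z A z) + (LINT z|lborel. ?z B z) = 0"
    using dir[of 1] unfolding split by simp
  have 2: "(LINT z|lborel. ?z A z) = (LINT z|lborel. ?z B z)"
    using dir[of \<i>] unfolding split by (simp add: algebra_simps)
  show "(LINT z:T|lborel. A z) = 0" "(LINT z:T|lborel. B z) = 0"
    using 1 2 eq[of A] eq[of B] AB0 by auto
qed

lemma stokes_smooth:
  assumes "open T" "smooth T g" "cpt_supp T g"
  shows "set_integrable lborel T (d_t g)" "(LINT z:T|lborel. d_t g z) = 0"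
    "set_integrable lborel T (d_tbar g)" "(LINT z:T|lborel. d_tbar g z) = 0"
proof -
  obtain K where K: "compact K" "K \<subseteq> T" "\<And>z. z \<in> T - K \<Longrightarrow> g z = 0"
    using assms(3) unfolding cpt_supp_def by auto
  note * = stokes[OF assms(1) K(1,2) smooth_wirtinger[OF assms(2,1)]
      smooth_continuous[OF smooth_d_t] smooth_continuous[OF smooth_d_tbar] K(3), OF _ assms(2,1) assms(2,1)]
  show "set_integrable lborel T (d_t g)" "(LINT z:T|lborel. d_t g z) = 0"
    "set_integrable lborel T (d_tbar g)" "(LINT z:T|lborel. d_tbar g z) = 0"
    using * by simp_all
qed

section \<open>Wedge integrals of covariantly exact forms\<close>

lemma cpt_supp_mult_left: "cpt_supp T f \<Longrightarrow> cpt_supp T (\<lambda>z. f z * g z :: complex)"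
  unfolding cpt_supp_def by fastforce

lemma cpt_supp_mult_right: "cpt_supp T g \<Longrightarrow> cpt_supp T (\<lambda>z. f z * g z :: complex)"
  unfolding cpt_supp_def by fastforce

text \<open>Twisted Leibniz rule: for \<psi> closed under d - w dt, the product of
  \<open>nabla0 w f\<close> with \<psi> is the ordinary differential d(f \<psi>), so Stokes applies
  as soon as one of the two has compact support.\<close>

lemma wedge_nabla0_left:
  assumes T: "open T" and f: "smooth T f" and \<psi>: "\<psi> \<in> Z1 T (\<lambda>z. - w z)"
    and c: "cpt_supp T f \<or> cpt_supp T \<psi>"
  shows "wedge_integral T (nabla0 w f) \<psi> = 0"
proof -
  let ?P = "\<lambda>z. fst (\<psi> z)" and ?Q = "\<lambda>z. snd (\<psi> z)"
  have P: "smooth T ?P" and Q: "smooth T ?Q" and n: "\<And>z. z \<in> T \<Longrightarrow> nabla1 (\<lambda>z. - w z) \<psi> z = 0"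
    using \<psi> unfolding Z1_def smooth_form_def by auto
  have cPQ: "cpt_supp T ?P" "cpt_supp T ?Q" if "cpt_supp T \<psi>"
    using that unfolding cpt_supp_def by (metis fst_zero snd_zero)+
  have c': "cpt_supp T (\<lambda>z. f z * ?P z)" "cpt_supp T (\<lambda>z. f z * ?Q z)"
    using c cPQ cpt_supp_mult_left[of T f] cpt_supp_mult_right[of T _ f] by metis+
  note SP = stokes_smooth[OF T smooth_mult[OF f P] c'(1)]
  note SQ = stokes_smooth[OF T smooth_mult[OF f Q] c'(2)]
  have "(LINT z:T|lborel. fst (nabla0 w f z) * ?Q z - snd (nabla0 w f z) * ?P z) =
      (LINT z:T|lborel. d_t (\<lambda>z. f z * ?Q z) z - d_tbar (\<lambda>z. f z * ?P z) z)"
  proof (rule set_lebesgue_integral_cong)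
    show "\<forall>z. z \<in> T \<longrightarrow> fst (nabla0 w f z) * ?Q z - snd (nabla0 w f z) * ?P z =
        d_t (\<lambda>z. f z * ?Q z) z - d_tbar (\<lambda>z. f z * ?P z) z"
    proof (intro allI impI)
      fix z assume z: "z \<in> T"
      note w = smooth_wirtinger[OF f T z] smooth_wirtinger[OF P T z] smooth_wirtinger[OF Q T z]
      show "fst (nabla0 w f z) * ?Q z - snd (nabla0 w f z) * ?P z =
          d_t (\<lambda>z. f z * ?Q z) z - d_tbar (\<lambda>z. f z * ?P z) z"
        unfolding wirtinger_d_t[OF wirtinger_mult[OF w(1,3)]] wirtinger_d_tbar[OF wirtinger_mult[OF w(1,2)]]
        using n[OF z] unfolding nabla1_def nabla0_def fst_conv snd_conv by algebra
    qed
  qed (use T in simp)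
  also have "\<dots> = 0" using SQ SP by (simp add: set_integral_diff)
  finally show ?thesis unfolding wedge_integral_def by simp
qed

lemma wedge_commute: "wedge_integral T \<psi> \<psi>' = - wedge_integral T \<psi>' \<psi>"
proof -
  have "fst (\<psi> z) * snd (\<psi>' z) - snd (\<psi> z) * fst (\<psi>' z) = - (fst (\<psi>' z) * snd (\<psi> z) - snd (\<psi>' z) * fst (\<psi> z))"
    for z by simp
  then show ?thesis unfolding wedge_integral_def set_lebesgue_integral_def by (simp only: scaleR_minus_right) simp
qed

lemma wedge_nabla0_right:
  assumes "open T" "smooth T g" "\<psi> \<in> Z1 T w" "cpt_supp T \<psi>"
  shows "wedge_integral T \<psi> (nabla0 (\<lambda>z. - w z) g) = 0"
  unfolding wedge_commute[of T \<psi>] using wedge_nabla0_left[of T g \<psi> "\<lambda>z. - w z"] assms by simp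

section \<open>Radial bump functions\<close>

text \<open>The function exp(- 1/s) alone is not stable under differentiation. Allowing a polynomial
  in 1/s as a factor gives a family that is, so smoothness can be proved by induction for all
  \<open>P\<close> at once.\<close>

definition flat :: "real poly \<Rightarrow> real \<Rightarrow> real" where
  "flat P s = (if 0 < s then poly P (inverse s) * exp (- inverse s) else 0)"

lemma poly_times_exp_uminus_tendsto_0:
  "((\<lambda>y::real. poly P y * exp (- y)) \<longlongrightarrow> 0) at_top"
proof -
  have "((\<lambda>y. \<Sum>i\<le>degree P. coeff P i * (y ^ i / exp y)) \<longlongrightarrow> (\<Sum>i\<le>degree P. coeff P i * 0)) at_top"
    by (intro tendsto_sum tendsto_mult tendsto_const tendsto_power_div_exp_0)
  then show ?thesis
    by (simp add: poly_altdef sum_distrib_right exp_minus divide_inverse mult.assoc)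
qed

lemma flat_tendsto_0: "(flat P \<longlongrightarrow> 0) (at 0)"
proof (rule filterlim_split_at)
  show "(flat P \<longlongrightarrow> 0) (at_left 0)"
    by (rule Lim_transform_eventually[OF tendsto_const])
       (auto simp: flat_def eventually_at_left_field intro: exI[of _ "-1"])
  have "((\<lambda>s. poly P (inverse s) * exp (- inverse s)) \<longlongrightarrow> 0) (at_right 0)"
    by (rule filterlim_compose[OF poly_times_exp_uminus_tendsto_0 filterlim_inverse_at_top_right])
  then show "(flat P \<longlongrightarrow> 0) (at_right 0)"
    by (rule Lim_transform_eventually)
       (auto simp: flat_def eventually_at_right_field intro: exI[of _ "1"])
qed

text \<open>With y = 1/s, differentiation in s is - y^2 d/dy, which turns P exp(-y) into y^2 (P -
  P') exp(-y). At 0 the difference quotient is again a member of the family, with y P in place of P,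
  and tends to 0.\<close>

lemma DERIV_flat:
  "(flat P has_real_derivative flat ([:0, 0, 1:] * (P - pderiv P)) s) (at s)"
proof (cases s "0 :: real" rule: linorder_cases)
  case less
  have "((\<lambda>_. 0) has_real_derivative 0) (at s)" by simp
  then have "(flat P has_real_derivative 0) (at s)"
    by (rule has_field_derivative_transform_within_open[where S = "{..<0}"]) (use less in \<open>auto simp: flat_def\<close>)
  with less show ?thesis by (simp add: flat_def)
next
  case equal
  have "((\<lambda>h. (flat P (0 + h) - flat P 0) / h) \<longlongrightarrow> 0) (at 0)"
  proof (rule Lim_transform_eventually[OF flat_tendsto_0[of "[:0, 1:] * P"]])
    show "\<forall>\<^sub>F h in at 0. flat ([:0, 1:] * P) h = (flat P (0 + h) - flat P 0) / h"
      by (rule eventuallyI) (simp add: flat_def divide_inverse)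
  qed
  then have "(flat P has_real_derivative 0) (at 0)"
    unfolding DERIV_def .
  with equal show ?thesis by (simp add: flat_def)
next
  case greater
  have "((\<lambda>s. poly P (inverse s) * exp (- inverse s)) has_real_derivative
      poly ([:0, 0, 1:] * (P - pderiv P)) (inverse s) * exp (- inverse s)) (at s)"
    using greater
    by (auto intro!: derivative_eq_intros poly_DERIV simp: algebra_simps power2_eq_square)
  then have "(flat P has_real_derivative poly ([:0, 0, 1:] * (P - pderiv P)) (inverse s) * exp (- inverse s)) (at s)"
    by (rule has_field_derivative_transform_within_open[where S = "{0<..}"]) (use greater in \<open>auto simp: flat_def\<close>)
  with greater show ?thesis by (simp add: flat_def)
qed

lemma smooth_flat_comp:
  assumes T: "open T" and A: "smooth T A" and B: "smooth T B"
    and r: "\<And>z. z \<in> T \<Longrightarrow> wirtinger (\<lambda>z. of_real (r z)) (A z) (B z) z"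
  shows "smooth T (\<lambda>z. of_real (flat P (r z)))"
proof -
  have "Ck n T (\<lambda>z. of_real (flat P (r z)))" for n
  proof (induction n arbitrary: P)
    case 0
    have "(\<lambda>z. of_real (flat P (r z)) :: complex) differentiable (at z)" if "z \<in> T" for z
      using wirtinger_of_real_comp[OF DERIV_flat r[OF that]] wirtinger_differentiable by blast
    then show ?case unfolding Ck.simps
      using differentiable_imp_continuous_within by (intro continuous_at_imp_continuous_on) blast
  next
    case (Suc n)
    show ?case
      by (rule Ck_SucI[OF T _ _ wirtinger_of_real_comp[OF DERIV_flat r]])
         (use A B Suc.IH in \<open>auto intro!: Ck_mult simp: smooth_def\<close>)
  qed
  then show ?thesis by (simp add: smooth_def)
qed

text \<open>The variable is a squared relative radius: the interval from 1/4 to 1/2 becomes the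
  annulus between r/2 and r/sqrt 2.\<close>

definition bump_density :: "real \<Rightarrow> real" where
  "bump_density s = flat 1 (s - 1/4) * flat 1 (1/2 - s)"

lemma bump_density_nonneg: "0 \<le> bump_density s"
  by (simp add: bump_density_def flat_def)

lemma bump_density_pos: "1/4 < s \<Longrightarrow> s < 1/2 \<Longrightarrow> 0 < bump_density s"
  by (simp add: bump_density_def flat_def)

lemma bump_density_eq_0: "s \<le> 1/4 \<or> 1/2 \<le> s \<Longrightarrow> bump_density s = 0"
  by (auto simp: bump_density_def flat_def)

lemma DERIV_bump_density: "\<exists>D. (bump_density has_real_derivative D) (at s)"
proof -
  have 1: "((\<lambda>s. flat 1 (s - 1/4)) has_real_derivative flat ([:0, 0, 1:] * (1 - pderiv 1)) (s - 1/4) * 1) (at s)"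
    by (rule DERIV_chain2[OF DERIV_flat]) (auto intro!: derivative_eq_intros)
  have 2: "((\<lambda>s. flat 1 (1/2 - s)) has_real_derivative flat ([:0, 0, 1:] * (1 - pderiv 1)) (1/2 - s) * (- 1)) (at s)"
    by (rule DERIV_chain2[OF DERIV_flat]) (auto intro!: derivative_eq_intros)
  show ?thesis unfolding bump_density_def[abs_def] using DERIV_mult[OF 1 2] by blast
qed

lemma continuous_bump_density: "continuous_on S bump_density"
  using DERIV_bump_density DERIV_isCont by (blast intro: continuous_at_imp_continuous_on)

definition bump_mass :: real where
  "bump_mass = integral {0..1/2} bump_density"

lemma bump_mass_pos: "0 < bump_mass"
proof -
  have "bump_mass \<noteq> 0" unfolding bump_mass_def
  proof
    assume "integral {0..1/2} bump_density = 0"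
    then have "\<forall>s\<in>{0..1/2}. bump_density s = 0"
      by (subst (asm) integral_eq_0_iff) (auto simp: continuous_bump_density bump_density_nonneg)
    then have "bump_density (3/8) = 0" by auto
    with bump_density_pos[of "3/8"] show False by simp
  qed
  moreover have "0 \<le> bump_mass" unfolding bump_mass_def
    by (intro integral_nonneg integrable_continuous_real continuous_bump_density bump_density_nonneg)
  ultimately show ?thesis by simp
qed

text \<open>The lower limit -1 makes 0 an interior point: squared radii start at 0, and a two-sided
  derivative is needed there.\<close>

definition cutoff :: "real \<Rightarrow> real" where
  "cutoff s = 1 - integral {-1..s} bump_density / bump_mass"

lemma DERIV_cutoff:
  assumes "-1 < s"
  shows "(cutoff has_real_derivative - bump_density s / bump_mass) (at s)"
proof -
  have "((\<lambda>x. integral {-1..x} bump_density) has_real_derivative bump_density s) (at s within {-1..s+1})"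
    by (rule integral_has_real_derivative) (use assms in \<open>auto intro: continuous_bump_density\<close>)
  moreover have "at s within {-1..s+1} = at s"
    by (rule at_within_interior) (use assms in auto)
  ultimately have "((\<lambda>x. integral {-1..x} bump_density) has_real_derivative bump_density s) (at s)" by simp
  from DERIV_diff[OF DERIV_const[of 1] DERIV_cdivide[OF this, of bump_mass]]
  show ?thesis unfolding cutoff_def[abs_def] by simp
qed

lemma integral_bump_density_0: "s \<le> 1/4 \<Longrightarrow> integral {-1..s} bump_density = 0"
  by (rule integral_unique, rule has_integral_is_0) (simp add: bump_density_eq_0)

lemma cutoff_eq_1: "s \<le> 1/4 \<Longrightarrow> cutoff s = 1"
  by (simp add: cutoff_def integral_bump_density_0)

lemma cutoff_eq_0:
  assumes "1/2 \<le> s" shows "cutoff s = 0"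
proof -
  have int: "bump_density integrable_on {a..b}" for a b
    by (intro integrable_continuous_real continuous_bump_density)
  have "integral {1/2..s} bump_density = 0"
    by (rule integral_unique, rule has_integral_is_0) (simp add: bump_density_eq_0)
  moreover have "integral {-1..0} bump_density = 0"
    by (rule integral_bump_density_0) simp
  moreover have "integral {-1..0} bump_density + integral {0..1/2} bump_density = integral {-1..1/2} bump_density"
    "integral {-1..1/2} bump_density + integral {1/2..s} bump_density = integral {-1..s} bump_density"
    using assms by (auto intro!: Henstock_Kurzweil_Integration.integral_combine int)
  ultimately have "integral {-1..s} bump_density = bump_mass"
    unfolding bump_mass_def by simp
  then show ?thesis unfolding cutoff_def using bump_mass_pos by simp
qed

text \<open>The squared norm is polynomial in z and its conjugate, so the cutoff is smooth at the
  centre as well.\<close>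

definition radius2 :: "complex \<Rightarrow> real \<Rightarrow> complex \<Rightarrow> real" where
  "radius2 p r z = (norm (z - p) / r)\<^sup>2"

definition bump :: "complex \<Rightarrow> real \<Rightarrow> complex \<Rightarrow> complex" where
  "bump p r z = of_real (cutoff (radius2 p r z))"

text \<open>The radial factor common to both derivatives of \<open>bump\<close>: \<open>d_t\<close>
  carries the cofactor \<open>cnj (z - p)\<close>, \<open>d_tbar\<close> the cofactor
  \<open>z - p\<close>.\<close>

definition bump_coeff :: "complex \<Rightarrow> real \<Rightarrow> complex \<Rightarrow> real" where
  "bump_coeff p r z = - bump_density (radius2 p r z) / (bump_mass * r\<^sup>2)"

lemma radius2_nonneg: "0 \<le> radius2 p r z"
  by (simp add: radius2_def)

lemma wirtinger_shift: "wirtinger (\<lambda>z. z - p) 1 0 z" and wirtinger_cnj_shift: "wirtinger (\<lambda>z. cnj (z - p)) 0 1 z"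
  unfolding wirtinger_def by (auto intro!: derivative_eq_intros)

lemma smooth_shift: "smooth T (\<lambda>z. z - p)" and smooth_cnj_shift: "smooth T (\<lambda>z. cnj (z - p))"
proof -
  have "smooth UNIV (\<lambda>z. z - p)"
    by (intro smooth_holomorphic holomorphic_intros open_UNIV)
  then show "smooth T (\<lambda>z. z - p)" by (rule smooth_subset) simp
  have "Ck n UNIV (\<lambda>z. cnj (z - p))" for n
    by (rule Ck_SucD, rule Ck_SucI[OF open_UNIV Ck_const Ck_const wirtinger_cnj_shift])
  then show "smooth T (\<lambda>z. cnj (z - p))" using smooth_subset[of UNIV] by (simp add: smooth_def)
qed

lemma wirtinger_radius2:
  "wirtinger (\<lambda>z. of_real (radius2 p r z)) (of_real (1 / r\<^sup>2) * cnj (z - p)) (of_real (1 / r\<^sup>2) * (z - p)) z"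
proof -
  have "of_real (radius2 p r z) = of_real (1 / r\<^sup>2) * ((z - p) * cnj (z - p))" for z
    unfolding complex_norm_square[symmetric] radius2_def by (simp add: power_divide)
  then have eq: "(\<lambda>z. of_real (radius2 p r z)) = (\<lambda>z. of_real (1 / r\<^sup>2) * ((z - p) * cnj (z - p)))"
    by (rule ext)
  show ?thesis unfolding eq
    using wirtinger_cmult[OF wirtinger_mult[OF wirtinger_shift[of p z] wirtinger_cnj_shift[of p z]], of "of_real (1 / r\<^sup>2)"] by simp
qed

lemma smooth_bump_coeff: "smooth T (\<lambda>z. of_real (bump_coeff p r z))"
proof -
  note sm = smooth_mult[OF smooth_const[of UNIV "of_real (1 / r\<^sup>2)"] smooth_cnj_shift[of UNIV p]]
    smooth_mult[OF smooth_const[of UNIV "of_real (1 / r\<^sup>2)"] smooth_shift[of UNIV p]]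
  have 1: "smooth UNIV (\<lambda>z. of_real (flat 1 (radius2 p r z - 1/4)))"
    by (rule smooth_flat_comp[OF open_UNIV sm])
       (use wirtinger_diff[OF wirtinger_radius2 wirtinger_const[of "of_real (1/4)"]] in \<open>simp only: of_real_diff diff_0_right\<close>)
  have 2: "smooth UNIV (\<lambda>z. of_real (flat 1 (1/2 - radius2 p r z)))"
    by (rule smooth_flat_comp[OF open_UNIV smooth_minus[OF sm(1)] smooth_minus[OF sm(2)]])
       (use wirtinger_diff[OF wirtinger_const[of "of_real (1/2)"] wirtinger_radius2] in \<open>simp only: of_real_diff diff_0\<close>)
  have "smooth UNIV (\<lambda>z. of_real (- 1 / (bump_mass * r\<^sup>2)) *
      (of_real (flat 1 (radius2 p r z - 1/4)) * of_real (flat 1 (1/2 - radius2 p r z))))"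
    by (intro smooth_mult smooth_const 1 2)
  then have "smooth UNIV (\<lambda>z. of_real (bump_coeff p r z))"
    by (rule smooth_cong[OF open_UNIV]) (simp add: bump_coeff_def bump_density_def)
  then show ?thesis by (rule smooth_subset) simp
qed

lemma wirtinger_bump: "wirtinger (bump p r) (of_real (bump_coeff p r z) * cnj (z - p)) (of_real (bump_coeff p r z) * (z - p)) z"
proof -
  have "-1 < radius2 p r z" using radius2_nonneg[of p r z] by linarith
  from wirtinger_of_real_comp[OF DERIV_cutoff[OF this] wirtinger_radius2]
  show ?thesis unfolding bump_def[abs_def] bump_coeff_def by (simp add: field_simps)
qed

lemma smooth_bump: "smooth T (bump p r)"
proof -
  have "Ck n UNIV (bump p r)" for n
    by (rule Ck_SucD, rule Ck_SucI[OF open_UNIV _ _ wirtinger_bump])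
       (use smooth_mult[OF smooth_bump_coeff smooth_cnj_shift] smooth_mult[OF smooth_bump_coeff smooth_shift]
         in \<open>auto simp: smooth_def\<close>)
  then show ?thesis using smooth_subset[of UNIV] by (simp add: smooth_def)
qed

lemma d_t_bump: "d_t (bump p r) = (\<lambda>z. of_real (bump_coeff p r z) * cnj (z - p))"
  by (rule ext) (rule wirtinger_d_t[OF wirtinger_bump])

lemma d_tbar_bump: "d_tbar (bump p r) = (\<lambda>z. of_real (bump_coeff p r z) * (z - p))"
  by (rule ext) (rule wirtinger_d_tbar[OF wirtinger_bump])

text \<open>Radial symmetry decides it: both sides are |z - p|^2 times the same real factor, plus
  \<open>bump_coeff\<close>.\<close>

lemma d_t_d_tbar_bump: "d_t (d_tbar (bump p r)) z = d_tbar (d_t (bump p r)) z"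
proof -
  obtain D where "(bump_density has_real_derivative D) (at (radius2 p r z))"
    using DERIV_bump_density by blast
  from DERIV_cdivide[OF DERIV_minus[OF this], of "bump_mass * r\<^sup>2"]
  have "((\<lambda>s. - bump_density s / (bump_mass * r\<^sup>2)) has_real_derivative - D / (bump_mass * r\<^sup>2)) (at (radius2 p r z))" .
  note k = wirtinger_of_real_comp[OF this wirtinger_radius2, folded bump_coeff_def]
  show ?thesis unfolding d_t_bump d_tbar_bump
      wirtinger_d_t[OF wirtinger_mult[OF k wirtinger_shift]] wirtinger_d_tbar[OF wirtinger_mult[OF k wirtinger_cnj_shift]]
    by (simp add: algebra_simps)
qed

section \<open>Supports and total mass of the cutoffs\<close>

lemma bump_eq_1: "0 < r \<Longrightarrow> norm (z - p) \<le> r / 2 \<Longrightarrow> bump p r z = 1"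
proof -
  assume "0 < r" "norm (z - p) \<le> r / 2"
  then have "norm (z - p) / r \<le> 1/2" by (simp add: field_simps)
  then have "radius2 p r z \<le> (1/2)\<^sup>2" unfolding radius2_def
    by (intro power_mono) (use \<open>0 < r\<close> in auto)
  then show ?thesis unfolding bump_def by (simp add: cutoff_eq_1 power2_eq_square)
qed

text \<open>The outer radius is rounded up: (3/4)^2 = 9/16 exceeds the end 1/2 of the support of the
  density.\<close>

lemma bump_eq_0: "0 < r \<Longrightarrow> 3/4 * r \<le> norm (z - p) \<Longrightarrow> bump p r z = 0"
proof -
  assume "0 < r" "3/4 * r \<le> norm (z - p)"
  then have "3/4 \<le> norm (z - p) / r" by (simp add: field_simps)
  then have "(3/4)\<^sup>2 \<le> radius2 p r z" unfolding radius2_def by (intro power_mono) auto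
  then show ?thesis unfolding bump_def by (simp add: cutoff_eq_0 power2_eq_square)
qed

lemma bump_coeff_eq_0: "0 < r \<Longrightarrow> norm (z - p) \<le> r / 2 \<or> 3/4 * r \<le> norm (z - p) \<Longrightarrow> bump_coeff p r z = 0"
proof -
  assume *: "0 < r" "norm (z - p) \<le> r / 2 \<or> 3/4 * r \<le> norm (z - p)"
  from *(2) have "radius2 p r z \<le> 1/4 \<or> 1/2 \<le> radius2 p r z"
  proof
    assume "norm (z - p) \<le> r / 2"
    then have "norm (z - p) / r \<le> 1/2" using * by (simp add: field_simps)
    then have "radius2 p r z \<le> (1/2)\<^sup>2" unfolding radius2_def
      by (intro power_mono) (use * in auto)
    then show ?thesis by (simp add: power2_eq_square)
  next
    assume "3/4 * r \<le> norm (z - p)"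
    then have "3/4 \<le> norm (z - p) / r" using * by (simp add: field_simps)
    then have "(3/4)\<^sup>2 \<le> radius2 p r z" unfolding radius2_def by (intro power_mono) auto
    then show ?thesis by (simp add: power2_eq_square)
  qed
  then show ?thesis by (simp add: bump_coeff_def bump_density_eq_0)
qed

text \<open>In polar coordinates this mass is - \<pi> for every r > 0, which is the source of the
  factor 2 \<pi> \<i> in the intersection numbers. The factor is common to all of them and cancels,
  so it is kept symbolic.\<close>

definition bump_total :: "real \<Rightarrow> complex" where
  "bump_total r = (LINT z|lborel. of_real (bump_coeff 0 r z))"

lemma integrable_bump_coeff:
  assumes "0 < r"
  shows "integrable lborel (\<lambda>z. of_real (bump_coeff p r z) :: complex)"
  using set_integrable_cpt_supp[OF smooth_continuous[OF smooth_bump_coeff[of UNIV p r]], of "cball p r"]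
    bump_coeff_eq_0[OF assms, of _ p] assms
  unfolding set_integrable_def
  by (auto simp: dist_norm norm_minus_commute)

lemma bump_total_translate: "(LINT z|lborel. of_real (bump_coeff p r z)) = bump_total r"
proof -
  have "(\<lambda>z. of_real (bump_coeff p r z) :: complex) \<in> borel_measurable borel"
    by (intro borel_measurable_continuous_onI smooth_continuous smooth_bump_coeff)
  from lborel_integral_translation[OF this, of p, symmetric]
  show ?thesis unfolding bump_total_def by (simp add: bump_coeff_def radius2_def)
qed

text \<open>The integrand is continuous and of constant sign; a zero integral would make the
  nonempty open set where it is nonzero negligible.\<close>

lemma bump_total_nonzero:
  assumes "0 < r"
  shows "bump_total r \<noteq> 0"
proof
  assume "bump_total r = 0"
  then have "(LINT z|lborel. bump_coeff 0 r z) = 0"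
    unfolding bump_total_def by simp
  then have int0: "(LINT z|lborel. - bump_coeff 0 r z) = 0" by simp
  have int: "integrable lborel (\<lambda>z. - bump_coeff 0 r z)"
    using integrable_Re[OF integrable_bump_coeff[OF assms, of 0]] by simp
  have nonneg: "0 \<le> - bump_coeff 0 r z" for z
    unfolding bump_coeff_def using bump_density_nonneg bump_mass_pos by simp
  have "AE z in lborel. - bump_coeff 0 r z = 0"
    using integral_nonneg_eq_0_iff_AE[OF int] nonneg int0 by auto
  then have "AE z in lborel. bump_coeff 0 r z = 0" by simp
  then have ae: "AE z in lebesgue. bump_coeff 0 r z = 0" by (rule AE_completion)
  let ?S = "{z. bump_coeff 0 r z \<noteq> 0}"
  have "continuous_on UNIV (\<lambda>z. Re (of_real (bump_coeff 0 r z)))"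
    by (intro continuous_on_Re smooth_continuous smooth_bump_coeff)
  then have "continuous_on UNIV (bump_coeff 0 r)" by simp
  from open_Collect_neq[OF this continuous_on_const] have op: "open ?S" .
  have "negligible ?S"
    using ae op by (simp add: completion.AE_iff_null_sets negligible_iff_null_sets)
  \<comment> \<open>(5/8)^2 = 25/64 lies strictly between 1/4 and 1/2.\<close>
  moreover have "of_real (5/8 * r) \<in> ?S"
  proof -
    have "radius2 0 r (of_real (5/8 * r)) = (5/8)\<^sup>2"
      unfolding radius2_def using assms by (simp add: norm_mult)
    then show ?thesis unfolding bump_coeff_def mem_Collect_eq by (simp only:)
      (use bump_density_pos[of "(5/8)\<^sup>2"] bump_mass_pos assms in \<open>simp add: power2_eq_square\<close>)
  qed
  ultimately show False using open_not_negligible[OF op] by blast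
qed

section \<open>Local solutions and monodromy\<close>

lemma bounded_inverse_of_nat_add:
  fixes \<alpha> :: complex
  obtains M where "\<And>n. norm (inverse (of_nat n + \<alpha>)) \<le> M"
proof -
  have "filterlim (\<lambda>n. of_nat n + \<alpha>) at_infinity sequentially"
    using tendsto_add_filterlim_at_infinity'[OF tendsto_of_nat tendsto_const[of \<alpha>]] .
  then have "(\<lambda>n. inverse (of_nat n + \<alpha>)) \<longlonglongrightarrow> 0"
    by (rule filterlim_compose[OF tendsto_inverse_0])
  then have "Bseq (\<lambda>n. inverse (of_nat n + \<alpha>))" by (rule convergent_imp_Bseq[OF convergentI])
  then show ?thesis using that unfolding Bseq_def by blast
qed

text \<open>Power series ansatz: (n + \<alpha>) b_n = c_n. Since \<alpha> is no integer the divisors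
  never vanish, and their inverses are bounded, so the radius of convergence does not
  shrink.\<close>

lemma euler_ode_solution:
  fixes \<alpha> :: complex
  assumes \<alpha>: "\<alpha> \<notin> \<int>" and R: "R holomorphic_on ball 0 r"
  obtains y y' where "\<And>s. s \<in> ball 0 r \<Longrightarrow> (y has_field_derivative y' s) (at s)"
    "\<And>s. s \<in> ball 0 r \<Longrightarrow> s * y' s + \<alpha> * y s = R s"
proof -
  define c where "c n = (deriv ^^ n) R 0 / fact n" for n
  have c: "(\<lambda>n. c n * s ^ n) sums R s" if "s \<in> ball 0 r" for s
    using holomorphic_power_series[OF R that] unfolding c_def by simp
  obtain M where M: "\<And>n. norm (inverse (of_nat n + \<alpha>)) \<le> M"
    using bounded_inverse_of_nat_add by blast
  define b where "b n = c n * inverse (of_nat n + \<alpha>)" for n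
  have sb: "summable (\<lambda>n. b n * s ^ n)" if s: "norm s < r" for s
  proof -
    obtain \<rho> where \<rho>: "norm s < \<rho>" "\<rho> < r" using dense s by blast
    then have "summable (\<lambda>n. c n * of_real \<rho> ^ n)" using c[of "of_real \<rho>"] sums_summable norm_ge_zero[of s] by force
    from powser_insidea[OF this, of s] \<rho> have "summable (\<lambda>n. norm (c n * s ^ n))" by simp
    then have "summable (\<lambda>n. M * norm (c n * s ^ n))" by (rule summable_mult)
    moreover have "norm (b n * s ^ n) \<le> M * norm (c n * s ^ n)" for n
    proof -
      have "norm (b n * s ^ n) = norm (inverse (of_nat n + \<alpha>)) * norm (c n * s ^ n)"
        unfolding b_def norm_mult by (simp add: mult_ac)
      also have "\<dots> \<le> M * norm (c n * s ^ n)" by (intro mult_right_mono M) simp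
      finally show ?thesis .
    qed
    ultimately show ?thesis by (rule summable_comparison_test')
  qed
  define y where "y s = (\<Sum>n. b n * s ^ n)" for s
  define y' where "y' s = (\<Sum>n. diffs b n * s ^ n)" for s
  have 1: "(y has_field_derivative y' s) (at s)" if "s \<in> ball 0 r" for s
    unfolding y_def[abs_def] y'_def using that by (intro termdiffs_strong'[of r] sb) auto
  have 2: "s * y' s + \<alpha> * y s = R s" if s: "s \<in> ball 0 r" for s
  proof -
    have "summable (\<lambda>n. diffs b n * s ^ n)"
      using s by (intro termdiff_converges[of s r] sb) auto
    note d = sums_mult[OF diffs_equiv[OF this], of s]
    have "(\<lambda>n. s * (of_nat n * b n * s ^ (n - Suc 0))) = (\<lambda>n. of_nat n * b n * s ^ n)"
    proof
      show "s * (of_nat n * b n * s ^ (n - Suc 0)) = of_nat n * b n * s ^ n" for n by (cases n) auto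
    qed
    with d have "(\<lambda>n. of_nat n * b n * s ^ n) sums (s * y' s)" unfolding y'_def by (simp only:)
    moreover have "(\<lambda>n. \<alpha> * (b n * s ^ n)) sums (\<alpha> * y s)"
      unfolding y_def using sb s by (intro sums_mult summable_sums) auto
    ultimately have "(\<lambda>n. of_nat n * b n * s ^ n + \<alpha> * (b n * s ^ n)) sums (s * y' s + \<alpha> * y s)"
      by (rule sums_add)
    moreover have "of_nat n * b n * s ^ n + \<alpha> * (b n * s ^ n) = c n * s ^ n" for n
    proof -
      have "of_nat n + \<alpha> \<noteq> 0" using \<alpha> by (metis Ints_minus Ints_of_nat add_eq_0_iff)
      then have "(of_nat n + \<alpha>) * b n = c n" unfolding b_def by simp
      then show ?thesis by (metis distrib_right mult.assoc)
    qed
    ultimately show ?thesis using c[OF s] sums_unique2 by auto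
  qed
  show ?thesis using that[of y y'] 1 2 by blast
qed

text \<open>The gauge factor \<open>exp G\<close> with \<open>G' = g\<close> reduces the equation to the case \<open>g = 0\<close>.\<close>

lemma fuchs_ode_solution:
  fixes \<alpha> :: complex
  assumes \<alpha>: "\<alpha> \<notin> \<int>" and g: "g holomorphic_on ball 0 r" and R: "R holomorphic_on ball 0 r"
  obtains f f' where "\<And>s. s \<in> ball 0 r \<Longrightarrow> (f has_field_derivative f' s) (at s)"
    "\<And>s. s \<in> ball 0 r \<Longrightarrow> s * f' s + (\<alpha> + s * g s) * f s = R s"
proof -
  obtain G where G: "\<And>s. s \<in> ball 0 r \<Longrightarrow> (G has_field_derivative g s) (at s within ball 0 r)"
    using holomorphic_convex_primitive'[OF convex_ball open_ball g] by blast
  have G': "(G has_field_derivative g s) (at s)" if "s \<in> ball 0 r" for s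
    using G[OF that] that by (simp add: at_within_open[OF that])
  then have "G holomorphic_on ball 0 r" using holomorphic_on_open by blast
  then have "(\<lambda>s. R s * exp (G s)) holomorphic_on ball 0 r" by (intro holomorphic_intros R)
  from euler_ode_solution[OF \<alpha> this]
  obtain y y' where y: "\<And>s. s \<in> ball 0 r \<Longrightarrow> (y has_field_derivative y' s) (at s)"
    and eq: "\<And>s. s \<in> ball 0 r \<Longrightarrow> s * y' s + \<alpha> * y s = R s * exp (G s)" by metis
  show ?thesis
  proof (rule that)
    fix s :: complex assume s: "s \<in> ball 0 r"
    show "((\<lambda>s. y s * exp (- G s)) has_field_derivative (y' s * exp (- G s) - y s * g s * exp (- G s))) (at s)"
      by (auto intro!: derivative_eq_intros y[OF s] G'[OF s])
    have "s * (y' s * exp (- G s) - y s * g s * exp (- G s)) + (\<alpha> + s * g s) * (y s * exp (- G s)) =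
        (s * y' s + \<alpha> * y s) * exp (- G s)" by (simp add: algebra_simps)
    also have "\<dots> = R s" unfolding eq[OF s] by (simp add: exp_minus)
    finally show "s * (y' s * exp (- G s) - y s * g s * exp (- G s)) + (\<alpha> + s * g s) * (y s * exp (- G s)) = R s" .
  qed
qed

text \<open>Continuing a solution along the circle multiplies it by \<open>exp (-2 \<pi> \<i> \<alpha>)\<close>.\<close>

lemma monodromy_zero:
  fixes \<alpha> :: complex
  assumes \<alpha>: "\<alpha> \<notin> \<int>" and z1: "z1 \<noteq> z0"
    and f: "\<And>z. norm (z - z0) = norm (z1 - z0) \<Longrightarrow>
      (f has_field_derivative - (\<alpha> / (z - z0) + h z) * f z) (at z)"
    and H: "\<And>z. norm (z - z0) = norm (z1 - z0) \<Longrightarrow> (H has_field_derivative h z) (at z)"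
  shows "f z1 = 0"
proof -
  define \<gamma> where "\<gamma> \<theta> = z0 + (z1 - z0) * exp (\<i> * of_real \<theta>)" for \<theta> :: real
  have \<gamma>n: "norm (\<gamma> \<theta> - z0) = norm (z1 - z0)" for \<theta>
    unfolding \<gamma>_def by (simp add: norm_mult)
  have \<gamma>: "(\<gamma> has_vector_derivative \<i> * (\<gamma> \<theta> - z0)) (at \<theta>)" for \<theta>
  proof -
    have "((\<lambda>x. z0 + (z1 - z0) * exp (\<i> * x)) has_field_derivative \<i> * (\<gamma> \<theta> - z0)) (at (of_real \<theta>))"
      unfolding \<gamma>_def by (auto intro!: derivative_eq_intros)
    then show ?thesis unfolding \<gamma>_def by (rule has_vector_derivative_real_field)
  qed
  \<comment> \<open>The factor exp H removes the regular part h. It is single-valued on the circle,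
    so all monodromy comes from \<alpha>.\<close>
  define F where "F z = f z * exp (H z)" for z
  have F: "(F has_field_derivative - (\<alpha> / (\<gamma> \<theta> - z0)) * F (\<gamma> \<theta>)) (at (\<gamma> \<theta>))" for \<theta>
    unfolding F_def using f[OF \<gamma>n] H[OF \<gamma>n]
    by (auto intro!: derivative_eq_intros simp: algebra_simps)
  have ne: "\<gamma> \<theta> - z0 \<noteq> 0" for \<theta> using z1 unfolding \<gamma>_def by simp
  \<comment> \<open>Along the circle F behaves like exp(- \<i> \<alpha> \<theta>). Undoing this
    factor gives a constant, and comparing the angles 0 and 2 \<pi> forces F z1 = 0.\<close>
  define Y where "Y \<theta> = F (\<gamma> \<theta>) * exp (\<i> * \<alpha> * of_real \<theta>)" for \<theta>
  have "(Y has_vector_derivative 0) (at \<theta>)" for \<theta>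
  proof -
    have 1: "((\<lambda>\<theta>. F (\<gamma> \<theta>)) has_vector_derivative (- \<i> * \<alpha> * F (\<gamma> \<theta>))) (at \<theta>)"
    proof -
      have "\<i> * (\<gamma> \<theta> - z0) * (- (\<alpha> / (\<gamma> \<theta> - z0)) * F (\<gamma> \<theta>)) = - \<i> * \<alpha> * F (\<gamma> \<theta>)"
        using ne[of \<theta>] by (simp add: divide_simps)
      with field_vector_diff_chain_at[OF \<gamma> F, of \<theta>] show ?thesis by (simp only: o_def)
    qed
    have "((\<lambda>x. exp (\<i> * \<alpha> * x)) has_field_derivative \<i> * \<alpha> * exp (\<i> * \<alpha> * of_real \<theta>)) (at (of_real \<theta>))"
      by (auto intro!: derivative_eq_intros)
    then have 2: "((\<lambda>\<theta>. exp (\<i> * \<alpha> * of_real \<theta>)) has_vector_derivative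
        \<i> * \<alpha> * exp (\<i> * \<alpha> * of_real \<theta>)) (at \<theta>)" by (rule has_vector_derivative_real_field)
    have "F (\<gamma> \<theta>) * (\<i> * \<alpha> * exp (\<i> * \<alpha> * of_real \<theta>)) + - \<i> * \<alpha> * F (\<gamma> \<theta>) * exp (\<i> * \<alpha> * of_real \<theta>) = 0"
      by simp
    with has_vector_derivative_mult[OF 1 2] show ?thesis unfolding Y_def by (simp only:)
  qed
  from has_vector_derivative_zero_constant[OF convex_UNIV this]
  have "Y (2 * pi) = Y 0" by (metis UNIV_I)
  moreover have "\<gamma> (2 * pi) = z1" "\<gamma> 0 = z1"
    unfolding \<gamma>_def using exp_two_pi_i by (simp_all add: mult_ac)
  ultimately have eq: "F z1 * (exp (\<i> * \<alpha> * of_real (2 * pi)) - 1) = 0"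
    unfolding Y_def by (simp add: algebra_simps)
  have "exp (\<i> * \<alpha> * of_real (2 * pi)) \<noteq> 1"
  proof
    assume "exp (\<i> * \<alpha> * of_real (2 * pi)) = 1"
    then obtain n :: int where n: "Im \<alpha> = 0" "Re \<alpha> * (2 * pi) = of_int (2 * n) * pi"
      unfolding exp_eq_1 by auto
    then have "Re \<alpha> = of_int n" by simp
    with n(1) have "\<alpha> = of_int n" by (simp add: complex_eq_iff)
    with \<alpha> show False by simp
  qed
  with eq show ?thesis unfolding F_def by simp
qed

section \<open>Twisted cohomology and the intersection pairing\<close>

definition lincomb :: "('i::finite \<Rightarrow> complex) \<Rightarrow> ('i \<Rightarrow> form1) \<Rightarrow> form1" where
  "lincomb c \<psi> = (\<lambda>z. (\<Sum>l\<in>UNIV. c l * fst (\<psi> l z), \<Sum>l\<in>UNIV. c l * snd (\<psi> l z)))"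

lemma nabla0_add:
  "open T \<Longrightarrow> smooth T f \<Longrightarrow> smooth T g \<Longrightarrow> z \<in> T \<Longrightarrow>
    nabla0 w (\<lambda>z. f z + g z) z = nabla0 w f z + nabla0 w g z"
  unfolding nabla0_def
  by (simp add: wirtinger_d_t[OF wirtinger_add[OF smooth_wirtinger smooth_wirtinger]] wirtinger_d_tbar[OF wirtinger_add[OF smooth_wirtinger smooth_wirtinger]]
      algebra_simps)

lemma nabla0_minus:
  "open T \<Longrightarrow> smooth T f \<Longrightarrow> z \<in> T \<Longrightarrow> nabla0 w (\<lambda>z. - f z) z = - nabla0 w f z"
  unfolding nabla0_def
  by (simp add: wirtinger_d_t[OF wirtinger_minus[OF smooth_wirtinger]] wirtinger_d_tbar[OF wirtinger_minus[OF smooth_wirtinger]])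

lemma nabla0_zero: "nabla0 w (\<lambda>_. 0) z = 0"
  unfolding nabla0_def by (simp add: wirtinger_d_t[OF wirtinger_const] wirtinger_d_tbar[OF wirtinger_const] zero_prod_def)

lemma nabla0_lincomb:
  assumes "open T" "\<And>l. smooth T (f l)" "z \<in> T"
  shows "nabla0 w (\<lambda>z. \<Sum>l\<in>UNIV. c l * f l z) z = lincomb c (\<lambda>l. nabla0 w (f l)) z"
  unfolding nabla0_def lincomb_def
  by (simp add: wirtinger_d_t[OF wirtinger_sum[OF wirtinger_cmult[OF smooth_wirtinger[OF assms(2,1,3)]]]]
      wirtinger_d_tbar[OF wirtinger_sum[OF wirtinger_cmult[OF smooth_wirtinger[OF assms(2,1,3)]]]]
      sum_distrib_left distrib_left sum.distrib mult_ac)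

lemma lincomb_add: "lincomb c (\<lambda>l z. \<psi> l z + \<psi>' l z) z = lincomb c \<psi> z + lincomb c \<psi>' z"
  unfolding lincomb_def by (simp add: distrib_left sum.distrib)

lemma lincomb_cong: "(\<And>l. \<psi> l z = \<psi>' l z) \<Longrightarrow> lincomb c \<psi> z = lincomb c \<psi>' z"
  unfolding lincomb_def by simp

lemma Z1_lincomb:
  assumes T: "open T" and \<psi>: "\<And>l. \<psi> l \<in> Z1 T w"
  shows "lincomb c \<psi> \<in> Z1 T w"
proof -
  have P: "\<And>l. smooth T (\<lambda>z. fst (\<psi> l z))" and Q: "\<And>l. smooth T (\<lambda>z. snd (\<psi> l z))"
    and n: "\<And>l z. z \<in> T \<Longrightarrow> nabla1 w (\<psi> l) z = 0"
    using \<psi> unfolding Z1_def smooth_form_def by auto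
  have "nabla1 w (lincomb c \<psi>) z = 0" if z: "z \<in> T" for z
  proof -
    have "nabla1 w (lincomb c \<psi>) z = (\<Sum>l\<in>UNIV. c l * nabla1 w (\<psi> l) z)"
      unfolding nabla1_def lincomb_def fst_conv snd_conv
        wirtinger_d_t[OF wirtinger_sum[OF wirtinger_cmult[OF smooth_wirtinger[OF Q T z]]]]
        wirtinger_d_tbar[OF wirtinger_sum[OF wirtinger_cmult[OF smooth_wirtinger[OF P T z]]]]
      by (simp add: sum_distrib_left sum.distrib sum_subtractf algebra_simps)
    then show ?thesis using n[OF z] by simp
  qed
  then show ?thesis
    unfolding Z1_def smooth_form_def by (auto simp: lincomb_def intro!: smooth_sum smooth_mult smooth_const P Q)
qed

section \<open>The relation of being cohomologous\<close>

lemma cohomI: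
  "\<psi> \<in> Z1 T w \<Longrightarrow> \<psi>' \<in> Z1 T w \<Longrightarrow> smooth T f \<Longrightarrow> (\<And>z. z \<in> T \<Longrightarrow> \<psi> z = \<psi>' z + nabla0 w f z) \<Longrightarrow>
    (\<psi>, \<psi>') \<in> cohom T w"
  unfolding cohom_def by blast

lemma cohom_refl: "\<psi> \<in> Z1 T w \<Longrightarrow> (\<psi>, \<psi>) \<in> cohom T w"
  by (rule cohomI[OF _ _ smooth_const[of _ 0]]) (auto simp: nabla0_zero)

lemma cohom_sym:
  assumes "open T" "(\<psi>, \<psi>') \<in> cohom T w" shows "(\<psi>', \<psi>) \<in> cohom T w"
proof -
  obtain f where f: "smooth T f" "\<And>z. z \<in> T \<Longrightarrow> \<psi> z = \<psi>' z + nabla0 w f z"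
    and Z: "\<psi> \<in> Z1 T w" "\<psi>' \<in> Z1 T w" using assms(2) unfolding cohom_def by blast
  show ?thesis
    by (rule cohomI[OF Z(2,1) smooth_minus[OF f(1)]]) (simp add: f(2) nabla0_minus[OF assms(1) f(1)])
qed

lemma cohom_trans:
  assumes "open T" "(\<psi>, \<psi>') \<in> cohom T w" "(\<psi>', \<psi>'') \<in> cohom T w" shows "(\<psi>, \<psi>'') \<in> cohom T w"
proof -
  obtain f where f: "smooth T f" "\<And>z. z \<in> T \<Longrightarrow> \<psi> z = \<psi>' z + nabla0 w f z"
    and Z: "\<psi> \<in> Z1 T w" using assms(2) unfolding cohom_def by blast
  obtain g where g: "smooth T g" "\<And>z. z \<in> T \<Longrightarrow> \<psi>' z = \<psi>'' z + nabla0 w g z"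
    and Z': "\<psi>'' \<in> Z1 T w" using assms(3) unfolding cohom_def by blast
  show ?thesis
    by (rule cohomI[OF Z Z' smooth_add[OF f(1) g(1)]])
       (simp add: f(2) g(2) nabla0_add[OF assms(1) f(1) g(1)])
qed

lemma cohom_lincomb:
  assumes T: "open T" and \<psi>: "\<And>l. (\<psi> l, \<psi>' l) \<in> cohom T w"
  shows "(lincomb c \<psi>, lincomb c \<psi>') \<in> cohom T w"
proof -
  have "\<forall>l. \<exists>f. smooth T f \<and> (\<forall>z\<in>T. \<psi> l z = \<psi>' l z + nabla0 w f z)"
    using \<psi> unfolding cohom_def by auto
  then obtain f where f: "\<And>l. smooth T (f l)"
    and eq: "\<And>l z. z \<in> T \<Longrightarrow> \<psi> l z = \<psi>' l z + nabla0 w (f l) z" by metis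
  have Z: "\<And>l. \<psi> l \<in> Z1 T w" "\<And>l. \<psi>' l \<in> Z1 T w" using \<psi> unfolding cohom_def by auto
  show ?thesis
  proof (rule cohomI[OF Z1_lincomb[OF T Z(1)] Z1_lincomb[OF T Z(2)]])
    show "smooth T (\<lambda>z. \<Sum>l\<in>UNIV. c l * f l z)" by (intro smooth_sum smooth_mult smooth_const f)
    fix z assume z: "z \<in> T"
    show "lincomb c \<psi> z = lincomb c \<psi>' z + nabla0 w (\<lambda>z. \<Sum>l\<in>UNIV. c l * f l z) z"
      unfolding nabla0_lincomb[OF T f z] lincomb_add[symmetric] by (rule lincomb_cong) (rule eq[OF z])
  qed
qed

section \<open>Integrability and linearity of the wedge pairing\<close>

lemma cpt_supp_lincomb:
  assumes "\<And>l. cpt_supp T (\<psi> l)" shows "cpt_supp T (lincomb c \<psi>)"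
proof -
  from assms have "\<forall>l. \<exists>K. compact K \<and> K \<subseteq> T \<and> (\<forall>z\<in>T - K. \<psi> l z = 0)" unfolding cpt_supp_def by blast
  then obtain K where K: "\<And>l. compact (K l)" "\<And>l. K l \<subseteq> T" "\<And>l z. z \<in> T - K l \<Longrightarrow> \<psi> l z = 0" by metis
  show ?thesis unfolding cpt_supp_def
    by (rule exI[of _ "\<Union>l. K l"]) (use K in \<open>auto simp: lincomb_def zero_prod_def\<close>)
qed

lemma cpt_supp_diff:
  fixes f g :: "complex \<Rightarrow> 'a::group_add"
  assumes "cpt_supp T f" "cpt_supp T g" shows "cpt_supp T (\<lambda>z. f z - g z)"
proof -
  obtain K K' where "compact K" "K \<subseteq> T" "\<forall>z\<in>T - K. f z = 0" "compact K'" "K' \<subseteq> T" "\<forall>z\<in>T - K'. g z = 0"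
    using assms unfolding cpt_supp_def by blast
  then show ?thesis unfolding cpt_supp_def by (intro exI[of _ "K \<union> K'"]) auto
qed

lemma cpt_supp_cong: "cpt_supp T f \<Longrightarrow> (\<And>z. z \<in> T \<Longrightarrow> f z = g z) \<Longrightarrow> cpt_supp T g"
  unfolding cpt_supp_def by fastforce

lemma wedge_set_integrable:
  assumes "cpt_supp T \<psi> \<or> cpt_supp T \<psi>'" "smooth_form T \<psi>" "smooth_form T \<psi>'"
  shows "set_integrable lborel T (\<lambda>z. fst (\<psi> z) * snd (\<psi>' z) - snd (\<psi> z) * fst (\<psi>' z))"
proof -
  obtain K where K: "compact K" "K \<subseteq> T" "\<And>z. z \<in> T - K \<Longrightarrow> \<psi> z = 0 \<or> \<psi>' z = 0"
    using assms(1) unfolding cpt_supp_def by metis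
  show ?thesis
  proof (rule set_integrable_cpt_supp[OF _ K(1,2)])
    show "continuous_on T (\<lambda>z. fst (\<psi> z) * snd (\<psi>' z) - snd (\<psi> z) * fst (\<psi>' z))"
      using assms(2,3) unfolding smooth_form_def by (intro smooth_continuous smooth_diff smooth_mult) auto
    show "fst (\<psi> z) * snd (\<psi>' z) - snd (\<psi> z) * fst (\<psi>' z) = 0" if "z \<in> T - K" for z
      using K(3)[OF that] by (auto simp: zero_prod_def)
  qed
qed

lemma wedge_lincomb_left:
  assumes T: "open T" and \<psi>: "\<And>l. \<psi> l \<in> Z1c T w" and \<psi>': "\<psi>' \<in> Z1 T w'"
  shows "wedge_integral T (lincomb c \<psi>) \<psi>' = (\<Sum>l\<in>UNIV. c l * wedge_integral T (\<psi> l) \<psi>')"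
proof -
  let ?W = "\<lambda>l z. fst (\<psi> l z) * snd (\<psi>' z) - snd (\<psi> l z) * fst (\<psi>' z)"
  have i: "set_integrable lborel T (?W l)" for l
    using wedge_set_integrable[of T "\<psi> l" \<psi>'] \<psi>[of l] \<psi>' unfolding Z1c_def Z1_def by blast
  have "(LINT z:T|lborel. fst (lincomb c \<psi> z) * snd (\<psi>' z) - snd (lincomb c \<psi> z) * fst (\<psi>' z)) =
      (LINT z:T|lborel. (\<Sum>l\<in>UNIV. c l * ?W l z))"
  proof (rule set_lebesgue_integral_cong)
    have "fst (lincomb c \<psi> z) * snd (\<psi>' z) - snd (lincomb c \<psi> z) * fst (\<psi>' z) = (\<Sum>l\<in>UNIV. c l * ?W l z)" for z
      unfolding lincomb_def fst_conv snd_conv sum_distrib_right sum_subtractf[symmetric]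
      by (simp add: right_diff_distrib mult.assoc)
    then show "\<forall>z. z \<in> T \<longrightarrow> fst (lincomb c \<psi> z) * snd (\<psi>' z) - snd (lincomb c \<psi> z) * fst (\<psi>' z) =
        (\<Sum>l\<in>UNIV. c l * ?W l z)" by blast
  qed (use T in simp)
  also have "\<dots> = (\<Sum>l\<in>UNIV. c l * (LINT z:T|lborel. ?W l z))"
    using i unfolding set_lebesgue_integral_def set_integrable_def
    by (simp add: scaleR_sum_right Bochner_Integration.integral_sum mult_scaleR_right[symmetric]
        del: mult_scaleR_right)
  finally show ?thesis unfolding wedge_integral_def by (simp add: sum_distrib_left mult_ac)
qed

lemma wedge_add_left:
  assumes T: "open T" and "smooth_form T \<psi>1" "smooth_form T \<psi>2" "smooth_form T \<psi>'"
    and "cpt_supp T \<psi>1 \<and> cpt_supp T \<psi>2 \<or> cpt_supp T \<psi>'"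
    and eq: "\<And>z. z \<in> T \<Longrightarrow> \<psi> z = \<psi>1 z + \<psi>2 z"
  shows "wedge_integral T \<psi> \<psi>' = wedge_integral T \<psi>1 \<psi>' + wedge_integral T \<psi>2 \<psi>'"
proof -
  let ?W = "\<lambda>\<psi> z. fst (\<psi> z) * snd (\<psi>' z) - snd (\<psi> z) * fst (\<psi>' z)"
  have "(LINT z:T|lborel. ?W \<psi> z) = (LINT z:T|lborel. ?W \<psi>1 z + ?W \<psi>2 z)"
    by (rule set_lebesgue_integral_cong) (use T eq in \<open>auto simp: algebra_simps\<close>)
  also have "\<dots> = (LINT z:T|lborel. ?W \<psi>1 z) + (LINT z:T|lborel. ?W \<psi>2 z)"
    by (rule set_integral_add) (use assms wedge_set_integrable in blast)+
  finally show ?thesis unfolding wedge_integral_def by (simp add: algebra_simps)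
qed

lemma wedge_add_right:
  assumes "open T" "cpt_supp T \<psi>" "smooth_form T \<psi>" "smooth_form T \<psi>1" "smooth_form T \<psi>2"
    and "\<And>z. z \<in> T \<Longrightarrow> \<psi>' z = \<psi>1 z + \<psi>2 z"
  shows "wedge_integral T \<psi> \<psi>' = wedge_integral T \<psi> \<psi>1 + wedge_integral T \<psi> \<psi>2"
  unfolding wedge_commute[of T \<psi>] using wedge_add_left[of T \<psi>1 \<psi>2 \<psi> \<psi>'] assms by simp

lemma smooth_form_nabla0:
  "open T \<Longrightarrow> smooth T w \<Longrightarrow> smooth T f \<Longrightarrow> smooth_form T (nabla0 w f)"
  unfolding smooth_form_def nabla0_def
  by (auto intro!: smooth_add smooth_mult smooth_d_t smooth_d_tbar)

text \<open>
  The last assumption is injectivity of the natural map from compactly supported cohomology, stated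
  for cochains.
\<close>

locale twisted_cohomology =
  fixes T :: "complex set" and w :: "complex \<Rightarrow> complex"
  assumes open_T: "open T" and smooth_w: "smooth T w"
    and cpt_supp_nabla0D: "\<And>f. smooth T f \<Longrightarrow> cpt_supp T (nabla0 w f) \<Longrightarrow> cpt_supp T f"
begin

text \<open>Two compactly supported cocycles in the same class differ by \<open>nabla0 w f\<close>
  with \<open>f\<close> a priori only smooth; \<open>cpt_supp_nabla0D\<close> makes \<open>f\<close>
  compactly supported, so Stokes removes this term. In the second argument any smooth
  \<open>g\<close> is harmless because \<kappa> has compact support.\<close>

lemma wedge_integral_cohom:
  assumes \<kappa>: "\<kappa> \<in> Z1c T w" and \<psi>: "\<psi> \<in> Z1c T w" "(\<kappa>, \<psi>) \<in> cohom T w"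
    and \<phi>: "(\<phi>, \<psi>') \<in> cohom T (\<lambda>z. - w z)"
  shows "wedge_integral T \<psi> \<psi>' = wedge_integral T \<kappa> \<phi>"
proof -
  obtain f where f: "smooth T f" "\<And>z. z \<in> T \<Longrightarrow> \<kappa> z = \<psi> z + nabla0 w f z"
    using \<psi>(2) unfolding cohom_def by blast
  obtain g where g: "smooth T g" "\<And>z. z \<in> T \<Longrightarrow> \<phi> z = \<psi>' z + nabla0 (\<lambda>z. - w z) g z"
    using \<phi> unfolding cohom_def by blast
  have sm: "smooth_form T \<kappa>" "smooth_form T \<psi>" "smooth_form T \<phi>" "smooth_form T \<psi>'"
    and c: "cpt_supp T \<kappa>" "cpt_supp T \<psi>" and Z: "\<psi>' \<in> Z1 T (\<lambda>z. - w z)" "\<kappa> \<in> Z1 T w"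
    using \<kappa> \<psi> \<phi> unfolding Z1c_def Z1_def cohom_def by auto
  have cf: "cpt_supp T (nabla0 w f)"
    by (rule cpt_supp_cong[OF cpt_supp_diff[OF c]]) (simp add: f(2))
  have "wedge_integral T \<kappa> \<phi> = wedge_integral T \<kappa> \<psi>' + wedge_integral T \<kappa> (nabla0 (\<lambda>z. - w z) g)"
    by (rule wedge_add_right[OF open_T c(1) sm(1,4)])
       (auto intro!: smooth_form_nabla0 open_T smooth_minus smooth_w g)
  also have "wedge_integral T \<kappa> (nabla0 (\<lambda>z. - w z) g) = 0"
    by (rule wedge_nabla0_right[OF open_T g(1) Z(2) c(1)])
  also have "wedge_integral T \<kappa> \<psi>' = wedge_integral T \<psi> \<psi>' + wedge_integral T (nabla0 w f) \<psi>'"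
    by (rule wedge_add_left[OF open_T sm(2) smooth_form_nabla0[OF open_T smooth_w f(1)] sm(4)])
       (use c cf f in auto)
  also have "wedge_integral T (nabla0 w f) \<psi>' = 0"
    by (rule wedge_nabla0_left[OF open_T f(1) Z(1) disjI1[OF cpt_supp_nabla0D[OF f(1) cf]]])
  finally show ?thesis by simp
qed

text \<open>Being an \<open>inv_into\<close>, \<open>jmath\<close> returns some preimage. The class
  of \<kappa> shows that one exists, and every member of whichever class is chosen is compactly
  supported and cohomologous to \<kappa>, which is what \<open>wedge_integral_cohom\<close> asks
  for.\<close>

lemma jmath_class:
  assumes \<kappa>: "\<kappa> \<in> Z1c T w" "(\<phi>, \<kappa>) \<in> cohom T w"
  shows "jmath T w (cohom T w `` {\<phi>}) \<noteq> {}"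
    and "\<psi> \<in> jmath T w (cohom T w `` {\<phi>}) \<Longrightarrow> \<psi> \<in> Z1c T w \<and> (\<kappa>, \<psi>) \<in> cohom T w"
proof -
  have sub: "cohom_c T w \<subseteq> cohom T w" unfolding cohom_c_def cohom_def Z1c_def by blast
  have refl: "(\<psi>, \<psi>) \<in> cohom_c T w" if "\<psi> \<in> Z1c T w" for \<psi>
  proof -
    have "\<exists>f. smooth T f \<and> cpt_supp T f \<and> (\<forall>z\<in>T. \<psi> z = \<psi> z + nabla0 w f z)"
      by (intro exI[of _ "\<lambda>_. 0"])
         (auto simp: smooth_const nabla0_zero cpt_supp_def intro: exI[of _ "{}"])
    with that show ?thesis unfolding cohom_c_def by blast
  qed
  let ?\<Psi> = "cohom T w `` {\<phi>}"
  have "natmap T w (cohom_c T w `` {\<kappa>}) = ?\<Psi>"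
  proof
    show "natmap T w (cohom_c T w `` {\<kappa>}) \<subseteq> ?\<Psi>"
      unfolding natmap_def using sub \<kappa>(2) cohom_trans[OF open_T] by blast
    have "(\<kappa>, \<psi>) \<in> cohom T w" if "(\<phi>, \<psi>) \<in> cohom T w" for \<psi>
      using cohom_trans[OF open_T cohom_sym[OF open_T \<kappa>(2)] that] .
    then show "?\<Psi> \<subseteq> natmap T w (cohom_c T w `` {\<kappa>})"
      unfolding natmap_def using refl[OF \<kappa>(1)] by blast
  qed
  moreover have "cohom_c T w `` {\<kappa>} \<in> H1c T w"
    unfolding H1c_def by (rule quotientI[OF \<kappa>(1)])
  ultimately have "?\<Psi> \<in> natmap T w ` H1c T w" by blast
  from inv_into_into[OF this] f_inv_into_f[OF this]
  have J: "jmath T w ?\<Psi> \<in> H1c T w" "natmap T w (jmath T w ?\<Psi>) = ?\<Psi>" unfolding jmath_def by auto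
  obtain \<kappa>' where \<kappa>': "\<kappa>' \<in> Z1c T w" "jmath T w ?\<Psi> = cohom_c T w `` {\<kappa>'}"
    using quotientE[OF J(1)[unfolded H1c_def]] by metis
  show "jmath T w ?\<Psi> \<noteq> {}" using \<kappa>' refl by blast
  have "(\<kappa>', \<kappa>') \<in> cohom T w" using refl[OF \<kappa>'(1)] sub by blast
  then have "\<kappa>' \<in> natmap T w (jmath T w ?\<Psi>)"
    unfolding natmap_def using refl[OF \<kappa>'(1)] \<kappa>'(2) by blast
  then have "(\<phi>, \<kappa>') \<in> cohom T w" unfolding J(2) by blast
  from cohom_trans[OF open_T cohom_sym[OF open_T \<kappa>(2)] this] have 1: "(\<kappa>, \<kappa>') \<in> cohom T w" .
  assume "\<psi> \<in> jmath T w ?\<Psi>"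
  then have 2: "(\<kappa>', \<psi>) \<in> cohom_c T w" using \<kappa>'(2) by blast
  then have "(\<kappa>', \<psi>) \<in> cohom T w" using sub by blast
  from cohom_trans[OF open_T 1 this] 2 show "\<psi> \<in> Z1c T w \<and> (\<kappa>, \<psi>) \<in> cohom T w"
    unfolding cohom_c_def by blast
qed

text \<open>Both classes are nonempty, so the value described by \<open>THE\<close> is forced; it
  may be computed on any compactly supported representative \<kappa>.\<close>

lemma intersection_eq:
  assumes \<kappa>: "\<kappa> \<in> Z1c T w" "(\<phi>, \<kappa>) \<in> cohom T w" and \<phi>': "\<phi>' \<in> Z1 T (\<lambda>z. - w z)"
  shows "intersection T w (cohom T w `` {\<phi>}) (cohom T (\<lambda>z. - w z) `` {\<phi>'}) = wedge_integral T \<kappa> \<phi>'"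
  unfolding intersection_def
proof (rule the_equality)
  show *: "\<forall>\<psi>\<in>jmath T w (cohom T w `` {\<phi>}). \<forall>\<psi>'\<in>cohom T (\<lambda>z. - w z) `` {\<phi>'}.
      wedge_integral T \<psi> \<psi>' = wedge_integral T \<kappa> \<phi>'"
    using wedge_integral_cohom[OF \<kappa>(1)] jmath_class(2)[OF \<kappa>] by blast
  show "v = wedge_integral T \<kappa> \<phi>'" if "\<forall>\<psi>\<in>jmath T w (cohom T w `` {\<phi>}).
      \<forall>\<psi>'\<in>cohom T (\<lambda>z. - w z) `` {\<phi>'}. wedge_integral T \<psi> \<psi>' = v" for v
  proof -
    obtain \<psi> where \<psi>: "\<psi> \<in> jmath T w (cohom T w `` {\<phi>})" using jmath_class(1)[OF \<kappa>] by blast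
    have "\<phi>' \<in> cohom T (\<lambda>z. - w z) `` {\<phi>'}" using cohom_refl[OF \<phi>'] by blast
    with \<psi> that * show ?thesis by metis
  qed
qed

end

section \<open>Logarithmic connections on the punctured plane\<close>

definition eta :: "('i::finite \<Rightarrow> complex) \<Rightarrow> ('i \<Rightarrow> complex) \<Rightarrow> complex \<Rightarrow> complex" where
  "eta q \<rho> z = (\<Sum>i\<in>UNIV. \<rho> i / (z - q i))"

definition eta_regular :: "('i::finite \<Rightarrow> complex) \<Rightarrow> 'i \<Rightarrow> ('i \<Rightarrow> complex) \<Rightarrow> complex \<Rightarrow> complex" where
  "eta_regular q i \<rho> z = (\<Sum>j\<in>UNIV - {i}. \<rho> j / (z - q j))"

text \<open>The same form seen from infinity: with s = 1/z, \<open>eta\<close> is s times this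
  function, which is holomorphic near s = 0 and takes there the sum of the residues as its
  value.\<close>

definition eta_inf :: "('i::finite \<Rightarrow> complex) \<Rightarrow> ('i \<Rightarrow> complex) \<Rightarrow> complex \<Rightarrow> complex" where
  "eta_inf q \<rho> s = (\<Sum>i\<in>UNIV. \<rho> i / (1 - q i * s))"

lemma eta_split: "eta q \<rho> z = \<rho> i / (z - q i) + eta_regular q i \<rho> z"
  unfolding eta_def eta_regular_def by (simp add: sum.remove[of UNIV i])

lemma eta_eq_eta_inf: "z \<noteq> 0 \<Longrightarrow> eta q \<rho> z = inverse z * eta_inf q \<rho> (inverse z)"
  unfolding eta_def eta_inf_def sum_distrib_left
  by (intro sum.cong refl) (simp add: divide_simps)

lemma eta_inf_split:
  assumes "\<And>i. q i * s \<noteq> 1"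
  shows "eta_inf q \<rho> s = (\<Sum>i\<in>UNIV. \<rho> i) + s * eta_inf q (\<lambda>i. \<rho> i * q i) s"
proof -
  have "\<rho> i / (1 - q i * s) = \<rho> i + s * (\<rho> i * q i / (1 - q i * s))" for i
    using assms[of i] by (simp add: field_simps)
  then show ?thesis unfolding eta_inf_def sum_distrib_left sum.distrib[symmetric] by simp
qed

lemma holomorphic_eta: "eta q \<rho> holomorphic_on - range q"
  unfolding eta_def[abs_def] by (auto intro!: holomorphic_intros)

text \<open>Closedness of a holomorphic form minus a covariant derivative rests on commuting mixed
  derivatives. The property is carried along with the construction (radial bumps, holomorphic
  factors, sums), where explicit formulas give it.\<close>

definition mixed_commute :: "(complex \<Rightarrow> complex) \<Rightarrow> complex \<Rightarrow> bool" where
  "mixed_commute f z \<longleftrightarrow> d_t (d_tbar f) z = d_tbar (d_t f) z"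

text \<open>A holomorphic factor has zero d_tbar derivative, so both orders give d_t (d_tbar h) F +
  (d_tbar h) F'.\<close>

lemma mixed_commute_mult:
  assumes U: "open U" "z \<in> U" and h: "smooth U h" "mixed_commute h z" and F: "F holomorphic_on U"
    and g: "\<And>y. y \<in> U \<Longrightarrow> g y = h y * F y"
  shows "mixed_commute g z"
proof -
  note F' = wirtinger_field_derivative[OF holomorphic_derivI[OF F U(1)]]
  note dF = wirtinger_field_derivative[OF holomorphic_derivI[OF holomorphic_deriv[OF F U(1)] U]]
  note h' = smooth_wirtinger[OF h(1) U(1)]
  note dh = smooth_wirtinger[OF smooth_d_t[OF h(1) U(1)] U] smooth_wirtinger[OF smooth_d_tbar[OF h(1) U(1)] U]
  have g': "wirtinger g (d_t h y * F y + h y * deriv F y) (d_tbar h y * F y) y" if y: "y \<in> U" for y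
    using wirtinger_cong_open[OF wirtinger_mult[OF h'[OF y] F'[OF y]] U(1) y, of g] g by simp
  have "d_t (d_tbar g) z = d_t (d_tbar h) z * F z + d_tbar h z * deriv F z"
    by (rule wirtinger_d_t[OF wirtinger_cong_open[OF wirtinger_mult[OF dh(2) F'[OF U(2)]] U]]) (simp add: wirtinger_d_tbar[OF g'])
  moreover have "d_tbar (d_t g) z = (d_tbar (d_t h) z * F z + d_t h z * 0) + (d_tbar h z * deriv F z + h z * 0)"
    by (rule wirtinger_d_tbar[OF wirtinger_cong_open[OF wirtinger_add[OF wirtinger_mult[OF dh(1) F'[OF U(2)]] wirtinger_mult[OF h'[OF U(2)] dF]] U]])
       (simp add: wirtinger_d_t[OF g'])
  ultimately show ?thesis using h(2) unfolding mixed_commute_def by simp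
qed

lemma mixed_commute_bump: "mixed_commute (bump p r) z"
  and mixed_commute_one_minus_bump: "mixed_commute (\<lambda>z. 1 - bump p r z) z"
proof -
  show b: "mixed_commute (bump p r) z" unfolding mixed_commute_def by (rule d_t_d_tbar_bump)
  have s: "wirtinger (\<lambda>z. 1 - bump p r z) (0 - d_t (bump p r) y) (0 - d_tbar (bump p r) y) y" for y
    by (intro wirtinger_diff wirtinger_const smooth_wirtinger[OF smooth_bump open_UNIV]) simp
  have d: "d_t (\<lambda>z. 1 - bump p r z) = (\<lambda>y. 0 - d_t (bump p r) y)"
    "d_tbar (\<lambda>z. 1 - bump p r z) = (\<lambda>y. 0 - d_tbar (bump p r) y)"
    by (rule ext, rule wirtinger_d_t[OF s], rule ext, rule wirtinger_d_tbar[OF s])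
  note db = smooth_wirtinger[OF smooth_d_t[OF smooth_bump open_UNIV] open_UNIV UNIV_I]
    smooth_wirtinger[OF smooth_d_tbar[OF smooth_bump open_UNIV] open_UNIV UNIV_I]
  show "mixed_commute (\<lambda>z. 1 - bump p r z) z"
    unfolding mixed_commute_def d wirtinger_d_t[OF wirtinger_diff[OF wirtinger_const db(2)]] wirtinger_d_tbar[OF wirtinger_diff[OF wirtinger_const db(1)]]
    by (simp add: d_t_d_tbar_bump)
qed

lemma mixed_commute_holomorphic:
  assumes U: "open U" "z \<in> U" and F: "F holomorphic_on U"
  shows "mixed_commute F z"
proof -
  have 1: "wirtinger F (deriv F y) 0 y" if "y \<in> U" for y
    by (rule wirtinger_field_derivative[OF holomorphic_derivI[OF F U(1) that]])
  have "d_t (d_tbar F) z = 0"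
    by (rule wirtinger_d_t[OF wirtinger_cong_open[OF wirtinger_const[of 0] U]]) (simp only: wirtinger_d_tbar[OF 1])
  moreover have "d_tbar (d_t F) z = 0"
    by (rule wirtinger_d_tbar[OF wirtinger_cong_open[OF wirtinger_field_derivative[OF holomorphic_derivI[OF holomorphic_deriv[OF F U(1)] U]] U]])
       (simp only: wirtinger_d_t[OF 1])
  ultimately show ?thesis unfolding mixed_commute_def by simp
qed

text \<open>F lives only on U, but the cut-off product is zero on V, which covers the rest of the
  plane. In this way local solutions become globally smooth functions.\<close>

lemma smooth_mixed_commute_cut:
  assumes U: "open U" and V: "open V" and UV: "U \<union> V = UNIV"
    and h: "smooth UNIV h" "\<And>z. mixed_commute h z" and F: "F holomorphic_on U"
    and g: "\<And>z. z \<in> U \<Longrightarrow> g z = h z * F z" "\<And>z. z \<in> V \<Longrightarrow> g z = 0"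
  shows "smooth UNIV g" and "mixed_commute g z"
proof -
  have hU: "smooth U h" by (rule smooth_subset[OF h(1)]) simp
  have gV: "g holomorphic_on V" using g(2) by (intro holomorphic_transform[OF holomorphic_on_const[of 0]]) simp
  have "smooth U g" by (rule smooth_cong[OF U smooth_mult[OF hU smooth_holomorphic[OF F U]]]) (simp add: g(1))
  from smooth_Un[OF U V this smooth_holomorphic[OF gV V]] show "smooth UNIV g" unfolding UV .
  have "z \<in> U \<or> z \<in> V" using UV by blast
  then show "mixed_commute g z"
    using mixed_commute_mult[OF U _ hU h(2) F g(1)] mixed_commute_holomorphic[OF V _ gV] by blast
qed

lemma mixed_commute_sum:
  assumes T: "open T" "z \<in> T" and f: "\<And>j. j \<in> I \<Longrightarrow> smooth T (f j)"
    and m: "\<And>j. j \<in> I \<Longrightarrow> mixed_commute (f j) z"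
  shows "mixed_commute (\<lambda>z. \<Sum>j\<in>I. f j z) z"
proof -
  have s: "wirtinger (\<lambda>z. \<Sum>j\<in>I. f j z) (\<Sum>j\<in>I. d_t (f j) y) (\<Sum>j\<in>I. d_tbar (f j) y) y" if "y \<in> T" for y
    using f T(1) that by (intro wirtinger_sum smooth_wirtinger)
  have "d_t (d_tbar (\<lambda>z. \<Sum>j\<in>I. f j z)) z = (\<Sum>j\<in>I. d_t (d_tbar (f j)) z)"
    by (rule wirtinger_d_t[OF wirtinger_cong_open[OF wirtinger_sum[OF smooth_wirtinger[OF smooth_d_tbar[OF f]]] T]])
       (use T wirtinger_d_tbar[OF s] in auto)
  moreover have "d_tbar (d_t (\<lambda>z. \<Sum>j\<in>I. f j z)) z = (\<Sum>j\<in>I. d_tbar (d_t (f j)) z)"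
    by (rule wirtinger_d_tbar[OF wirtinger_cong_open[OF wirtinger_sum[OF smooth_wirtinger[OF smooth_d_t[OF f]]] T]])
       (use T wirtinger_d_t[OF s] in auto)
  ultimately show ?thesis using m unfolding mixed_commute_def by simp
qed

text \<open>For holomorphic w and \<phi> only terms in f survive, and they cancel: the connection is
  flat.\<close>

lemma nabla1_holomorphic_minus_nabla0:
  assumes T: "open T" and w: "w holomorphic_on T" and \<phi>: "\<phi> holomorphic_on T"
    and f: "smooth T f" and m: "\<And>z. z \<in> T \<Longrightarrow> mixed_commute f z"
  shows "(\<lambda>z. (\<phi> z, 0) - nabla0 w f z) \<in> Z1 T w"
proof -
  have sw: "smooth T w" and s\<phi>: "smooth T \<phi>" using w \<phi> T by (auto intro: smooth_holomorphic)
  have "nabla1 w (\<lambda>z. (\<phi> z, 0) - nabla0 w f z) z = 0" if z: "z \<in> T" for z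
  proof -
    note f' = smooth_wirtinger[OF f T z] smooth_wirtinger[OF smooth_d_t[OF f T] T z] smooth_wirtinger[OF smooth_d_tbar[OF f T] T z]
    note w' = wirtinger_field_derivative[OF holomorphic_derivI[OF w T z]]
    note \<phi>' = wirtinger_field_derivative[OF holomorphic_derivI[OF \<phi> T z]]
    have 1: "d_t (\<lambda>s. 0 - d_tbar f s) z = 0 - d_t (d_tbar f) z"
      by (rule wirtinger_d_t[OF wirtinger_diff[OF wirtinger_const f'(3)]])
    have 2: "d_tbar (\<lambda>s. \<phi> s - (d_t f s + w s * f s)) z = 0 - (d_tbar (d_t f) z + (0 * f z + w z * d_tbar f z))"
      by (rule wirtinger_d_tbar[OF wirtinger_diff[OF \<phi>' wirtinger_add[OF f'(2) wirtinger_mult[OF w' f'(1)]]]])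
    show ?thesis unfolding nabla1_def nabla0_def fst_diff snd_diff fst_conv snd_conv 1 2
      using m[OF z] unfolding mixed_commute_def by simp
  qed
  then show ?thesis unfolding Z1_def smooth_form_def nabla0_def
    using T f sw s\<phi> by (auto intro!: smooth_diff smooth_minus smooth_add smooth_mult smooth_const smooth_d_t smooth_d_tbar)
qed

text \<open>A smeared mean value property. In G = G(p) + (z - p) G1 the factor z - p completes
  \<open>bump_coeff\<close> to the d_tbar derivative of the bump, so the G1 part is the d_tbar
  derivative of the compactly supported \<open>bump p r z * G1 z\<close> and integrates to
  zero.\<close>

lemma holomorphic_bump_coeff_mean:
  assumes r: "0 < r" and G: "G holomorphic_on ball p r"
  shows "(LINT z:ball p r|lborel. of_real (bump_coeff p r z) * G z) = G p * bump_total r"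
proof -
  define G1 where "G1 z = (if z = p then deriv G p else (G z - G p) / (z - p))" for z
  have G1: "G1 holomorphic_on ball p r" unfolding G1_def
    by (rule pole_lemma[OF G]) (use r in simp)
  have eq: "G z = G p + (z - p) * G1 z" for z unfolding G1_def by simp
  have sG1: "smooth (ball p r) G1" using G1 by (rule smooth_holomorphic) simp
  have cs: "cpt_supp (ball p r) (\<lambda>z. bump p r z * G1 z)"
    unfolding cpt_supp_def
    by (rule exI[of _ "cball p (3/4 * r)"])
       (use r in \<open>auto simp: dist_norm norm_minus_commute bump_eq_0\<close>)
  have d: "d_tbar (\<lambda>z. bump p r z * G1 z) z = of_real (bump_coeff p r z) * (z - p) * G1 z"
    if "z \<in> ball p r" for z
    by (rule wirtinger_d_tbar[OF back_subst[of "\<lambda>B. wirtinger _ _ B _",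
            OF wirtinger_mult[OF wirtinger_bump wirtinger_field_derivative[OF holomorphic_derivI[OF G1 open_ball that]]]]]) simp
  note st = stokes_smooth(3,4)[OF open_ball smooth_mult[OF smooth_bump sG1] cs]
  have int1: "set_integrable lborel (ball p r) (\<lambda>z. of_real (bump_coeff p r z) * G p)"
    using integrable_bump_coeff[OF r, of p]
    by (auto simp: set_integrable_def intro!: integrable_mult_indicator integrable_mult_left)
  have "(LINT z:ball p r|lborel. of_real (bump_coeff p r z) * G z) =
      (LINT z:ball p r|lborel. of_real (bump_coeff p r z) * G p + d_tbar (\<lambda>z. bump p r z * G1 z) z)"
  proof (rule set_lebesgue_integral_cong)
    have "of_real (bump_coeff p r z) * G z =
        of_real (bump_coeff p r z) * G p + d_tbar (\<lambda>z. bump p r z * G1 z) z" if "z \<in> ball p r" for z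
      unfolding d[OF that] by (subst eq) (simp add: algebra_simps)
    then show "\<forall>z. z \<in> ball p r \<longrightarrow> of_real (bump_coeff p r z) * G z =
        of_real (bump_coeff p r z) * G p + d_tbar (\<lambda>z. bump p r z * G1 z) z" by blast
  qed simp
  also have "\<dots> = (LINT z:ball p r|lborel. of_real (bump_coeff p r z) * G p)"
    using set_integral_add(2)[OF int1 st(1)] st(2) by simp
  also have "\<dots> = (LINT z|lborel. of_real (bump_coeff p r z) * G p)"
    unfolding set_lebesgue_integral_def
    by (rule Bochner_Integration.integral_cong)
       (use r bump_coeff_eq_0[OF r, of _ p] in \<open>auto simp: indicator_def dist_norm norm_minus_commute\<close>)
  also have "\<dots> = G p * bump_total r"
    by (subst Bochner_Integration.integral_mult_left_zero) (simp only: bump_total_translate mult.commute)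
  finally show ?thesis .
qed

text \<open>Relative to the exterior domain the bump has no compact support, but its differential
  does, in the annulus R \<le> |z| \<le> 3R/2. The integrand is, up to sign, the wedge of this
  differential with d\<Phi>, so Stokes with w = 0 applies.\<close>

lemma exact_bump_annulus:
  assumes R: "0 < R" and \<Phi>: "\<And>z. R / 2 < norm z \<Longrightarrow> (\<Phi> has_field_derivative \<Phi>' z) (at z)"
  shows "(LINT z:- cball 0 (R / 2)|lborel. of_real (bump_coeff 0 (2 * R) z) * z * \<Phi>' z) = 0"
proof -
  let ?U = "- cball (0::complex) (R / 2)"
  let ?w = "\<lambda>_::complex. 0 :: complex"
  let ?b = "bump 0 (2 * R)"
  have U: "open ?U" by (simp add: open_Compl)
  have \<Phi>hol: "\<Phi> holomorphic_on ?U" unfolding holomorphic_on_open[OF U]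
  proof
    fix z assume "z \<in> ?U"
    then have "R / 2 < norm z" by simp
    from \<Phi>[OF this] show "\<exists>f'. (\<Phi> has_field_derivative f') (at z)" by blast
  qed
  have Z: "nabla0 ?w ?b \<in> Z1 ?U ?w"
  proof -
    have "(\<lambda>z. nabla0 ?w ?b z) \<in> Z1 ?U ?w"
      unfolding Z1_def smooth_form_def nabla0_def nabla1_def
      by (auto intro!: smooth_d_t smooth_d_tbar smooth_bump U simp: d_t_d_tbar_bump)
    then show ?thesis .
  qed
  have c: "cpt_supp ?U (nabla0 ?w ?b)" unfolding cpt_supp_def
  proof (intro exI[of _ "cball 0 (3/2 * R) - ball 0 R"] conjI ballI)
    show "compact (cball 0 (3/2 * R) - ball 0 R :: complex set)" by (intro compact_diff compact_cball open_ball)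
    show "cball 0 (3/2 * R) - ball 0 R \<subseteq> ?U" using R by auto
    fix z assume "z \<in> ?U - (cball 0 (3/2 * R) - ball 0 R)"
    then have "bump_coeff 0 (2 * R) z = 0" by (intro bump_coeff_eq_0) (use R in auto)
    then show "nabla0 ?w ?b z = 0" unfolding nabla0_def d_t_bump d_tbar_bump by (simp add: zero_prod_def)
  qed
  have "wedge_integral ?U (nabla0 ?w ?b) (nabla0 (\<lambda>z. - ?w z) \<Phi>) = 0"
    by (rule wedge_nabla0_right[OF U smooth_holomorphic[OF \<Phi>hol U] Z c])
  moreover have "(LINT z:?U|lborel. fst (nabla0 ?w ?b z) * snd (nabla0 (\<lambda>z. - ?w z) \<Phi> z) -
      snd (nabla0 ?w ?b z) * fst (nabla0 (\<lambda>z. - ?w z) \<Phi> z)) =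
      (LINT z:?U|lborel. - (of_real (bump_coeff 0 (2 * R) z) * z * \<Phi>' z))"
  proof (rule set_lebesgue_integral_cong)
    have "fst (nabla0 ?w ?b z) * snd (nabla0 (\<lambda>z. - ?w z) \<Phi> z) -
      snd (nabla0 ?w ?b z) * fst (nabla0 (\<lambda>z. - ?w z) \<Phi> z) =
      - (of_real (bump_coeff 0 (2 * R) z) * z * \<Phi>' z)" if "z \<in> ?U" for z
    proof -
      have "R / 2 < norm z" using that by simp
      note wirtinger = wirtinger_field_derivative[OF \<Phi>[OF this]]
      show ?thesis by (simp add: nabla0_def d_t_bump d_tbar_bump wirtinger_d_t[OF wirtinger] wirtinger_d_tbar[OF wirtinger])
    qed
    then show "\<forall>z. z \<in> ?U \<longrightarrow> fst (nabla0 ?w ?b z) * snd (nabla0 (\<lambda>z. - ?w z) \<Phi> z) -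
      snd (nabla0 ?w ?b z) * fst (nabla0 (\<lambda>z. - ?w z) \<Phi> z) =
      - (of_real (bump_coeff 0 (2 * R) z) * z * \<Phi>' z)" by blast
  qed (use U in simp)
  ultimately show ?thesis unfolding wedge_integral_def set_lebesgue_integral_def by simp
qed

text \<open>The open discs of radius r about the poles are disjoint and lie in |z| \<le> R/2; the
  cutoff at infinity, of radius 2R, varies only for R \<le> |z| \<le> 3R/2. The sum of the exponents
  is minus the exponent at infinity.\<close>

locale log_connection =
  fixes q :: "'i::finite \<Rightarrow> complex" and \<alpha> :: "'i \<Rightarrow> complex" and r R :: real
  assumes r: "0 < r" and sep: "\<And>i j. i \<noteq> j \<Longrightarrow> 2 * r \<le> dist (q i) (q j)"
    and R: "\<And>i. 2 * (norm (q i) + r) \<le> R"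
    and \<alpha>: "\<And>i. \<alpha> i \<notin> \<int>" and \<alpha>_inf: "(\<Sum>i\<in>UNIV. \<alpha> i) \<notin> \<int>"
begin

abbreviation "T \<equiv> - range q"
abbreviation "w \<equiv> eta q \<alpha>"

lemma open_T: "open T"
  by (intro open_Compl finite_imp_closed) simp

lemma R_pos: "0 < R"
proof -
  have "0 < 2 * (norm (q undefined) + r)" using r by (intro mult_pos_pos add_nonneg_pos) auto
  also note R
  finally show ?thesis .
qed

lemma Diff_balls_subset:
  assumes "\<And>i. 0 < e i"
  shows "S - (\<Union>i. ball (q i) (e i)) \<subseteq> T"
proof
  fix z assume "z \<in> S - (\<Union>i. ball (q i) (e i))"
  then have "z \<notin> ball (q i) (e i)" for i by blast
  then have "z \<noteq> q i" for i using assms by (metis centre_in_ball)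
  then show "z \<in> T" by auto
qed

lemma ball_avoids: "z \<in> ball (q i) (2 * r) \<Longrightarrow> j \<noteq> i \<Longrightarrow> z \<noteq> q j"
  using sep[of i j] by (auto simp: dist_commute)

lemma far_avoids: "R / 2 < norm z \<Longrightarrow> z \<noteq> q j"
  using R[of j] r by auto

lemma inverse_avoids: "norm s < 2 / R \<Longrightarrow> q i * s \<noteq> 1"
proof
  assume s: "norm s < 2 / R" and eq: "q i * s = 1"
  have "norm (q i * s) < 1"
  proof (cases "q i = 0")
    case False
    have "norm (q i) * norm s < norm (q i) * (2 / R)" using s False by (intro mult_strict_left_mono) auto
    also have "\<dots> \<le> 1" using R[of i] r R_pos by (simp add: field_simps)
    finally show ?thesis by (simp add: norm_mult)
  qed simp
  with eq show False by simp
qed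

lemma holomorphic_eta_regular: "eta_regular q i \<rho> holomorphic_on ball (q i) (2 * r)"
  unfolding eta_regular_def[abs_def]
  by (intro holomorphic_intros) (use ball_avoids in \<open>auto simp: \<close>)

lemma holomorphic_eta_inf: "eta_inf q \<rho> holomorphic_on ball 0 (2 / R)"
  unfolding eta_inf_def[abs_def]
  by (intro holomorphic_intros) (use inverse_avoids in \<open>auto simp: \<close>)

lemma cpt_supp_nabla0D:
  assumes f: "smooth T f" and c: "cpt_supp T (nabla0 w f)"
  shows "cpt_supp T f"
proof -
  obtain K where K: "compact K" "K \<subseteq> T" "\<And>z. z \<in> T - K \<Longrightarrow> nabla0 w f z = 0"
    using c unfolding cpt_supp_def by auto
  \<comment> \<open>The second component of \<open>nabla0 w f z = 0\<close> makes f holomorphic, the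
    first makes it horizontal.\<close>
  have f': "(f has_field_derivative - w z * f z) (at z)" if z: "z \<in> T - K" for z
  proof -
    have "z \<in> T" using z by simp
    from smooth_wirtinger[OF f open_T this] K(3)[OF z] show ?thesis
      unfolding nabla0_def zero_prod_def
      by (intro wirtinger_imp_field_derivative) (auto simp: add_eq_0_iff2)
  qed
  have "\<exists>e>0. e \<le> r \<and> ball (q i) e \<inter> K = {}" for i
  proof -
    have "open (- K)" "q i \<in> - K" using K compact_imp_closed by auto
    then obtain e where "e > 0" "ball (q i) e \<subseteq> - K" using open_contains_ball by blast
    then show ?thesis using r by (intro exI[of _ "min e r"]) auto
  qed
  then obtain e where e: "\<And>i. e i > 0" "\<And>i. e i \<le> r" "\<And>i. ball (q i) (e i) \<inter> K = {}" by metis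
  obtain R0 where R0: "\<And>z. z \<in> K \<Longrightarrow> norm z \<le> R0"
    using compact_imp_bounded[OF K(1)] unfolding bounded_iff by auto
  define R' where "R' = max R R0"
  have near: "f z1 = 0" if z1: "z1 \<in> ball (q i) (e i)" "z1 \<noteq> q i" for z1 i
  proof -
    obtain H where H: "\<And>z. z \<in> ball (q i) (2 * r) \<Longrightarrow>
        (H has_field_derivative eta_regular q i \<alpha> z) (at z within ball (q i) (2 * r))"
      using holomorphic_convex_primitive'[OF convex_ball open_ball holomorphic_eta_regular] by blast
    show ?thesis
    proof (rule monodromy_zero[OF \<alpha>[of i] z1(2)])
      fix z assume "norm (z - q i) = norm (z1 - q i)"
      then have d: "dist (q i) z = dist (q i) z1" by (simp add: dist_norm norm_minus_commute)
      then have z: "z \<in> ball (q i) (e i)" "z \<in> ball (q i) (2 * r)" "z \<noteq> q i"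
        using z1 e(2)[of i] r by auto
      have "z \<noteq> q j" for j using z(3) ball_avoids[OF z(2), of j] by (cases "j = i") auto
      moreover have "z \<notin> K" using e(3)[of i] z(1) by blast
      ultimately have "z \<in> T - K" by auto
      from f'[OF this] show "(f has_field_derivative - (\<alpha> i / (z - q i) + eta_regular q i \<alpha> z) * f z) (at z)"
        unfolding eta_split[of q \<alpha> z i] .
      show "(H has_field_derivative eta_regular q i \<alpha> z) (at z)"
        using H[OF z(2)] at_within_open[OF z(2) open_ball] by simp
    qed
  qed
  have far: "f z1 = 0" if z1: "R' < norm z1" for z1
  proof (rule monodromy_zero[OF \<alpha>_inf, of z1 0])
    show "z1 \<noteq> 0" using z1 R_pos unfolding R'_def by auto
    fix z :: complex assume "norm (z - 0) = norm (z1 - 0)"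
    then have n: "R' < norm z" using z1 by simp
    then have z: "R / 2 < norm z" "z \<noteq> 0" and zK: "z \<notin> K" using R_pos R0[of z] unfolding R'_def by auto
    have "z \<in> T - K" using far_avoids[OF z(1)] zK by auto
    from f'[OF this]
    show "(f has_field_derivative - ((\<Sum>i\<in>UNIV. \<alpha> i) / (z - 0) + (\<Sum>i\<in>UNIV. \<alpha> i * q i / (z * (z - q i)))) * f z) (at z)"
    proof (rule back_subst[of "\<lambda>D. (f has_field_derivative D) (at z)"])
      \<comment> \<open>The leading term at infinity is the sum of the \<alpha> i over z; what
        remains decays like 1/z^2 and has a single-valued primitive.\<close>
      have "\<alpha> i / (z - q i) = \<alpha> i / z + \<alpha> i * q i / (z * (z - q i))" for i
      proof -
        have "\<alpha> i / z + \<alpha> i * q i / (z * (z - q i)) = (\<alpha> i * (z - q i) + \<alpha> i * q i) / (z * (z - q i))"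
          using far_avoids[OF z(1), of i] z(2) by (simp add: add_divide_distrib)
        also have "\<dots> = (z * \<alpha> i) / (z * (z - q i))" by (simp add: algebra_simps)
        finally show ?thesis using z(2) by simp
      qed
      then show "- w z * f z = - ((\<Sum>i\<in>UNIV. \<alpha> i) / (z - 0) + (\<Sum>i\<in>UNIV. \<alpha> i * q i / (z * (z - q i)))) * f z"
        unfolding eta_def by (simp add: sum.distrib sum_divide_distrib)
    qed
    \<comment> \<open>Since |q i / z| < 1, the number 1 - q i / z stays in the right half-plane,
      away from the cut of \<open>Ln\<close>, so the primitive exists on the whole circle.\<close>
    show "((\<lambda>z. \<Sum>i\<in>UNIV. \<alpha> i * Ln (1 - q i / z)) has_field_derivative (\<Sum>i\<in>UNIV. \<alpha> i * q i / (z * (z - q i)))) (at z)"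
    proof (rule DERIV_sum)
      fix i
      have "norm (q i / z) < 1" using R[of i] r z by (simp add: norm_divide)
      then have "Re (q i / z) < 1" using complex_Re_le_cmod[of "q i / z"] by linarith
      then have n: "1 - q i / z \<notin> \<real>\<^sub>\<le>\<^sub>0" by (auto simp: complex_nonpos_Reals_iff)
      have d: "((\<lambda>z. 1 - q i / z) has_field_derivative q i / (z * z)) (at z)"
        by (auto intro!: derivative_eq_intros simp: z(2))
      have "1 - q i / z = (z - q i) / z" using z(2) by (simp add: diff_divide_distrib)
      then have "\<alpha> i * (inverse (1 - q i / z) * (q i / (z * z))) = \<alpha> i * q i / (z * (z - q i))"
        using z(2) by simp
      then show "((\<lambda>z. \<alpha> i * Ln (1 - q i / z)) has_field_derivative \<alpha> i * q i / (z * (z - q i))) (at z)"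
        using DERIV_cmult[OF DERIV_chain2[OF has_field_derivative_Ln[OF n] d], of "\<alpha> i"] by (simp only:)
    qed
  qed
  show ?thesis unfolding cpt_supp_def
  proof (intro exI[of _ "cball 0 R' - (\<Union>i. ball (q i) (e i))"] conjI ballI)
    show "compact (cball 0 R' - (\<Union>i. ball (q i) (e i)))" by (intro compact_diff compact_cball) auto
    show "cball 0 R' - (\<Union>i. ball (q i) (e i)) \<subseteq> T" by (rule Diff_balls_subset) (rule e(1))
    fix z assume "z \<in> T - (cball 0 R' - (\<Union>i. ball (q i) (e i)))"
    then show "f z = 0" using far[of z] near[of z] by (cases "R' < norm z") auto
  qed
qed

lemma twisted: "twisted_cohomology T w"
  by unfold_locales
     (use open_T cpt_supp_nabla0D smooth_holomorphic[OF holomorphic_eta] in auto)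

text \<open>Multiplying by s = z - q i clears the simple poles and leaves a Fuchsian equation with
  exponent \<alpha> i. At s = 0 it reads \<alpha> i f = \<rho> i, and this value becomes the local
  contribution to the intersection number.\<close>

lemma local_solution:
  obtains f f' where "\<And>z. z \<in> ball (q i) (2 * r) \<Longrightarrow> (f has_field_derivative f' z) (at z)"
    "\<And>z. z \<in> ball (q i) (2 * r) \<Longrightarrow> z \<noteq> q i \<Longrightarrow> f' z + w z * f z = eta q \<rho> z"
    "f (q i) = \<rho> i / \<alpha> i"
proof -
  have hol: "(\<lambda>s. eta_regular q i \<sigma> (s + q i)) holomorphic_on ball 0 (2 * r)" for \<sigma>
    by (rule holomorphic_on_compose_gen[OF _ holomorphic_eta_regular[of i \<sigma>], unfolded o_def])
       (auto intro!: holomorphic_intros simp: dist_norm)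
  have "(\<lambda>s. \<rho> i + s * eta_regular q i \<rho> (s + q i)) holomorphic_on ball 0 (2 * r)"
    by (intro holomorphic_intros hol)
  from fuchs_ode_solution[OF \<alpha>[of i] hol[of \<alpha>] this]
  obtain f f' where f: "\<And>s. s \<in> ball 0 (2 * r) \<Longrightarrow> (f has_field_derivative f' s) (at s)"
    and eq: "\<And>s. s \<in> ball 0 (2 * r) \<Longrightarrow> s * f' s + (\<alpha> i + s * eta_regular q i \<alpha> (s + q i)) * f s =
      \<rho> i + s * eta_regular q i \<rho> (s + q i)" by metis
  have \<alpha>0: "\<alpha> i \<noteq> 0" using \<alpha>[of i] by auto
  show ?thesis
  proof (rule that)
    fix z assume z: "z \<in> ball (q i) (2 * r)"
    then have z': "z - q i \<in> ball 0 (2 * r)" by (simp add: dist_norm norm_minus_commute)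
    show "((\<lambda>z. f (z - q i)) has_field_derivative f' (z - q i)) (at z)"
    proof -
      have "((\<lambda>z. z - q i) has_field_derivative 1) (at z)" by (auto intro!: derivative_eq_intros)
      with DERIV_chain2[of f "f' (z - q i)" "\<lambda>z. z - q i" z 1 UNIV] f[OF z'] show ?thesis by simp
    qed
    assume "z \<noteq> q i"
    then have n: "z - q i \<noteq> 0" by simp
    have e: "(z - q i) * eta q \<sigma> z = \<sigma> i + (z - q i) * eta_regular q i \<sigma> z" for \<sigma>
      unfolding eta_split[of q _ z i] using n by (simp add: distrib_left)
    have "(z - q i) * (f' (z - q i) + w z * f (z - q i)) =
        (z - q i) * f' (z - q i) + ((z - q i) * w z) * f (z - q i)" by (simp add: algebra_simps)
    also have "\<dots> = (z - q i) * eta q \<rho> z"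
      unfolding e using eq[OF z'] by simp
    finally have "(z - q i) * (f' (z - q i) + w z * f (z - q i)) = (z - q i) * eta q \<rho> z" .
    with n show "f' (z - q i) + w z * f (z - q i) = eta q \<rho> z" by (metis mult_cancel_left)
  next
    show "f (q i - q i) = \<rho> i / \<alpha> i" using eq[of 0] r \<alpha>0 by (simp add: field_simps)
  qed
qed

text \<open>In s = 1/z one has d/dz = - s^2 d/ds; dividing the equation by - s gives a Fuchsian
  equation whose exponent is minus the sum of the \<alpha> i.\<close>

lemma local_solution_inf:
  obtains g f' where "g holomorphic_on ball 0 (2 / R)"
    "\<And>z. R / 2 < norm z \<Longrightarrow> ((\<lambda>z. g (inverse z)) has_field_derivative f' z) (at z)"
    "\<And>z. R / 2 < norm z \<Longrightarrow> f' z + w z * g (inverse z) = eta q \<rho> z"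
proof -
  have A: "- (\<Sum>i\<in>UNIV. \<alpha> i) \<notin> \<int>" using \<alpha>_inf by (simp add: minus_in_Ints_iff)
  have h: "(\<lambda>s. - eta_inf q \<sigma> s) holomorphic_on ball 0 (2 / R)" for \<sigma>
    by (intro holomorphic_intros holomorphic_eta_inf)
  from fuchs_ode_solution[OF A h[of "\<lambda>i. \<alpha> i * q i"] h[of \<rho>]]
  obtain g g' where g: "\<And>s. s \<in> ball 0 (2 / R) \<Longrightarrow> (g has_field_derivative g' s) (at s)"
    and eq: "\<And>s. s \<in> ball 0 (2 / R) \<Longrightarrow> s * g' s + (- (\<Sum>i\<in>UNIV. \<alpha> i) + s * - eta_inf q (\<lambda>i. \<alpha> i * q i) s) * g s =
      - eta_inf q \<rho> s" by metis
  show ?thesis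
  proof (rule that)
    show "g holomorphic_on ball 0 (2 / R)" unfolding holomorphic_on_open[OF open_ball] using g by blast
    fix z :: complex assume z: "R / 2 < norm z"
    then have n: "z \<noteq> 0" using R_pos by auto
    have "inverse (norm z) < inverse (R / 2)" using z R_pos by (intro less_imp_inverse_less) auto
    then have s: "inverse z \<in> ball 0 (2 / R)" by (simp add: norm_inverse)
    show "((\<lambda>z. g (inverse z)) has_field_derivative - (inverse z)\<^sup>2 * g' (inverse z)) (at z)"
      using DERIV_chain2[of g "g' (inverse z)" inverse z _ UNIV, OF g[OF s] DERIV_inverse[OF n]]
      by (simp add: power2_eq_square mult_ac)
    have "\<And>i. q i * inverse z \<noteq> 1" using inverse_avoids s by auto
    note sp = eta_inf_split[OF this, of _ \<alpha>]
    show "- (inverse z)\<^sup>2 * g' (inverse z) + w z * g (inverse z) = eta q \<rho> z"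
      using eq[OF s] unfolding eta_eq_eta_inf[OF n] sp by (simp add: algebra_simps power2_eq_square) algebra
  qed
qed

lemma bump_other_eq_0:
  assumes "z \<in> ball (q i) (r / 2)" "j \<noteq> i"
  shows "bump (q j) r z = 0"
proof (rule bump_eq_0[OF r])
  have "2 * r \<le> dist (q i) (q j)" using sep assms by simp
  also have "\<dots> \<le> dist (q i) z + dist (q j) z" by (metis dist_commute dist_triangle)
  finally show "3 / 4 * r \<le> norm (z - q j)" using assms r by (simp add: dist_norm norm_minus_commute)
qed

lemma far_ball_avoids: "2 * R < norm z \<Longrightarrow> r \<le> norm (z - q j)"
proof -
  assume "2 * R < norm z"
  moreover have "norm z \<le> norm (z - q j) + norm (q j)" by (metis diff_add_cancel norm_triangle_ineq)
  ultimately show ?thesis using R[of j] r R_pos by simp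
qed

lemma near_ball_bounded: "z \<in> ball (q i) r \<Longrightarrow> norm z \<le> R"
proof -
  assume "z \<in> ball (q i) r"
  moreover have "norm z \<le> norm (z - q i) + norm (q i)" by (metis diff_add_cancel norm_triangle_ineq)
  ultimately have "norm z \<le> r + norm (q i)" by (simp add: dist_norm norm_minus_commute)
  moreover have "2 * r + 2 * norm (q i) \<le> R" using R[of i] by simp
  ultimately show ?thesis using r norm_ge_zero[of "q i"] by linarith
qed

text \<open>The local residue at infinity drops out because \<open>\<sigma>\<close> sums to zero.\<close>

lemma compact_representative:
  obtains \<kappa> where "\<kappa> \<in> Z1c T w" "((\<lambda>z. (eta q \<rho> z, 0)), \<kappa>) \<in> cohom T w"
    "\<And>\<sigma>. (\<Sum>i\<in>UNIV. \<sigma> i) = 0 \<Longrightarrow> wedge_integral T \<kappa> (\<lambda>z. (eta q \<sigma> z, 0)) =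
      - 2 * \<i> * bump_total r * (\<Sum>i\<in>UNIV. \<rho> i * \<sigma> i / \<alpha> i)"
proof -
  have "\<forall>i. \<exists>f f'. (\<forall>z\<in>ball (q i) (2 * r). (f has_field_derivative f' z) (at z)) \<and>
    (\<forall>z\<in>ball (q i) (2 * r). z \<noteq> q i \<longrightarrow> f' z + w z * f z = eta q \<rho> z) \<and> f (q i) = \<rho> i / \<alpha> i"
  proof
    fix i
    show "\<exists>f f'. (\<forall>z\<in>ball (q i) (2 * r). (f has_field_derivative f' z) (at z)) \<and>
      (\<forall>z\<in>ball (q i) (2 * r). z \<noteq> q i \<longrightarrow> f' z + w z * f z = eta q \<rho> z) \<and> f (q i) = \<rho> i / \<alpha> i"
      by (rule local_solution[of i \<rho>]) blast
  qed
  then obtain f f' where f: "\<And>i z. z \<in> ball (q i) (2 * r) \<Longrightarrow> (f i has_field_derivative f' i z) (at z)"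
    and f_eq: "\<And>i z. z \<in> ball (q i) (2 * r) \<Longrightarrow> z \<noteq> q i \<Longrightarrow> f' i z + w z * f i z = eta q \<rho> z"
    and f_0: "\<And>i. f i (q i) = \<rho> i / \<alpha> i" by metis
  obtain g g' where g: "g holomorphic_on ball 0 (2 / R)"
    and g': "\<And>z. R / 2 < norm z \<Longrightarrow> ((\<lambda>z. g (inverse z)) has_field_derivative g' z) (at z)"
    and g_eq: "\<And>z. R / 2 < norm z \<Longrightarrow> g' z + w z * g (inverse z) = eta q \<rho> z"
    using local_solution_inf[of \<rho>] by metis
  \<comment> \<open>\<open>None\<close> stands for the point at infinity, where the cutoff is one
    minus a large bump.\<close>
  define P where "P j z = (case j of None \<Rightarrow> (1 - bump 0 (2 * R) z) * g (inverse z)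
      | Some i \<Rightarrow> bump (q i) r z * f i z)" for j z
  have R2: "0 < 2 * R" using R_pos by simp
  have f_hol: "f i holomorphic_on ball (q i) (2 * r)" for i
    unfolding holomorphic_on_open[OF open_ball] using f by blast
  have g_hol: "(\<lambda>z. g (inverse z)) holomorphic_on - cball 0 (R / 2)"
  proof -
    have "\<exists>D. ((\<lambda>z. g (inverse z)) has_field_derivative D) (at z)" if "z \<in> - cball 0 (R / 2)" for z
    proof -
      have "R / 2 < norm z" using that by simp
      from g'[OF this] show ?thesis by blast
    qed
    then show ?thesis using holomorphic_on_open[of "- cball (0::complex) (R / 2)"] by (simp add: open_Compl)
  qed
  have P_cut: "smooth UNIV (P j) \<and> (\<forall>z. mixed_commute (P j) z)" for j
  proof (cases j)
    case (Some i)
    let ?U = "ball (q i) (2 * r)" and ?V = "- cball (q i) (3/4 * r)"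
    have V: "open ?V" "?U \<union> ?V = UNIV" using r by (auto simp: open_Compl)
    have "P j z = 0" if "z \<in> ?V" for z
      using that Some bump_eq_0[OF r, of z "q i"] unfolding P_def by (simp add: dist_norm norm_minus_commute)
    from smooth_mixed_commute_cut[OF open_ball V smooth_bump mixed_commute_bump f_hol, of "P j" "q i" r, OF _ this]
    show ?thesis by (simp add: P_def Some)
  next
    case None
    let ?U = "- cball (0::complex) (R / 2)" and ?V = "ball (0::complex) R"
    have U: "open ?U" "?U \<union> ?V = UNIV" using R_pos by (auto simp: open_Compl)
    have "P j z = 0" if "z \<in> ?V" for z
      using that None bump_eq_1[OF R2, of z 0] unfolding P_def by simp
    from smooth_mixed_commute_cut[OF U(1) open_ball U(2) smooth_diff[OF smooth_const smooth_bump]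
        mixed_commute_one_minus_bump g_hol, of "P j" 0 "2 * R", OF _ this]
    show ?thesis by (simp add: P_def None)
  qed
  then have P_smooth: "smooth UNIV (P j)" and P_mixed: "mixed_commute (P j) z" for j z by auto
  define F where "F z = (\<Sum>j\<in>UNIV. P j z)" for z
  have F_smooth: "smooth T F"
    unfolding F_def[abs_def] by (rule smooth_subset[OF smooth_sum[OF P_smooth]]) simp
  have F_mixed: "mixed_commute F z" for z
    unfolding F_def[abs_def] by (rule mixed_commute_sum[OF open_UNIV]) (auto intro: P_smooth P_mixed)
  have sum_option: "(\<Sum>j\<in>UNIV. h j) = h None + (\<Sum>i\<in>UNIV. h (Some i))" for h :: "'i option \<Rightarrow> complex"
    by (simp add: UNIV_option_conv sum.reindex)
  define \<kappa> where "\<kappa> z = (eta q \<rho> z, 0) - nabla0 w F z" for z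
  have \<kappa>Z: "\<kappa> \<in> Z1 T w" unfolding \<kappa>_def[abs_def]
    by (rule nabla1_holomorphic_minus_nabla0[OF open_T holomorphic_eta holomorphic_eta F_smooth F_mixed])
  \<comment> \<open>Close to q i only the i-th local solution contributes to F, with coefficient 1,
    so its covariant derivative cancels the form exactly.\<close>
  have \<kappa>_near: "\<kappa> z = 0" if z: "z \<in> ball (q i) (r / 2)" "z \<noteq> q i" for z i
  proof -
    have FP: "F y = f i y" if y: "y \<in> ball (q i) (r / 2)" for y
    proof -
      have "bump 0 (2 * R) y = 1"
        using near_ball_bounded[of y i] y r by (intro bump_eq_1[OF R2]) auto
      then have "P None y = 0" unfolding P_def by simp
      moreover have "(\<Sum>j\<in>UNIV. P (Some j) y) = P (Some i) y + (\<Sum>j\<in>UNIV - {i}. P (Some j) y)"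
        by (simp add: sum.remove[of UNIV i])
      moreover have "(\<Sum>j\<in>UNIV - {i}. P (Some j) y) = 0"
        using bump_other_eq_0[OF y] by (intro sum.neutral) (auto simp: P_def)
      moreover have "P (Some i) y = f i y"
        unfolding P_def using y bump_eq_1[OF r, of y "q i"] by (simp add: dist_norm norm_minus_commute)
      ultimately show ?thesis unfolding F_def sum_option by simp
    qed
    have z2: "z \<in> ball (q i) (2 * r)" using z r by auto
    have "wirtinger F (f' i z) 0 z"
      by (rule wirtinger_cong_open[OF wirtinger_field_derivative[OF f[OF z2]] open_ball z(1)]) (simp add: FP)
    then have "nabla0 w F z = (f' i z + w z * f i z, 0)"
      unfolding nabla0_def by (simp add: wirtinger_d_t wirtinger_d_tbar FP[OF z(1)])
    then show ?thesis unfolding \<kappa>_def f_eq[OF z2 z(2)] by (simp add: zero_prod_def)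
  qed
  have \<kappa>_far: "\<kappa> z = 0" if z: "2 * R < norm z" for z
  proof -
    have FP: "F y = g (inverse y)" if y: "y \<in> - cball 0 (2 * R)" for y
    proof -
      have y': "2 * R < norm y" using y by simp
      have "(\<Sum>j\<in>UNIV. P (Some j) y) = 0"
        using far_ball_avoids[OF y'] r by (intro sum.neutral) (auto simp: P_def intro!: bump_eq_0 order_trans[OF _ far_ball_avoids[OF y']])
      moreover have "P None y = g (inverse y)"
        unfolding P_def using bump_eq_0[OF R2, of y 0] y' R_pos by simp
      ultimately show ?thesis unfolding F_def sum_option by simp
    qed
    have z2: "R / 2 < norm z" using z R_pos by simp
    have z3: "z \<in> - cball 0 (2 * R)" using z by simp
    have "wirtinger F (g' z) 0 z"
      by (rule wirtinger_cong_open[OF wirtinger_field_derivative[OF g'[OF z2]] _ z3]) (auto simp: FP open_Compl)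
    then have "nabla0 w F z = (g' z + w z * g (inverse z), 0)"
      unfolding nabla0_def by (simp add: wirtinger_d_t wirtinger_d_tbar FP[OF z3])
    then show ?thesis unfolding \<kappa>_def g_eq[OF z2] by (simp add: zero_prod_def)
  qed
  have \<kappa>c: "cpt_supp T \<kappa>" unfolding cpt_supp_def
  proof (intro exI[of _ "cball 0 (2 * R) - (\<Union>i. ball (q i) (r / 2))"] conjI ballI)
    show "compact (cball 0 (2 * R) - (\<Union>i. ball (q i) (r / 2)))" by (intro compact_diff compact_cball) auto
    show "cball 0 (2 * R) - (\<Union>i. ball (q i) (r / 2)) \<subseteq> T" by (rule Diff_balls_subset) (use r in simp)
    fix z assume "z \<in> T - (cball 0 (2 * R) - (\<Union>i. ball (q i) (r / 2)))"
    then show "\<kappa> z = 0" using \<kappa>_far[of z] \<kappa>_near[of z] by (cases "2 * R < norm z") auto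
  qed
  have "((\<lambda>z. (eta q \<rho> z, 0)), \<kappa>) \<in> cohom T w"
  proof (rule cohomI[OF _ \<kappa>Z F_smooth])
    have "(\<lambda>z. (eta q \<rho> z, 0) - nabla0 w (\<lambda>_. 0) z) \<in> Z1 T w"
      by (rule nabla1_holomorphic_minus_nabla0[OF open_T holomorphic_eta holomorphic_eta smooth_const])
         (rule mixed_commute_holomorphic[OF open_UNIV UNIV_I holomorphic_on_const])
    then show "(\<lambda>z. (eta q \<rho> z, 0)) \<in> Z1 T w" by (simp add: nabla0_zero)
  qed (simp add: \<kappa>_def)
  moreover have "wedge_integral T \<kappa> (\<lambda>z. (eta q \<sigma> z, 0)) =
      - 2 * \<i> * bump_total r * (\<Sum>i\<in>UNIV. \<rho> i * \<sigma> i / \<alpha> i)" if \<sigma>: "(\<Sum>i\<in>UNIV. \<sigma> i) = 0" for \<sigma>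
  proof -
    have P_wirtinger: "wirtinger (P j) (d_t (P j) z) (d_tbar (P j) z) z" for j z
      by (rule smooth_wirtinger[OF P_smooth open_UNIV]) simp
    have dP_Some: "d_tbar (P (Some i)) z = of_real (bump_coeff (q i) r z) * (z - q i) * f i z" for i z
    proof (cases "z \<in> ball (q i) (2 * r)")
      case True
      show ?thesis unfolding P_def[abs_def] option.case
          wirtinger_d_tbar[OF wirtinger_mult[OF wirtinger_bump wirtinger_field_derivative[OF f[OF True]]]] by simp
    next
      case False
      let ?V = "- cball (q i) (3/4 * r)"
      have z: "z \<in> ?V" using False r by auto
      have "d_tbar (P (Some i)) z = 0"
        by (rule wirtinger_d_tbar[OF wirtinger_cong_open[OF wirtinger_const[of 0] _ z]])
           (auto simp: open_Compl P_def dist_norm norm_minus_commute bump_eq_0[OF r])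
      moreover have "bump_coeff (q i) r z = 0"
        using z by (intro bump_coeff_eq_0[OF r]) (auto simp: dist_norm norm_minus_commute)
      ultimately show ?thesis by simp
    qed
    have dP_None: "d_tbar (P None) z = - (of_real (bump_coeff 0 (2 * R) z) * z * g (inverse z))" for z
    proof (cases "R / 2 < norm z")
      case True
      show ?thesis unfolding P_def[abs_def] option.case
          wirtinger_d_tbar[OF wirtinger_mult[OF wirtinger_diff[OF wirtinger_const wirtinger_bump] wirtinger_field_derivative[OF g'[OF True]]]] by simp
    next
      case False
      have z: "z \<in> ball 0 R" using False R_pos by auto
      have "d_tbar (P None) z = 0"
        by (rule wirtinger_d_tbar[OF wirtinger_cong_open[OF wirtinger_const[of 0] _ z]])
           (auto simp: P_def bump_eq_1[OF R2])
      moreover have "bump_coeff 0 (2 * R) z = 0"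
        using z by (intro bump_coeff_eq_0[OF R2]) auto
      ultimately show ?thesis by simp
    qed
    have dF: "d_tbar F z = (\<Sum>j\<in>UNIV. d_tbar (P j) z)" for z
      unfolding F_def[abs_def] by (rule wirtinger_d_tbar[OF wirtinger_sum[OF P_wirtinger]])
    \<comment> \<open>The d_tbar derivative of each cut-off solution lives in an annulus away from
      the punctures, so the integral splits into local contributions.\<close>
    have int: "set_integrable lborel T (\<lambda>z. d_tbar (P j) z * eta q \<sigma> z)" for j
    proof -
      have cont: "continuous_on T (\<lambda>z. d_tbar (P j) z * eta q \<sigma> z)"
        by (intro continuous_intros smooth_continuous
            smooth_subset[OF smooth_d_tbar[OF P_smooth open_UNIV] subset_UNIV]
            holomorphic_on_imp_continuous_on[OF holomorphic_eta])
      have 0: "d_tbar (P j) z = 0" if zK: "z \<in> T - (cball 0 (2 * R) - (\<Union>i. ball (q i) (r / 2)))" for z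
      proof (cases j)
        case None
        have "bump_coeff 0 (2 * R) z = 0"
        proof (cases "2 * R < norm z")
          case True then show ?thesis using R_pos by (intro bump_coeff_eq_0[OF R2]) auto
        next
          case False
          with zK obtain i where "z \<in> ball (q i) (r / 2)" using zK by auto
          then have "z \<in> ball (q i) r" using r by auto
          from near_ball_bounded[OF this] show ?thesis by (intro bump_coeff_eq_0[OF R2]) auto
        qed
        then show ?thesis using None dP_None by simp
      next
        case (Some i)
        have "bump_coeff (q i) r z = 0"
        proof (cases "2 * R < norm z")
          case True then show ?thesis using far_ball_avoids[OF True, of i] r by (intro bump_coeff_eq_0[OF r]) auto
        next
          case False
          then obtain k where k: "z \<in> ball (q k) (r / 2)" using zK False by auto
          show ?thesis
          proof (cases "k = i")
            case True then show ?thesis using k by (intro bump_coeff_eq_0[OF r]) (auto simp: dist_norm norm_minus_commute)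
          next
            case False
            have "2 * r \<le> dist (q k) (q i)" using sep False by simp
            also have "\<dots> \<le> dist (q k) z + dist (q i) z" by (metis dist_commute dist_triangle)
            finally have "3 / 4 * r \<le> norm (z - q i)" using k r by (simp add: dist_norm norm_minus_commute)
            then show ?thesis by (intro bump_coeff_eq_0[OF r]) auto
          qed
        qed
        then show ?thesis using Some dP_Some by simp
      qed
      show ?thesis
      proof (rule set_integrable_cpt_supp[OF cont])
        show "compact (cball 0 (2 * R) - (\<Union>i. ball (q i) (r / 2)))" by (intro compact_diff compact_cball) auto
        show "cball 0 (2 * R) - (\<Union>i. ball (q i) (r / 2)) \<subseteq> T" by (rule Diff_balls_subset) (use r in simp)
      qed (use 0 in simp)
    qed
    \<comment> \<open>The second form has a zero dtbar component, so only the dtbar component -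
      d_tbar F of \<kappa> enters.\<close>
    have "(LINT z:T|lborel. fst (\<kappa> z) * snd (eta q \<sigma> z, 0::complex) - snd (\<kappa> z) * fst (eta q \<sigma> z, 0::complex)) =
        (LINT z:T|lborel. (\<Sum>j\<in>UNIV. d_tbar (P j) z * eta q \<sigma> z))"
      by (rule set_lebesgue_integral_cong)
         (use open_T in \<open>auto simp: \<kappa>_def nabla0_def dF sum_distrib_right\<close>)
    also have "\<dots> = (\<Sum>j\<in>UNIV. LINT z:T|lborel. d_tbar (P j) z * eta q \<sigma> z)"
      unfolding set_lebesgue_integral_def scaleR_sum_right
      by (rule Bochner_Integration.integral_sum) (use int in \<open>simp only: set_integrable_def\<close>)
    also have "\<dots> = (\<Sum>i\<in>UNIV. LINT z:T|lborel. d_tbar (P (Some i)) z * eta q \<sigma> z)"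
    proof -
      \<comment> \<open>Since the residues \<sigma> sum to zero, \<open>eta q \<sigma>\<close> is
        s^2 times S1 with s = 1/z. Its product with the solution at infinity therefore has a
        primitive there, and \<open>exact_bump_annulus\<close> applies.\<close>
      define S1 where "S1 = eta_inf q (\<lambda>i. \<sigma> i * q i)"
      have "(\<lambda>s. g s * S1 s) holomorphic_on ball 0 (2 / R)"
        unfolding S1_def by (intro holomorphic_intros g holomorphic_eta_inf)
      then obtain \<Phi> where \<Phi>: "\<And>s. s \<in> ball 0 (2 / R) \<Longrightarrow> (\<Phi> has_field_derivative g s * S1 s) (at s within ball 0 (2 / R))"
        using holomorphic_convex_primitive'[OF convex_ball open_ball] by blast
      have s: "inverse z \<in> ball 0 (2 / R)" "z \<noteq> 0" if z: "R / 2 < norm z" for z :: complex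
      proof -
        show "z \<noteq> 0" using z R_pos by auto
        have "inverse (norm z) < inverse (R / 2)" using z R_pos by (intro less_imp_inverse_less) auto
        then show "inverse z \<in> ball 0 (2 / R)" by (simp add: norm_inverse)
      qed
      have prim: "((\<lambda>z. - \<Phi> (inverse z)) has_field_derivative g (inverse z) * eta q \<sigma> z) (at z)"
        if z: "R / 2 < norm z" for z
      proof -
        have n: "\<And>i. q i * inverse z \<noteq> 1" using inverse_avoids s[OF z] by auto
        have e: "eta q \<sigma> z = inverse z * (inverse z * S1 (inverse z))"
          using eta_eq_eta_inf[OF s(2)[OF z], of q \<sigma>] eta_inf_split[OF n, where \<rho> = \<sigma>] \<sigma> unfolding S1_def by simp
        have "(\<Phi> has_field_derivative g (inverse z) * S1 (inverse z)) (at (inverse z))"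
          using \<Phi>[OF s(1)[OF z]] at_within_open[OF s(1)[OF z] open_ball] by simp
        from DERIV_minus[OF DERIV_chain2[of \<Phi> _ inverse z _ UNIV, OF this DERIV_inverse[OF s(2)[OF z]]]]
        show ?thesis unfolding e by (simp add: mult_ac)
      qed
      have "(LINT z:T|lborel. d_tbar (P None) z * eta q \<sigma> z) =
          (LINT z:- cball 0 (R / 2)|lborel. - (of_real (bump_coeff 0 (2 * R) z) * z * (g (inverse z) * eta q \<sigma> z)))"
        unfolding set_lebesgue_integral_def
      proof (rule Bochner_Integration.integral_cong[OF refl])
        fix z
        show "indicator T z *\<^sub>R (d_tbar (P None) z * eta q \<sigma> z) = indicator (- cball 0 (R / 2)) z *\<^sub>R
            - (of_real (bump_coeff 0 (2 * R) z) * z * (g (inverse z) * eta q \<sigma> z))"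
        proof (cases "R / 2 < norm z")
          case True
          then have "z \<in> T" using far_avoids by auto
          with True show ?thesis by (simp add: dP_None)
        next
          case False
          then have "bump_coeff 0 (2 * R) z = 0" using R_pos by (intro bump_coeff_eq_0[OF R2]) auto
          then show ?thesis by (simp add: dP_None)
        qed
      qed
      also have "\<dots> = 0"
        using exact_bump_annulus[OF R_pos prim] unfolding set_lebesgue_integral_def by simp
      finally show ?thesis unfolding sum_option by simp
    qed
    also have "\<dots> = (\<Sum>i\<in>UNIV. bump_total r * (\<rho> i * \<sigma> i / \<alpha> i))"
    proof (rule sum.cong[OF refl])
      fix i
      \<comment> \<open>The factor z - q i from the derivative of the bump cancels the simple pole
        of \<open>eta q \<sigma>\<close>; the remaining holomorphic factor takes the value \<rho> i
        \<sigma> i / \<alpha> i at q i.\<close>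
      let ?G = "\<lambda>z. f i z * (\<sigma> i + (z - q i) * eta_regular q i \<sigma> z)"
      have sub: "ball (q i) r \<subseteq> ball (q i) (2 * r)" using r by auto
      have "(LINT z:T|lborel. d_tbar (P (Some i)) z * eta q \<sigma> z) =
          (LINT z:ball (q i) r|lborel. of_real (bump_coeff (q i) r z) * ?G z)"
        unfolding set_lebesgue_integral_def
      proof (rule Bochner_Integration.integral_cong[OF refl])
        fix z
        show "indicator T z *\<^sub>R (d_tbar (P (Some i)) z * eta q \<sigma> z) =
            indicator (ball (q i) r) z *\<^sub>R (of_real (bump_coeff (q i) r z) * ?G z)"
        proof (cases "z \<in> ball (q i) r \<and> z \<noteq> q i")
          case True
          then have "z \<noteq> q j" for j using ball_avoids[of z i j] sub by (cases "j = i") auto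
          then have zT: "z \<in> T" by auto
          have "(z - q i) * eta q \<sigma> z = \<sigma> i + (z - q i) * eta_regular q i \<sigma> z"
            unfolding eta_split[of q \<sigma> z i] using True by (simp add: distrib_left)
          then have "d_tbar (P (Some i)) z * eta q \<sigma> z = of_real (bump_coeff (q i) r z) * ?G z"
            unfolding dP_Some by (metis mult.assoc mult.commute)
          with True zT show ?thesis by simp
        next
          case False
          then have "bump_coeff (q i) r z = 0"
            using r by (intro bump_coeff_eq_0[OF r]) (auto simp: dist_norm norm_minus_commute)
          then show ?thesis unfolding dP_Some by simp
        qed
      qed
      also have "\<dots> = ?G (q i) * bump_total r"
        by (rule holomorphic_bump_coeff_mean[OF r])
           (intro holomorphic_intros holomorphic_on_subset[OF f_hol sub] holomorphic_on_subset[OF holomorphic_eta_regular sub])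
      also have "\<dots> = bump_total r * (\<rho> i * \<sigma> i / \<alpha> i)" by (simp add: f_0)
      finally show "(LINT z:T|lborel. d_tbar (P (Some i)) z * eta q \<sigma> z) = bump_total r * (\<rho> i * \<sigma> i / \<alpha> i)" .
    qed
    finally show ?thesis unfolding wedge_integral_def by (simp add: sum_distrib_left mult_ac)
  qed
  ultimately show ?thesis using that[of \<kappa>] \<kappa>Z \<kappa>c unfolding Z1c_def by blast
qed

end

section \<open>Multiple power series with polynomially bounded coefficients\<close>

abbreviation monom_at :: "complex ^ 'm::finite \<Rightarrow> ('m \<Rightarrow> nat) \<Rightarrow> complex" where
  "monom_at x n \<equiv> (\<Prod>i\<in>UNIV. (x $ i) ^ n i)"

abbreviation mdeg :: "('m::finite \<Rightarrow> nat) \<Rightarrow> nat" where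
  "mdeg n \<equiv> \<Sum>i\<in>UNIV. n i"

abbreviation msize :: "('m::finite \<Rightarrow> nat) \<Rightarrow> real" where
  "msize n \<equiv> \<Prod>i\<in>UNIV. real (Suc (n i))"

definition mseries :: "(('m::finite \<Rightarrow> nat) \<Rightarrow> complex) \<Rightarrow> complex ^ 'm \<Rightarrow> complex" where
  "mseries A x = (\<Sum>\<^sub>\<infinity>n\<in>UNIV. A n * monom_at x n)"

text \<open>The bound uses the product \<open>msize\<close> instead of a power of the total degree
  because it factorizes over the variables, like the monomials.\<close>

definition poly_bounded :: "(('m::finite \<Rightarrow> nat) \<Rightarrow> complex) \<Rightarrow> bool" where
  "poly_bounded A \<longleftrightarrow> (\<exists>K d. \<forall>n. norm (A n) \<le> K * msize n ^ d)"

section \<open>Closure properties of polynomially bounded coefficients\<close>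

lemma prod_Suc_ge_1: "1 \<le> msize n"
  by (rule prod_ge_1) simp

lemma Suc_le_prod_Suc: "real (Suc (n k)) \<le> msize n"
proof -
  have "real (Suc (n k)) * 1 \<le> real (Suc (n k)) * (\<Prod>i\<in>UNIV - {k}. real (Suc (n i)))"
    by (intro mult_left_mono prod_ge_1) auto
  also have "\<dots> = msize n" by (simp add: prod.remove[of UNIV k])
  finally show ?thesis by simp
qed

lemma poly_boundedI: "(\<And>n. norm (A n) \<le> K * msize n ^ d) \<Longrightarrow> poly_bounded A"
  unfolding poly_bounded_def by blast

lemma poly_boundedE:
  assumes "poly_bounded A"
  obtains K d where "0 \<le> K" "\<And>n. norm (A n) \<le> K * msize n ^ d"
proof -
  obtain K d where K: "\<And>n. norm (A n) \<le> K * msize n ^ d"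
    using assms unfolding poly_bounded_def by blast
  from K[of "\<lambda>_. 0"] have "0 \<le> K" using norm_ge_zero[of "A (\<lambda>_. 0)"] by (simp del: norm_ge_zero)
  with K that show ?thesis by blast
qed

lemma poly_bounded_add:
  fixes A B :: "('m::finite \<Rightarrow> nat) \<Rightarrow> complex"
  assumes "poly_bounded A" "poly_bounded B" shows "poly_bounded (\<lambda>n. A n + B n)"
proof -
  obtain K d where K: "0 \<le> K" "\<And>n. norm (A n) \<le> K * msize n ^ d"
    using poly_boundedE[OF assms(1)] by blast
  obtain L e where L: "0 \<le> L" "\<And>n. norm (B n) \<le> L * msize n ^ e"
    using poly_boundedE[OF assms(2)] by blast
  show ?thesis
  proof (rule poly_boundedI)
    fix n :: "'m \<Rightarrow> nat"
    let ?p = "msize n"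
    have "norm (A n + B n) \<le> K * ?p ^ d + L * ?p ^ e"
      using norm_triangle_ineq[of "A n" "B n"] K(2)[of n] L(2)[of n] by linarith
    also have "\<dots> \<le> K * ?p ^ (d + e) + L * ?p ^ (d + e)"
      using K(1) L(1) prod_Suc_ge_1[of n] by (intro add_mono mult_left_mono power_increasing) auto
    finally show "norm (A n + B n) \<le> (K + L) * ?p ^ (d + e)" by (simp add: distrib_right)
  qed
qed

lemma poly_bounded_mult:
  fixes A B :: "('m::finite \<Rightarrow> nat) \<Rightarrow> complex"
  assumes "poly_bounded A" "poly_bounded B" shows "poly_bounded (\<lambda>n. A n * B n)"
proof -
  obtain K d where K: "0 \<le> K" "\<And>n. norm (A n) \<le> K * msize n ^ d"
    using poly_boundedE[OF assms(1)] by blast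
  obtain L e where L: "0 \<le> L" "\<And>n. norm (B n) \<le> L * msize n ^ e"
    using poly_boundedE[OF assms(2)] by blast
  show ?thesis
  proof (rule poly_boundedI)
    fix n :: "'m \<Rightarrow> nat"
    let ?p = "msize n"
    have "norm (A n * B n) \<le> (K * ?p ^ d) * (L * ?p ^ e)"
      unfolding norm_mult using K L prod_Suc_ge_1[of n] by (intro mult_mono) auto
    then show "norm (A n * B n) \<le> (K * L) * ?p ^ (d + e)" by (simp add: power_add mult_ac)
  qed
qed

lemma poly_bounded_const: "poly_bounded (\<lambda>_. c)"
  by (rule poly_boundedI[of _ "norm c" 0]) simp

lemma poly_bounded_of_nat: "poly_bounded (\<lambda>n. of_nat (n k))"
proof (rule poly_boundedI)
  fix n :: "'a \<Rightarrow> nat"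
  show "norm (of_nat (n k) :: complex) \<le> 1 * msize n ^ 1"
    using Suc_le_prod_Suc[of n k] by simp
qed

lemma poly_bounded_sum: "(\<And>i. i \<in> I \<Longrightarrow> poly_bounded (A i)) \<Longrightarrow> poly_bounded (\<lambda>n. \<Sum>i\<in>I. A i n)"
  by (induction I rule: infinite_finite_induct) (auto intro: poly_bounded_const poly_bounded_add)

lemma poly_bounded_prod: "(\<And>i. i \<in> I \<Longrightarrow> poly_bounded (A i)) \<Longrightarrow> poly_bounded (\<lambda>n. \<Prod>i\<in>I. A i n)"
  by (induction I rule: infinite_finite_induct) (auto intro: poly_bounded_const poly_bounded_mult)

lemma prod_Suc_upd:
  "(\<Prod>i\<in>(UNIV::'m::finite set). real (Suc ((n(k := v)) i))) = real (Suc v) * (\<Prod>i\<in>UNIV - {k}. real (Suc (n i)))"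
  by (subst prod.remove[of UNIV k]) (auto intro!: prod.cong)

lemma poly_bounded_shift:
  fixes A :: "('m::finite \<Rightarrow> nat) \<Rightarrow> complex"
  assumes "poly_bounded A" and f: "\<And>v. f v \<le> Suc v"
  shows "poly_bounded (\<lambda>n. A (n(k := f (n k))))"
proof -
  obtain K d where K: "0 \<le> K" "\<And>n. norm (A n) \<le> K * msize n ^ d"
    using poly_boundedE[OF assms(1)] by blast
  show ?thesis
  proof (rule poly_boundedI)
    fix n :: "'m \<Rightarrow> nat"
    let ?p = "msize n"
    have "(msize (n(k := f (n k)))) \<le> 2 * ?p"
    proof -
      have "real (Suc (f (n k))) \<le> 2 * real (Suc (n k))" using f[of "n k"] by simp
      then have "real (Suc (f (n k))) * (\<Prod>i\<in>UNIV - {k}. real (Suc (n i))) \<le>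
          2 * real (Suc (n k)) * (\<Prod>i\<in>UNIV - {k}. real (Suc (n i)))"
        by (intro mult_right_mono prod_nonneg) auto
      then show ?thesis unfolding prod_Suc_upd by (simp add: prod.remove[of UNIV k] mult.assoc del: of_nat_Suc)
    qed
    then have "K * (msize (n(k := f (n k)))) ^ d \<le> K * (2 * ?p) ^ d"
      by (intro mult_left_mono power_mono K prod_nonneg) auto
    with K(2)[of "n(k := f (n k))"]
    show "norm (A (n(k := f (n k)))) \<le> (K * 2 ^ d) * ?p ^ d" by (simp add: power_mult_distrib mult.assoc)
  qed
qed

section \<open>Convergence and linearity of multiple power series\<close>

lemma summable_power_mult_geometric:
  assumes "norm (x::real) < 1" shows "summable (\<lambda>n. real (Suc n) ^ d * x ^ n)"
proof -
  have *: "summable (\<lambda>n. real n ^ d * x ^ n)" if "norm x < 1" for x :: real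
    using that
  proof (induction d arbitrary: x)
    case 0 then show ?case by (simp add: summable_geometric)
  next
    case (Suc d)
    \<comment> \<open>Induction on d through x d/dx, which multiplies the n-th coefficient by n and
      keeps the radius of convergence.\<close>
    from termdiff_converges[OF Suc.prems Suc.IH]
    have "summable (\<lambda>n. diffs (\<lambda>n. real n ^ d) n * x ^ n)" by simp
    then have "summable (\<lambda>n. x * (diffs (\<lambda>n. real n ^ d) n * x ^ n))" by (rule summable_mult)
    moreover have "x * (diffs (\<lambda>n. real n ^ d) n * x ^ n) = real (Suc n) ^ Suc d * x ^ Suc n" for n
      by (simp add: diffs_def)
    ultimately have "summable (\<lambda>n. real (Suc n) ^ Suc d * x ^ Suc n)" by simp
    then show ?case by (subst (asm) summable_Suc_iff)
  qed
  have "summable (\<lambda>n. norm (real (Suc n) ^ d * x ^ n))"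
  proof (rule summable_comparison_test')
    show "summable (\<lambda>n. diffs (\<lambda>n. real n ^ d) n * norm x ^ n)"
      by (rule termdiff_converges[of "norm x" 1]) (use assms * in auto)
    show "norm (norm (real (Suc n) ^ d * x ^ n)) \<le> diffs (\<lambda>n. real n ^ d) n * norm x ^ n" for n
      by (simp add: diffs_def norm_mult norm_power abs_mult power_abs mult_right_mono)
  qed
  then show ?thesis by (rule summable_norm_cancel)
qed

text \<open>The majorant is a product of one-variable series, so its summability reduces to
  \<open>summable_power_mult_geometric\<close> in each variable.\<close>

lemma mseries_abs_summable:
  fixes A :: "('m::finite \<Rightarrow> nat) \<Rightarrow> complex" and x :: "complex ^ 'm"
  assumes A: "poly_bounded A" and x: "\<And>i. norm (x $ i) < 1"
  shows "(\<lambda>n. norm (A n * monom_at x n)) summable_on UNIV"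
proof -
  obtain K d where K: "0 \<le> K" "\<And>n. norm (A n) \<le> K * msize n ^ d"
    using poly_boundedE[OF A] by blast
  let ?f = "\<lambda>i k. real (Suc k) ^ d * norm (x $ i) ^ k"
  have "Infinite_Set_Sum.abs_summable_on (?f i) UNIV" for i
    unfolding abs_summable_on_nat_iff' using summable_power_mult_geometric[of "norm (x $ i)" d] x[of i] by simp
  then have "Infinite_Set_Sum.abs_summable_on (\<lambda>n. \<Prod>i\<in>UNIV. ?f i (n i)) (PiE UNIV (\<lambda>_. UNIV))"
    by (intro abs_summable_on_prod_PiE) auto
  then have "Infinite_Sum.abs_summable_on (\<lambda>n. \<Prod>i\<in>UNIV. ?f i (n i)) (UNIV :: ('m \<Rightarrow> nat) set)"
    unfolding abs_summable_equivalent by simp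
  then have "(\<lambda>n. norm (\<Prod>i\<in>UNIV. ?f i (n i))) summable_on UNIV" .
  then have "(\<lambda>n. K * norm (\<Prod>i\<in>UNIV. ?f i (n i))) summable_on UNIV"
    by (rule summable_on_cmult_right)
  then show ?thesis
  proof (rule summable_on_comparison_test)
    fix n :: "'m \<Rightarrow> nat"
    have "norm (A n * monom_at x n) \<le> (K * msize n ^ d) * (\<Prod>i\<in>UNIV. norm (x $ i) ^ n i)"
      unfolding norm_mult by (intro mult_mono K(2)) (auto simp: prod_norm[symmetric] norm_power K(1) intro!: mult_nonneg_nonneg zero_le_power prod_nonneg)
    also have "\<dots> = K * norm (\<Prod>i\<in>UNIV. ?f i (n i))"
      by (simp add: prod.distrib prod_power_distrib abs_prod abs_mult power_abs)
    finally show "norm (A n * monom_at x n) \<le> K * norm (\<Prod>i\<in>UNIV. ?f i (n i))" .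
  qed simp
qed

lemma mseries_summable:
  fixes x :: "complex ^ 'm::finite"
  shows "poly_bounded A \<Longrightarrow> (\<And>i. norm (x $ i) < 1) \<Longrightarrow> (\<lambda>n. A n * monom_at x n) summable_on UNIV"
  by (rule abs_summable_summable) (rule mseries_abs_summable)

lemma mseries_add:
  fixes x :: "complex ^ 'm::finite"
  assumes "poly_bounded A" "poly_bounded B" "\<And>i. norm (x $ i) < 1"
  shows "mseries (\<lambda>n. A n + B n) x = mseries A x + mseries B x"
  unfolding mseries_def distrib_right using assms by (intro infsum_add mseries_summable)

lemma mseries_cmult: "mseries (\<lambda>n. c * A n) x = c * mseries A x"
  unfolding mseries_def by (simp add: mult.assoc infsum_cmult_right')

lemma mseries_sum:
  fixes x :: "complex ^ 'm::finite"
  assumes "\<And>i. i \<in> I \<Longrightarrow> poly_bounded (A i)" "\<And>i. norm (x $ i) < 1"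
  shows "mseries (\<lambda>n. \<Sum>i\<in>I. A i n) x = (\<Sum>i\<in>I. mseries (A i) x)"
  using assms(1)
proof (induction I rule: infinite_finite_induct)
  case (insert i I)
  then show ?case
    using mseries_add[of "A i" "\<lambda>n. \<Sum>i\<in>I. A i n" x] assms(2) by (simp add: poly_bounded_sum)
qed (simp_all add: mseries_def)

definition mderiv :: "'m::finite \<Rightarrow> (('m \<Rightarrow> nat) \<Rightarrow> complex) \<Rightarrow> ('m \<Rightarrow> nat) \<Rightarrow> complex" where
  "mderiv k A n = of_nat (Suc (n k)) * A (n(k := Suc (n k)))"

text \<open>Coefficients of x_k times the series. The case \<open>n k = 0\<close> is set to zero
  because truncated subtraction would return the coefficient at \<open>n\<close> itself.\<close>

definition mshift :: "'m::finite \<Rightarrow> (('m \<Rightarrow> nat) \<Rightarrow> complex) \<Rightarrow> ('m \<Rightarrow> nat) \<Rightarrow> complex" where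
  "mshift k A n = (if n k = 0 then 0 else A (n(k := n k - 1)))"

lemma poly_bounded_mderiv: "poly_bounded A \<Longrightarrow> poly_bounded (mderiv k A)"
  using poly_bounded_mult[OF poly_bounded_add[OF poly_bounded_const[of 1] poly_bounded_of_nat[of k]]
      poly_bounded_shift[of A Suc k]]
  unfolding mderiv_def[abs_def] by simp

lemma poly_bounded_mshift: "poly_bounded A \<Longrightarrow> poly_bounded (mshift k A)"
proof -
  assume "poly_bounded A"
  then have "poly_bounded (\<lambda>n. A (n(k := n k - 1)))"
    by (rule poly_bounded_shift[where f = "\<lambda>v. v - 1"]) simp
  then obtain K d where K: "0 \<le> K"
    "\<And>n. norm (A (n(k := n k - 1))) \<le> K * msize n ^ d"
    using poly_boundedE by blast
  show ?thesis
    by (rule poly_boundedI[of _ K d])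
       (use K in \<open>auto simp: mshift_def intro!: mult_nonneg_nonneg zero_le_power prod_nonneg\<close>)
qed

section \<open>Index shifts and termwise differentiation\<close>

lemma monom_at_upd:
  "monom_at x (n(k := v)) = (x $ k) ^ v * (\<Prod>i\<in>UNIV - {k}. (x $ i) ^ n i)"
  by (subst prod.remove[of UNIV k]) (auto intro!: prod.cong)

lemma monom_at_remove: "monom_at x n = (x $ k) ^ n k * (\<Prod>i\<in>UNIV - {k}. (x $ i) ^ n i)"
  by (simp add: prod.remove[of UNIV k])

lemma
  shows inj_shift_index: "inj (\<lambda>n::'m \<Rightarrow> nat. n(k := Suc (n k)))"
    and range_shift_index: "n k \<noteq> 0 \<Longrightarrow> n \<in> range (\<lambda>n::'m \<Rightarrow> nat. n(k := Suc (n k)))"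
proof -
  show "inj (\<lambda>n::'m \<Rightarrow> nat. n(k := Suc (n k)))"
  proof (rule injI)
    fix n n' :: "'m \<Rightarrow> nat" assume e: "n(k := Suc (n k)) = n'(k := Suc (n' k))"
    show "n = n'"
    proof
      fix i show "n i = n' i" using fun_cong[OF e, of i] by (cases "i = k") auto
    qed
  qed
  show "n \<in> range (\<lambda>n::'m \<Rightarrow> nat. n(k := Suc (n k)))" if "n k \<noteq> 0"
    by (rule range_eqI[of _ _ "n(k := n k - 1)"]) (use that in auto)
qed

lemma infsum_shift_index:
  fixes f :: "('m::finite \<Rightarrow> nat) \<Rightarrow> complex"
  assumes "\<And>n. n k = 0 \<Longrightarrow> f n = 0"
  shows "infsum f UNIV = (\<Sum>\<^sub>\<infinity>n\<in>UNIV. f (n(k := Suc (n k))))"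
proof -
  let ?s = "\<lambda>n::'m \<Rightarrow> nat. n(k := Suc (n k))"
  have "infsum f UNIV = infsum f (range ?s)"
    using assms range_shift_index[of _ k] by (intro infsum_cong_neutral) auto
  also have "\<dots> = (\<Sum>\<^sub>\<infinity>n\<in>UNIV. f (?s n))" using infsum_reindex[OF inj_shift_index, of f] by (simp add: o_def)
  finally show ?thesis .
qed

lemma mseries_mshift: "mseries (mshift k A) x = x $ k * mseries A x"
proof -
  have "mseries (mshift k A) x = (\<Sum>\<^sub>\<infinity>n\<in>UNIV. mshift k A (n(k := Suc (n k))) * monom_at x (n(k := Suc (n k))))"
    unfolding mseries_def by (rule infsum_shift_index[of k]) (simp add: mshift_def)
  also have "\<dots> = (\<Sum>\<^sub>\<infinity>n\<in>UNIV. x $ k * (A n * monom_at x n))"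
    unfolding monom_at_upd by (rule infsum_cong) (simp add: mshift_def monom_at_remove[of x _ k] mult_ac)
  finally show ?thesis unfolding mseries_def by (simp add: infsum_cmult_right')
qed

text \<open>A bijection between the natural numbers and the multi-indices turns the unordered sum
  into an ordinary series of holomorphic functions of s. On a disc of radius \<rho> < 1 it is
  dominated by its terms at \<rho>, so it may be differentiated termwise.\<close>

lemma mseries_deriv:
  fixes x :: "complex ^ 'm::finite"
  assumes A: "poly_bounded A" and x: "\<And>i. norm (x $ i) < 1"
  shows "((\<lambda>s. mseries A (\<chi> j. if j = k then s else x $ j)) has_field_derivative mseries (mderiv k A) x) (at (x $ k))"
proof -
  obtain \<rho> where \<rho>: "norm (x $ k) < \<rho>" "\<rho> < 1" using dense x by blast
  then have \<rho>0: "0 < \<rho>" using norm_ge_zero[of "x $ k"] by linarith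
  obtain e :: "nat \<Rightarrow> 'm \<Rightarrow> nat" where e: "bij e"
  proof -
    have "infinite (UNIV :: ('m \<Rightarrow> nat) set)"
    proof
      assume "finite (UNIV :: ('m \<Rightarrow> nat) set)"
      then have "finite (range (\<lambda>v. (\<lambda>_. v) :: 'm \<Rightarrow> nat))" by (rule finite_subset[rotated]) simp
      then have "finite (UNIV :: nat set)" by (rule finite_imageD) (auto simp: inj_on_def fun_eq_iff)
      then show False by simp
    qed
    from bij_betw_from_nat_into[OF countableI_type this] that show ?thesis by blast
  qed
  let ?p = "\<lambda>n. \<Prod>i\<in>UNIV - {k}. (x $ i) ^ n i"
  let ?y = "\<lambda>s. \<chi> j. if j = k then s else x $ j"
  define f where "f n s = A n * (s ^ n k * ?p n)" for n :: "'m \<Rightarrow> nat" and s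
  define f' where "f' n s = A n * (of_nat (n k) * s ^ (n k - 1) * ?p n)" for n :: "'m \<Rightarrow> nat" and s
  have f_eq: "A n * monom_at (?y s) n = f n s" for n s
    unfolding f_def monom_at_remove[of _ n k] by (auto intro!: arg_cong2[of _ _ _ _ "(*)"] prod.cong)
  have sm: "(\<lambda>n. norm (f n s)) summable_on UNIV" if "norm s < 1" for s
  proof -
    have "norm (?y s $ i) < 1" for i using that x by simp
    from mseries_abs_summable[OF A this] show ?thesis unfolding f_eq .
  qed
  have ser: "(\<lambda>n. f (e n) s) sums mseries A (?y s)" if "norm s < 1" for s
  proof -
    have "((\<lambda>n. f n s) has_sum mseries A (?y s)) UNIV"
      unfolding mseries_def f_eq using abs_summable_summable[OF sm[OF that]] by (rule has_sum_infsum)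
    then have "((\<lambda>n. f (e n) s) has_sum mseries A (?y s)) UNIV"
      using has_sum_reindex_bij_betw[OF e, of "\<lambda>n. f n s"] by simp
    then show ?thesis by (rule has_sum_imp_sums)
  qed
  have "norm (of_real \<rho> :: complex) < 1" using \<rho> \<rho>0 by simp
  from sm[OF this] have "(\<lambda>n. norm (f (e n) (of_real \<rho>))) summable_on UNIV"
    using summable_on_reindex_bij_betw[OF e, of "\<lambda>n. norm (f n (of_real \<rho>))"] by simp
  then have h: "summable (\<lambda>n. norm (f (e n) (of_real \<rho>)))" by (rule summable_on_imp_summable)
  have der: "(f n has_field_derivative f' n s) (at s)" for n s
    unfolding f_def[abs_def] f'_def by (auto intro!: derivative_eq_intros)
  obtain g g' where g: "\<And>s. s \<in> ball 0 \<rho> \<Longrightarrow> (\<lambda>n. f (e n) s) sums g s \<and> (\<lambda>n. f' (e n) s) sums g' s \<and>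
      (g has_field_derivative g' s) (at s)"
  proof -
    have "\<exists>g g'. \<forall>s\<in>ball 0 \<rho>. ((\<lambda>n. f (e n) s) sums g s) \<and> ((\<lambda>n. f' (e n) s) sums g' s) \<and>
        (g has_field_derivative g' s) (at s)"
    proof (rule series_and_derivative_comparison[OF open_ball h])
      show "\<forall>\<^sub>F n in sequentially. \<forall>s\<in>ball 0 \<rho>. norm (f (e n) s) \<le> norm (f (e n) (of_real \<rho>))"
      proof (intro always_eventually allI ballI)
        fix n s assume "s \<in> ball (0::complex) \<rho>"
        then have "norm s ^ e n k \<le> \<rho> ^ e n k" by (intro power_mono) auto
        then show "norm (f (e n) s) \<le> norm (f (e n) (of_real \<rho>))"
          unfolding f_def using \<rho>0 by (simp add: norm_mult norm_power mult_left_mono mult_right_mono)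
      qed
    qed (rule der, blast)
    with that show ?thesis by blast
  qed
  have xk: "x $ k \<in> ball 0 \<rho>" using \<rho> by simp
  have "((\<lambda>s. mseries A (?y s)) has_field_derivative g' (x $ k)) (at (x $ k))"
  proof (rule has_field_derivative_transform_within_open[OF _ open_ball xk])
    show "(g has_field_derivative g' (x $ k)) (at (x $ k))" using g[OF xk] by blast
    fix s assume s: "s \<in> ball (0::complex) \<rho>"
    then have "norm s < 1" using \<rho> by simp
    from sums_unique2[OF _ ser[OF this]] g[OF s] show "g s = mseries A (?y s)" by blast
  qed
  moreover have "g' (x $ k) = mseries (mderiv k A) x"
  proof -
    have sh: "f' (n(k := Suc (n k))) (x $ k) = mderiv k A n * monom_at x n" for n
      unfolding f'_def mderiv_def monom_at_remove[of x n k]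
      by (simp add: mult_ac)
    have 0: "n k = 0 \<Longrightarrow> f' n (x $ k) = 0" for n unfolding f'_def by simp
    have sum': "(\<lambda>n. norm (mderiv k A n * monom_at x n)) summable_on UNIV"
      by (rule mseries_abs_summable[OF poly_bounded_mderiv[OF A] x])
    let ?s = "\<lambda>n::'m \<Rightarrow> nat. n(k := Suc (n k))"
    \<comment> \<open>The terms with \<open>n k = 0\<close> vanish, so summability of the derived
      series can be read off after raising \<open>n k\<close> by one.\<close>
    have "(\<lambda>n. f' n (x $ k)) summable_on UNIV"
    proof -
      have "((\<lambda>n. f' n (x $ k)) \<circ> ?s) summable_on UNIV"
        unfolding o_def sh using abs_summable_summable[OF sum'] .
      then have "(\<lambda>n. f' n (x $ k)) summable_on range ?s" unfolding summable_on_reindex[OF inj_shift_index] .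
      then show ?thesis
        by (rule summable_on_cong_neutral[THEN iffD1, rotated -1]) (use 0 range_shift_index[of _ k] in auto)
    qed
    then have "((\<lambda>n. f' n (x $ k)) has_sum (infsum (\<lambda>n. f' n (x $ k)) UNIV)) UNIV" by (rule has_sum_infsum)
    then have "((\<lambda>n. f' (e n) (x $ k)) has_sum (infsum (\<lambda>n. f' n (x $ k)) UNIV)) UNIV"
      using has_sum_reindex_bij_betw[OF e, of "\<lambda>n. f' n (x $ k)"] by simp
    from sums_unique2[OF has_sum_imp_sums[OF this]] g[OF xk]
    have "g' (x $ k) = infsum (\<lambda>n. f' n (x $ k)) UNIV" by auto
    also have "\<dots> = (\<Sum>\<^sub>\<infinity>n\<in>UNIV. mderiv k A n * monom_at x n)"
      using infsum_shift_index[of k "\<lambda>n. f' n (x $ k)"] 0 unfolding sh by simp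
    finally show ?thesis unfolding mseries_def .
  qed
  ultimately show ?thesis by simp
qed

section \<open>Lauricella coefficients and contiguity\<close>

lemma not_nonpos_Ints_add_of_nat:
  fixes c :: complex
  assumes "c \<notin> \<int>\<^sub>\<le>\<^sub>0" shows "c + of_nat n \<noteq> 0"
proof
  assume "c + of_nat n = 0"
  then have "c = - of_nat n" by (simp add: eq_neg_iff_add_eq_0)
  with assms show False by simp
qed

text \<open>Consecutive quotients have ratio 1 + O(1/(n+1)), which Bernoulli's inequality bounds by
  (1 + 1/(n+1))^d for a natural number d; the product of these bounds telescopes.\<close>

lemma pochhammer_ratio_bound:
  fixes a c :: complex
  assumes c: "c \<notin> \<int>\<^sub>\<le>\<^sub>0"
  obtains d where "\<And>n. norm (pochhammer a n / pochhammer c n) \<le> real (Suc n) ^ d"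
proof -
  obtain M where M: "\<And>n. norm (inverse (of_nat n + c)) \<le> M"
    using bounded_inverse_of_nat_add by blast
  note cn = not_nonpos_Ints_add_of_nat[OF c]
  \<comment> \<open>L bounds (n+1) |a - c| / |c + n|, because (n+1)/(c+n) = 1 + (1-c)/(c+n).\<close>
  define L where "L = norm (a - c) * (1 + norm (1 - c) * M)"
  have L: "norm ((a - c) / (c + of_nat n)) \<le> L / real (Suc n)" for n
  proof -
    have "of_nat (Suc n) / (c + of_nat n) = 1 + (1 - c) * inverse (of_nat n + c)"
      using cn[of n] by (simp add: field_simps)
    then have "norm (of_nat (Suc n) / (c + of_nat n)) \<le> 1 + norm (1 - c) * norm (inverse (of_nat n + c))"
      using norm_triangle_ineq[of 1 "(1 - c) * inverse (of_nat n + c)"] by (simp add: norm_mult)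
    also have "\<dots> \<le> 1 + norm (1 - c) * M" by (intro add_left_mono mult_left_mono M) simp
    finally have "norm (a - c) * norm (of_nat (Suc n) / (c + of_nat n)) \<le> L"
      unfolding L_def by (rule mult_left_mono) simp
    then have "real (Suc n) * norm ((a - c) / (c + of_nat n)) \<le> L"
      by (simp add: norm_divide norm_mult mult_ac del: of_nat_Suc)
    then show ?thesis by (simp add: field_simps del: of_nat_Suc)
  qed
  obtain d :: nat where d: "L \<le> real d" using real_arch_simple by blast
  have "norm (pochhammer a n / pochhammer c n) \<le> real (Suc n) ^ d" for n
  proof (induction n)
    case (Suc n)
    have "(a + of_nat n) / (c + of_nat n) = 1 + (a - c) / (c + of_nat n)"
      using cn[of n] by (simp add: field_simps)
    then have "norm ((a + of_nat n) / (c + of_nat n)) \<le> 1 + L / real (Suc n)"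
      using norm_triangle_ineq[of 1 "(a - c) / (c + of_nat n)"] L[of n] by simp
    also have "\<dots> \<le> 1 + real d * (1 / real (Suc n))"
      using d by (simp add: divide_right_mono)
    also have "\<dots> \<le> (1 + 1 / real (Suc n)) ^ d"
      by (rule Bernoulli_inequality) (simp add: field_simps)
    finally have 1: "norm ((a + of_nat n) / (c + of_nat n)) \<le> (1 + 1 / real (Suc n)) ^ d" .
    have "norm (pochhammer a (Suc n) / pochhammer c (Suc n)) =
        norm (pochhammer a n / pochhammer c n) * norm ((a + of_nat n) / (c + of_nat n))"
      by (simp add: pochhammer_Suc norm_divide norm_mult)
    also have "\<dots> \<le> real (Suc n) ^ d * (1 + 1 / real (Suc n)) ^ d"
      by (intro mult_mono Suc.IH 1) auto
    also have "\<dots> = (real (Suc n) * (1 + 1 / real (Suc n))) ^ d" by (simp only: power_mult_distrib)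
    also have "real (Suc n) * (1 + 1 / real (Suc n)) = real (Suc (Suc n))" by (simp add: field_simps)
    finally show ?case .
  qed simp
  with that show ?thesis by blast
qed

lemma Suc_sum_le_prod_Suc: "real (Suc (\<Sum>i\<in>I. n i)) \<le> (\<Prod>i\<in>I. real (Suc (n i)))"
proof (induction I rule: infinite_finite_induct)
  case (insert i I)
  have "real (Suc (\<Sum>i\<in>insert i I. n i)) \<le> real (Suc (n i)) * real (Suc (\<Sum>i\<in>I. n i))"
    using insert.hyps by (simp add: algebra_simps sum_nonneg)
  also have "\<dots> \<le> real (Suc (n i)) * (\<Prod>i\<in>I. real (Suc (n i)))"
    by (intro mult_left_mono insert.IH) simp
  finally show ?case using insert.hyps by simp
qed simp_all

section \<open>Coefficients of Lauricella's series and their recurrences\<close>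

definition fd_coeff :: "complex \<Rightarrow> complex ^ 'm::finite \<Rightarrow> complex \<Rightarrow> ('m \<Rightarrow> nat) \<Rightarrow> complex" where
  "fd_coeff a b c n = pochhammer a (mdeg n) * (\<Prod>i\<in>UNIV. pochhammer (b $ i) (n i)) /
     (pochhammer c (mdeg n) * (\<Prod>i\<in>UNIV. fact (n i)))"

lemma FD_mseries: "FD a b c x = mseries (fd_coeff a b c) x"
  unfolding FD_def mseries_def fd_coeff_def ..

lemma poly_bounded_fd_coeff:
  fixes b :: "complex ^ 'm::finite"
  assumes c: "c \<notin> \<int>\<^sub>\<le>\<^sub>0"
  shows "poly_bounded (fd_coeff a b c)"
proof -
  have 1: "poly_bounded (\<lambda>n::'m \<Rightarrow> nat. pochhammer a (mdeg n) / pochhammer c (mdeg n))"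
  proof -
    obtain d where d: "\<And>n. norm (pochhammer a n / pochhammer c n) \<le> real (Suc n) ^ d"
      using pochhammer_ratio_bound[OF c, of a] by blast
    show ?thesis
    proof (rule poly_boundedI)
      fix n :: "'m \<Rightarrow> nat"
      note d[of "mdeg n"]
      also have "real (Suc (mdeg n)) ^ d \<le> msize n ^ d"
        by (intro power_mono Suc_sum_le_prod_Suc of_nat_0_le_iff)
      finally show "norm (pochhammer a (mdeg n) / pochhammer c (mdeg n)) \<le>
          1 * msize n ^ d" by simp
    qed
  qed
  have "(1::complex) \<notin> \<int>\<^sub>\<le>\<^sub>0" by simp
  have 2: "poly_bounded (\<lambda>n::'m \<Rightarrow> nat. pochhammer (b $ k) (n k) / fact (n k))" for k
  proof -
    obtain d where d: "\<And>n. norm (pochhammer (b $ k) n / pochhammer 1 n) \<le> real (Suc n) ^ d"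
      using pochhammer_ratio_bound[OF \<open>1 \<notin> \<int>\<^sub>\<le>\<^sub>0\<close>, of "b $ k"] by blast
    show ?thesis
    proof (rule poly_boundedI)
      fix n :: "'m \<Rightarrow> nat"
      note d[of "n k"]
      also have "real (Suc (n k)) ^ d \<le> msize n ^ d"
        by (intro power_mono Suc_le_prod_Suc) simp
      finally show "norm (pochhammer (b $ k) (n k) / fact (n k)) \<le>
          1 * msize n ^ d" by (simp add: pochhammer_fact)
    qed
  qed
  have "fd_coeff a b c = (\<lambda>n. (pochhammer a (mdeg n) / pochhammer c (mdeg n)) *
      (\<Prod>i\<in>UNIV. pochhammer (b $ i) (n i) / fact (n i)))"
    unfolding fd_coeff_def[abs_def] by (simp add: prod_dividef)
  then show ?thesis using poly_bounded_mult[OF 1 poly_bounded_prod[OF 2]] by simp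
qed

lemma FD_partial_mseries:
  fixes x :: "complex ^ 'm::finite"
  assumes "c \<notin> \<int>\<^sub>\<le>\<^sub>0" "\<And>i. norm (x $ i) < 1"
  shows "FD_partial a b c k x = mseries (mderiv k (fd_coeff a b c)) x"
  unfolding FD_partial_def FD_mseries
  by (rule DERIV_imp_deriv) (rule mseries_deriv[OF poly_bounded_fd_coeff[OF assms(1)] assms(2)])

lemma pochhammer_shift: "(a + of_nat n) * pochhammer a n = a * pochhammer (a + 1) n" for a :: complex
  using pochhammer_rec[of a n] pochhammer_Suc[of a n] by (simp add: mult.commute)

lemma pochhammer_nonzero: "c \<notin> \<int>\<^sub>\<le>\<^sub>0 \<Longrightarrow> pochhammer c n \<noteq> 0" for c :: complex
  by (auto simp: pochhammer_eq_0_iff)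

lemma fd_coeff_shift_a:
  "(a + of_nat (mdeg n)) * fd_coeff a b c n = a * fd_coeff (a + 1) b c n"
  unfolding fd_coeff_def using pochhammer_shift[of a "mdeg n"]
  by (simp add: mult.assoc[symmetric])

lemma fd_coeff_shift_c:
  assumes c: "c \<notin> \<int>\<^sub>\<le>\<^sub>0"
  shows "c * fd_coeff a b c n = (c + of_nat (mdeg n)) * fd_coeff a b (c + 1) n"
proof -
  let ?N = "mdeg n"
  have c1: "c + 1 \<notin> \<int>\<^sub>\<le>\<^sub>0" using c plus_one_in_nonpos_Ints_imp by blast
  have "c / pochhammer c ?N = (c + of_nat ?N) / pochhammer (c + 1) ?N"
    using pochhammer_shift[of c ?N] pochhammer_nonzero[OF c, of ?N] pochhammer_nonzero[OF c1, of ?N]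
    by (simp add: frac_eq_eq)
  then show ?thesis unfolding fd_coeff_def
    by (simp add: divide_inverse mult_ac)
qed

lemma fd_coeff_shift_ac:
  assumes "c \<notin> \<int>\<^sub>\<le>\<^sub>0"
  shows "c * ((a + of_nat (mdeg n)) * fd_coeff a b c n) =
    a * ((c + of_nat (mdeg n)) * fd_coeff (a + 1) b (c + 1) n)"
  unfolding fd_coeff_shift_a using fd_coeff_shift_c[OF assms, of "a + 1" b n] by simp

lemma fd_coeff_shift_b:
  "(b $ k - 1 + of_nat (n k)) * fd_coeff a (b - axis k 1) c n = (b $ k - 1) * fd_coeff a b c n"
proof -
  let ?b = "b - axis k 1"
  have "(\<Prod>i\<in>UNIV. pochhammer (?b $ i) (n i)) =
      pochhammer (b $ k - 1) (n k) * (\<Prod>i\<in>UNIV - {k}. pochhammer (b $ i) (n i))"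
    by (subst prod.remove[of UNIV k]) (auto simp: axis_def intro!: prod.cong)
  moreover have "(\<Prod>i\<in>UNIV. pochhammer (b $ i) (n i)) =
      pochhammer (b $ k) (n k) * (\<Prod>i\<in>UNIV - {k}. pochhammer (b $ i) (n i))"
    by (subst prod.remove[of UNIV k]) auto
  ultimately have "(b $ k - 1 + of_nat (n k)) * (\<Prod>i\<in>UNIV. pochhammer (?b $ i) (n i)) =
      (b $ k - 1) * (\<Prod>i\<in>UNIV. pochhammer (b $ i) (n i))"
    using pochhammer_shift[of "b $ k - 1" "n k"] by (simp add: mult.assoc[symmetric])
  then show ?thesis unfolding fd_coeff_def by (simp add: mult_ac)
qed

lemma sum_upd_Suc: "(\<Sum>i\<in>(UNIV::'m::finite set). (n(k := Suc (n k))) i) = Suc (mdeg n)"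
  by (simp add: sum.remove[of UNIV k])

text \<open>Raising n k by one multiplies the coefficient by (a + |n|)(b_k + n k) / ((c + |n|)(n k +
  1)), with |n| the total degree. As |n| and n k are eigenvalues of Euler operators, this is one
  form of Lauricella's differential equations.\<close>

lemma fd_coeff_rec:
  assumes c: "c \<notin> \<int>\<^sub>\<le>\<^sub>0"
  shows "(c + of_nat (mdeg n)) * mderiv k (fd_coeff a b c) n =
    (a + of_nat (mdeg n)) * ((b $ k + of_nat (n k)) * fd_coeff a b c n)"
proof -
  let ?N = "mdeg n" and ?n = "n(k := Suc (n k))"
  have p: "(\<Prod>i\<in>UNIV. pochhammer (b $ i) (?n i)) = (b $ k + of_nat (n k)) * (\<Prod>i\<in>UNIV. pochhammer (b $ i) (n i))"
    by (simp add: prod.remove[of UNIV k] pochhammer_Suc mult_ac)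
  have f: "(\<Prod>i\<in>UNIV. fact (?n i) :: complex) = of_nat (Suc (n k)) * (\<Prod>i\<in>UNIV. fact (n i))"
    by (simp add: prod.remove[of UNIV k] mult_ac)
  have n: "c + of_nat ?N \<noteq> 0" "of_nat (Suc (n k)) \<noteq> (0::complex)"
    using not_nonpos_Ints_add_of_nat[OF c, of ?N] by (simp_all del: of_nat_Suc of_nat_sum)
  have f0: "(\<Prod>i\<in>UNIV. fact (n i) :: complex) \<noteq> 0" by simp
  show ?thesis unfolding mderiv_def fd_coeff_def p f sum_upd_Suc pochhammer_Suc
    using n f0 pochhammer_nonzero[OF c, of ?N] by (simp add: divide_simps mult_ac del: of_nat_Suc of_nat_sum)
qed

lemma mshift_mderiv: "mshift k (mderiv k A) n = of_nat (n k) * A n"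
  unfolding mshift_def mderiv_def by simp

text \<open>This is \<open>fd_coeff_rec\<close> at the predecessor of n in direction k, whose total
  degree is one less.\<close>

lemma mshift_fd_coeff_aux:
  assumes c: "c \<notin> \<int>\<^sub>\<le>\<^sub>0"
  shows "(a + of_nat (mdeg n) - 1) * mshift k (\<lambda>n. (b $ k + of_nat (n k)) * fd_coeff a b c n) n =
    of_nat (n k) * ((c + of_nat (mdeg n) - 1) * fd_coeff a b c n)"
proof (cases "n k")
  case (Suc v)
  let ?n = "n(k := v)"
  have n: "n = ?n(k := Suc (?n k))" using Suc by auto
  then have N: "mdeg n = Suc (\<Sum>i\<in>UNIV. ?n i)" using sum_upd_Suc[of ?n k] by simp
  have "mderiv k (fd_coeff a b c) ?n = of_nat (n k) * fd_coeff a b c n"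
    unfolding mderiv_def using n Suc by simp
  with fd_coeff_rec[OF c, of ?n k a b] Suc show ?thesis
    unfolding N mshift_def by (simp add: mult_ac)
qed (simp add: mshift_def)

lemma of_nat_add_not_Ints: "a \<notin> \<int> \<Longrightarrow> a + of_nat n \<noteq> 0" for a :: complex
  by (metis Ints_minus Ints_of_nat add_eq_0_iff2)

text \<open>
  The coefficients of the series obtained by applying \<open>\<Sum>\<^sub>j (\<theta>\<^sub>j - x\<^sub>j (b\<^sub>j + \<theta>\<^sub>j))\<close>, where
  \<open>\<theta>\<^sub>j = x\<^sub>j \<partial>\<^sub>j\<close>.
\<close>

definition euler_part :: "complex ^ 'm::finite \<Rightarrow> (('m \<Rightarrow> nat) \<Rightarrow> complex) \<Rightarrow> ('m \<Rightarrow> nat) \<Rightarrow> complex" where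
  "euler_part b A n = (\<Sum>j\<in>UNIV. of_nat (n j) * A n + (-1) * mshift j (\<lambda>n. (b $ j + of_nat (n j)) * A n) n)"

lemma fd_coeff_neg_shift:
  fixes a c :: complex and b :: "complex ^ 'm::finite"
  assumes a: "a \<notin> \<int>" and c: "c \<notin> \<int>\<^sub>\<le>\<^sub>0"
  shows "mshift k (\<lambda>n. (b $ k + of_nat (n k)) * fd_coeff (a + 1) b c n) n =
    of_nat (n k) * (c + of_nat (mdeg n) - 1) * fd_coeff (a + 1) b c n / (a + of_nat (mdeg n))"
  using mshift_fd_coeff_aux[OF c, of "a + 1" n k b] of_nat_add_not_Ints[OF a, of "mdeg n"]
  by (simp add: divide_simps mult_ac del: of_nat_sum)

text \<open>By \<open>fd_coeff_neg_shift\<close> the j-th summand is n j times 1 - (c + |n| - 1)/(a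
  + |n|) times the coefficient. Apart from n j this does not depend on j, so the sum sees only the
  total degree.\<close>

lemma euler_part_fd_coeff:
  fixes a c :: complex and b :: "complex ^ 'm::finite"
  assumes a: "a \<notin> \<int>" and c: "c \<notin> \<int>\<^sub>\<le>\<^sub>0"
  shows "euler_part b (fd_coeff (a + 1) b c) n =
    of_nat (mdeg n) * (a + 1 - c) / (a + of_nat (mdeg n)) * fd_coeff (a + 1) b c n"
proof -
  let ?N = "of_nat (mdeg n) :: complex"
  have N: "a + ?N \<noteq> 0" by (rule of_nat_add_not_Ints[OF a])
  have "of_nat (n j) * fd_coeff (a + 1) b c n +
      (-1) * mshift j (\<lambda>n. (b $ j + of_nat (n j)) * fd_coeff (a + 1) b c n) n =
      of_nat (n j) * ((a + 1 - c) / (a + ?N) * fd_coeff (a + 1) b c n)" for j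
    unfolding fd_coeff_neg_shift[OF a c] using N
    by (simp add: divide_simps del: of_nat_sum) (simp add: algebra_simps del: of_nat_sum)
  then have "euler_part b (fd_coeff (a + 1) b c) n =
      (\<Sum>j\<in>UNIV. of_nat (n j) * ((a + 1 - c) / (a + ?N) * fd_coeff (a + 1) b c n))"
    unfolding euler_part_def by simp
  also have "\<dots> = ?N * ((a + 1 - c) / (a + ?N) * fd_coeff (a + 1) b c n)"
    by (simp only: sum_distrib_right[symmetric] of_nat_sum)
  finally show ?thesis by simp
qed

section \<open>Contiguity relations between coefficients\<close>

lemma mshift_fd_coeff:
  fixes a c :: complex and b :: "complex ^ 'm::finite"
  assumes a: "a \<notin> \<int>" and c: "c \<notin> \<int>\<^sub>\<le>\<^sub>0" and b: "b $ k \<notin> \<int>"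
  shows "mshift k (fd_coeff (a + 1) b c) n * ((b $ k - 1 + of_nat (n k)) * (a + of_nat (mdeg n))) =
    of_nat (n k) * (c + of_nat (mdeg n) - 1) * fd_coeff (a + 1) b c n"
proof (cases "n k = 0")
  case False
  then have "mshift k (\<lambda>n. (b $ k + of_nat (n k)) * fd_coeff (a + 1) b c n) n =
      (b $ k - 1 + of_nat (n k)) * mshift k (fd_coeff (a + 1) b c) n"
    unfolding mshift_def by (simp add: of_nat_diff)
  with fd_coeff_neg_shift[OF a c, of k b n] of_nat_add_not_Ints[OF a, of "mdeg n"]
  show ?thesis by (simp add: divide_simps mult_ac del: of_nat_sum)
qed (simp add: mshift_def)

text \<open>Once a + |n| is cleared this is (c - a - 1) a = (c - a - 1)(a + |n|) - (c - a - 1)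
  |n|.\<close>

lemma contiguous_coeff_a:
  fixes a c :: complex and b :: "complex ^ 'm::finite"
  assumes a: "a \<notin> \<int>" and c: "c \<notin> \<int>\<^sub>\<le>\<^sub>0"
  shows "(c - a - 1) * fd_coeff a b c n =
    (c - a - 1) * fd_coeff (a + 1) b c n + euler_part b (fd_coeff (a + 1) b c) n"
proof -
  let ?N = "of_nat (mdeg n) :: complex"
  have N: "a + ?N \<noteq> 0" by (rule of_nat_add_not_Ints[OF a])
  have "fd_coeff a b c n = a * fd_coeff (a + 1) b c n / (a + ?N)"
    using fd_coeff_shift_a[of a n b c] N by (simp add: field_simps del: of_nat_sum)
  then show ?thesis unfolding euler_part_fd_coeff[OF a c] using N
    by (simp add: divide_simps del: of_nat_sum) (simp add: algebra_simps del: of_nat_sum)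
qed

text \<open>Reduces to a (c + |n|) = c (a + |n|) + |n| (a - c).\<close>

lemma contiguous_coeff_ac:
  fixes a c :: complex and b :: "complex ^ 'm::finite"
  assumes a: "a \<notin> \<int>" and c: "c \<notin> \<int>\<^sub>\<le>\<^sub>0" and c1: "c + 1 \<notin> \<int>\<^sub>\<le>\<^sub>0"
  shows "c * fd_coeff a b c n =
    c * fd_coeff (a + 1) b (c + 1) n + euler_part b (fd_coeff (a + 1) b (c + 1)) n"
proof -
  let ?N = "of_nat (mdeg n) :: complex"
  have N: "a + ?N \<noteq> 0" by (rule of_nat_add_not_Ints[OF a])
  have "c * fd_coeff a b c n = a * ((c + ?N) * fd_coeff (a + 1) b (c + 1) n) / (a + ?N)"
    using fd_coeff_shift_ac[OF c, of a n b] N by (simp add: divide_simps mult_ac del: of_nat_sum)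
  then show ?thesis unfolding euler_part_fd_coeff[OF a c1] using N
    by (simp add: divide_simps del: of_nat_sum) (simp add: algebra_simps del: of_nat_sum)
qed

text \<open>Lowering b_k multiplies the coefficient by (b_k - 1)/(b_k - 1 + n k) = 1 - n k/(b_k - 1
  + n k). The second part is exactly the term with a x_k; the first is the relation for (a,
  c).\<close>

lemma contiguous_coeff_abc:
  fixes a c :: complex and b :: "complex ^ 'm::finite"
  assumes a: "a \<notin> \<int>" and c: "c \<notin> \<int>\<^sub>\<le>\<^sub>0" and c1: "c + 1 \<notin> \<int>\<^sub>\<le>\<^sub>0" and b: "b $ k \<notin> \<int>"
  shows "c * fd_coeff a (b - axis k 1) c n =
    c * fd_coeff (a + 1) b (c + 1) n + euler_part b (fd_coeff (a + 1) b (c + 1)) n +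
    (- a) * mshift k (fd_coeff (a + 1) b (c + 1)) n"
proof -
  let ?N = "of_nat (mdeg n) :: complex" and ?A = "fd_coeff (a + 1) b (c + 1) n"
  let ?B = "b $ k - 1 + of_nat (n k)"
  have N: "a + ?N \<noteq> 0" by (rule of_nat_add_not_Ints[OF a])
  have "b $ k - 1 \<notin> \<int>" using b by (metis Ints_1 Ints_add diff_add_cancel)
  then have B: "?B \<noteq> 0" by (rule of_nat_add_not_Ints)
  have e1: "c * fd_coeff a b c n = a * (c + ?N) * ?A / (a + ?N)"
    using fd_coeff_shift_ac[OF c, of a n b] N by (simp add: divide_simps mult_ac del: of_nat_sum)
  have e2: "mshift k (fd_coeff (a + 1) b (c + 1)) n = of_nat (n k) * (c + ?N) * ?A / (?B * (a + ?N))"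
    using mshift_fd_coeff[OF a c1 b, of n] N B by (simp add: eq_divide_eq del: of_nat_sum)
  note 1 = arg_cong2[of _ _ _ _ "\<lambda>u v. u + (- a) * v", OF e1 e2]
  have "?B * (c * fd_coeff a (b - axis k 1) c n) = c * ((b $ k - 1) * fd_coeff a b c n)"
    using fd_coeff_shift_b[of b k n a c] by (simp add: mult_ac)
  also have "\<dots> = (b $ k - 1) * (a * (c + ?N) * ?A / (a + ?N))"
    using fd_coeff_shift_ac[OF c, of a n b] N by (simp add: divide_simps mult_ac del: of_nat_sum)
  also have "\<dots> = ?B * (c * fd_coeff a b c n + (- a) * mshift k (fd_coeff (a + 1) b (c + 1)) n)"
    unfolding 1 using N B by (simp add: divide_simps del: of_nat_sum) (simp add: algebra_simps del: of_nat_sum)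
  finally have "c * fd_coeff a (b - axis k 1) c n =
      c * fd_coeff a b c n + (- a) * mshift k (fd_coeff (a + 1) b (c + 1)) n" using B by simp
  then show ?thesis using contiguous_coeff_ac[OF a c c1, of b n] by simp
qed

text \<open>Split c - a - 1 = (c + |n|) - (a + 1 + |n|): the recurrence at a + 1 converts the first
  part, after which the factor a + 1 + |n| cancels.\<close>

lemma mderiv_coeff_a:
  fixes a c :: complex and b :: "complex ^ 'm::finite"
  assumes a: "a \<notin> \<int>" and c: "c \<notin> \<int>\<^sub>\<le>\<^sub>0"
  shows "(c - a - 1) * mderiv i (fd_coeff a b c) n =
    a * ((b $ i + of_nat (n i)) * fd_coeff (a + 1) b c n + (-1) * mderiv i (fd_coeff (a + 1) b c) n)"
proof -
  let ?N = "of_nat (mdeg n) :: complex"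
  have N: "a + of_nat (Suc (mdeg n)) \<noteq> 0" by (rule of_nat_add_not_Ints[OF a])
  have C: "c + ?N \<noteq> 0" by (rule not_nonpos_Ints_add_of_nat[OF c])
  have 1: "(a + of_nat (Suc (mdeg n))) * mderiv i (fd_coeff a b c) n = a * mderiv i (fd_coeff (a + 1) b c) n"
    using fd_coeff_shift_a[of a "n(i := Suc (n i))" b c] unfolding mderiv_def sum_upd_Suc by (metis mult.left_commute)
  have "(c + ?N) * ((a + of_nat (Suc (mdeg n))) * ((c - a - 1) * mderiv i (fd_coeff a b c) n)) =
      (c + ?N) * ((c - a - 1) * (a * mderiv i (fd_coeff (a + 1) b c) n))"
    using 1 by (metis mult.left_commute)
  also have "\<dots> = (c - a - 1) * a * ((a + 1 + ?N) * ((b $ i + of_nat (n i)) * fd_coeff (a + 1) b c n))"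
    using fd_coeff_rec[OF c, of n i "a + 1" b] by (metis mult.assoc mult.left_commute)
  also have "\<dots> = (a + of_nat (Suc (mdeg n))) * (a * ((c + ?N) * ((b $ i + of_nat (n i)) * fd_coeff (a + 1) b c n) +
      (-1) * ((a + 1 + ?N) * ((b $ i + of_nat (n i)) * fd_coeff (a + 1) b c n))))"
    by (simp add: algebra_simps del: of_nat_sum)
  also have "\<dots> = (c + ?N) * ((a + of_nat (Suc (mdeg n))) * (a * ((b $ i + of_nat (n i)) * fd_coeff (a + 1) b c n +
      (-1) * mderiv i (fd_coeff (a + 1) b c) n)))"
    unfolding fd_coeff_rec[OF c, of n i "a + 1" b, symmetric] by (simp add: algebra_simps del: of_nat_sum)
  finally show ?thesis using C N by (simp del: of_nat_sum of_nat_Suc)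
qed

lemma mderiv_coeff_ac:
  fixes a c :: complex and b :: "complex ^ 'm::finite"
  assumes a: "a \<notin> \<int>" and c: "c \<notin> \<int>\<^sub>\<le>\<^sub>0" and c1: "c + 1 \<notin> \<int>\<^sub>\<le>\<^sub>0"
  shows "c * mderiv i (fd_coeff a b c) n = a * ((b $ i + of_nat (n i)) * fd_coeff (a + 1) b (c + 1) n)"
proof -
  let ?N = "of_nat (mdeg n) :: complex" and ?S = "of_nat (Suc (mdeg n)) :: complex"
  have N: "a + ?S \<noteq> 0" by (rule of_nat_add_not_Ints[OF a])
  have "(a + ?S) * (c * mderiv i (fd_coeff a b c) n) = a * ((c + ?S) * mderiv i (fd_coeff (a + 1) b (c + 1)) n)"
    using fd_coeff_shift_ac[OF c, of a "n(i := Suc (n i))" b] unfolding mderiv_def sum_upd_Suc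
    by (metis mult.left_commute)
  also have "\<dots> = a * ((a + ?S) * ((b $ i + of_nat (n i)) * fd_coeff (a + 1) b (c + 1) n))"
    using fd_coeff_rec[OF c1, of n i "a + 1" b] by (simp add: add_ac del: of_nat_sum)
  finally have "(a + ?S) * (c * mderiv i (fd_coeff a b c) n) =
      (a + ?S) * (a * ((b $ i + of_nat (n i)) * fd_coeff (a + 1) b (c + 1) n))" by (simp add: mult_ac del: of_nat_sum of_nat_Suc)
  with N show ?thesis by (metis mult_cancel_left)
qed

text \<open>At n k + 1 the factor b_k - 1 + n k of \<open>fd_coeff_shift_b\<close> becomes b_k + n
  k, the one produced by \<open>mderiv_coeff_ac\<close>. It cancels, which matches the zero diagonal
  entry x_k - x_k of the matrix.\<close>

lemma mderiv_coeff_abc_same: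
  fixes a c :: complex and b :: "complex ^ 'm::finite"
  assumes a: "a \<notin> \<int>" and c: "c \<notin> \<int>\<^sub>\<le>\<^sub>0" and c1: "c + 1 \<notin> \<int>\<^sub>\<le>\<^sub>0" and b: "b $ k \<notin> \<int>"
  shows "c * mderiv k (fd_coeff a (b - axis k 1) c) n = a * (b $ k - 1) * fd_coeff (a + 1) b (c + 1) n"
proof -
  have B: "b $ k + of_nat (n k) \<noteq> 0" by (rule of_nat_add_not_Ints[OF b])
  have "(b $ k + of_nat (n k)) * mderiv k (fd_coeff a (b - axis k 1) c) n =
      (b $ k - 1) * mderiv k (fd_coeff a b c) n"
    using fd_coeff_shift_b[of b k "n(k := Suc (n k))" a c] unfolding mderiv_def
    by (simp add: mult_ac)
  then have "(b $ k + of_nat (n k)) * (c * mderiv k (fd_coeff a (b - axis k 1) c) n) =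
      (b $ k - 1) * (c * mderiv k (fd_coeff a b c) n)" by (metis mult.left_commute)
  also have "\<dots> = (b $ k + of_nat (n k)) * (a * (b $ k - 1) * fd_coeff (a + 1) b (c + 1) n)"
    unfolding mderiv_coeff_ac[OF a c c1] by (simp add: mult_ac)
  finally show ?thesis using B by simp
qed

lemma mderiv_coeff_abc_other:
  fixes a c :: complex and b :: "complex ^ 'm::finite"
  assumes a: "a \<notin> \<int>" and c: "c \<notin> \<int>\<^sub>\<le>\<^sub>0" and c1: "c + 1 \<notin> \<int>\<^sub>\<le>\<^sub>0" and b: "b $ k \<notin> \<int>" and ik: "i \<noteq> k"
  shows "c * mderiv i (fd_coeff a (b - axis k 1) c) n =
    a * ((b $ i + of_nat (n i)) * fd_coeff (a + 1) b (c + 1) n +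
      (-1) * mshift k (mderiv i (fd_coeff (a + 1) b (c + 1))) n)"
proof -
  let ?B = "b $ k - 1 + of_nat (n k)" and ?A = "fd_coeff (a + 1) b (c + 1)"
  let ?N = "of_nat (mdeg n) :: complex"
  have "b $ k - 1 \<notin> \<int>" using b by (metis Ints_1 Ints_add diff_add_cancel)
  then have B: "?B \<noteq> 0" by (rule of_nat_add_not_Ints)
  have N: "a + ?N \<noteq> 0" by (rule of_nat_add_not_Ints[OF a])
  have C: "c + ?N \<noteq> 0" by (rule not_nonpos_Ints_add_of_nat[OF c])
  \<comment> \<open>The left side lives at the predecessor of n in direction k. The recurrence for i
    there and the one for k between the two indices together bring it back to n.\<close>
  have sh: "?B * mshift k (mderiv i ?A) n = of_nat (n k) * ((b $ i + of_nat (n i)) * ?A n)"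
  proof (cases "n k")
    case (Suc v)
    let ?n = "n(k := v)"
    have n: "n = ?n(k := Suc (?n k))" using Suc by auto
    then have S: "mdeg n = Suc (\<Sum>i\<in>UNIV. ?n i)" using sum_upd_Suc[of ?n k] by simp
    have "(c + 1 + of_nat (\<Sum>i\<in>UNIV. ?n i)) * mderiv i ?A ?n =
        (a + 1 + of_nat (\<Sum>i\<in>UNIV. ?n i)) * ((b $ i + of_nat (n i)) * ?A ?n)"
      using fd_coeff_rec[OF c1, of ?n i "a + 1" b] ik by simp
    then have 1: "(c + ?N) * mderiv i ?A ?n = (a + ?N) * ((b $ i + of_nat (n i)) * ?A ?n)"
      unfolding S by (simp add: add_ac del: of_nat_sum)
    have 2: "?A ?n * (?B * (a + ?N)) = of_nat (n k) * (c + ?N) * ?A n"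
      using mshift_fd_coeff[OF a c1 b, of n] Suc unfolding mshift_def by (simp add: add_ac del: of_nat_sum)
    have "(c + ?N) * (?B * mderiv i ?A ?n) = ?B * ((c + ?N) * mderiv i ?A ?n)" by (rule mult.left_commute)
    also have "\<dots> = (b $ i + of_nat (n i)) * (?A ?n * (?B * (a + ?N)))" unfolding 1 by (simp only: mult_ac)
    also have "\<dots> = (c + ?N) * (of_nat (n k) * ((b $ i + of_nat (n i)) * ?A n))"
      unfolding 2 by (simp add: mult_ac)
    finally have "?B * mderiv i ?A ?n = of_nat (n k) * ((b $ i + of_nat (n i)) * ?A n)" using C by simp
    then show ?thesis using Suc unfolding mshift_def by simp
  qed (simp add: mshift_def)
  have "?B * mderiv i (fd_coeff a (b - axis k 1) c) n = (b $ k - 1) * mderiv i (fd_coeff a b c) n"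
    using fd_coeff_shift_b[of b k "n(i := Suc (n i))" a c] ik unfolding mderiv_def
    by simp
  then have "?B * (c * mderiv i (fd_coeff a (b - axis k 1) c) n) = (b $ k - 1) * (c * mderiv i (fd_coeff a b c) n)"
    by (metis mult.left_commute)
  also have "\<dots> = a * (?B * ((b $ i + of_nat (n i)) * ?A n) + (-1) * (of_nat (n k) * ((b $ i + of_nat (n i)) * ?A n)))"
    unfolding mderiv_coeff_ac[OF a c c1] by (simp add: algebra_simps)
  also have "\<dots> = ?B * (a * ((b $ i + of_nat (n i)) * ?A n + (-1) * mshift k (mderiv i ?A) n))"
    unfolding sh[symmetric] by (simp add: algebra_simps)
  finally show ?thesis using B by simp
qed

section \<open>From relations between coefficients to relations between series\<close>

lemma mseries_linear_factor:
  fixes b x :: "complex ^ 'm::finite"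
  assumes A: "poly_bounded A" and x: "\<And>i. norm (x $ i) < 1"
  shows "mseries (\<lambda>n. (b $ j + of_nat (n j)) * A n) x = b $ j * mseries A x + x $ j * mseries (mderiv j A) x"
    and "poly_bounded (\<lambda>n. (b $ j + of_nat (n j)) * A n)"
proof -
  have eq: "(\<lambda>n. (b $ j + of_nat (n j)) * A n) = (\<lambda>n. b $ j * A n + mshift j (mderiv j A) n)"
    by (simp add: fun_eq_iff mshift_mderiv algebra_simps)
  note p = poly_bounded_mult[OF poly_bounded_const A, of "b $ j"] poly_bounded_mshift[OF poly_bounded_mderiv[OF A], of j j]
  show "mseries (\<lambda>n. (b $ j + of_nat (n j)) * A n) x = b $ j * mseries A x + x $ j * mseries (mderiv j A) x"
    unfolding eq by (subst mseries_add[OF p x]) (simp add: mseries_cmult mseries_mshift)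
  show "poly_bounded (\<lambda>n. (b $ j + of_nat (n j)) * A n)" unfolding eq by (rule poly_bounded_add[OF p])
qed

lemma mseries_euler_part:
  fixes b x :: "complex ^ 'm::finite"
  assumes A: "poly_bounded A" and x: "\<And>i. norm (x $ i) < 1"
  shows "mseries (\<lambda>n. euler_part b A n) x =
      (\<Sum>j\<in>UNIV. x $ j * (1 - x $ j) * mseries (mderiv j A) x - b $ j * x $ j * mseries A x)"
    and "poly_bounded (\<lambda>n. euler_part b A n)"
proof -
  let ?e = "\<lambda>j n. of_nat (n j) * A n + (-1) * mshift j (\<lambda>n. (b $ j + of_nat (n j)) * A n) n"
  have p1: "poly_bounded (\<lambda>n. of_nat (n j) * A n)" for j
    by (rule poly_bounded_mult[OF poly_bounded_of_nat A])
  have p2: "poly_bounded (\<lambda>n. (-1) * mshift j (\<lambda>n. (b $ j + of_nat (n j)) * A n) n)" for j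
    by (intro poly_bounded_mult poly_bounded_const poly_bounded_mshift mseries_linear_factor(2)[OF A x])
  have "mseries (\<lambda>n. of_nat (n j) * A n) x = x $ j * mseries (mderiv j A) x" for j
    unfolding mshift_mderiv[symmetric] mseries_mshift ..
  moreover have "mseries (\<lambda>n. (-1) * mshift j (\<lambda>n. (b $ j + of_nat (n j)) * A n) n) x =
      - (x $ j * (b $ j * mseries A x + x $ j * mseries (mderiv j A) x))" for j
    unfolding mseries_cmult mseries_mshift mseries_linear_factor(1)[OF A x] by simp
  ultimately have e: "mseries (?e j) x = x $ j * (1 - x $ j) * mseries (mderiv j A) x - b $ j * x $ j * mseries A x" for j
    unfolding mseries_add[OF p1 p2 x] by (simp add: algebra_simps)
  show "mseries (\<lambda>n. euler_part b A n) x =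
      (\<Sum>j\<in>UNIV. x $ j * (1 - x $ j) * mseries (mderiv j A) x - b $ j * x $ j * mseries A x)"
    unfolding euler_part_def by (subst mseries_sum[OF poly_bounded_add[OF p1 p2] x]) (simp only: e)
  show "poly_bounded (\<lambda>n. euler_part b A n)"
    unfolding euler_part_def by (intro poly_bounded_sum poly_bounded_add[OF p1 p2])
qed

text \<open>
  The matrix of multiplication by \<open>t - x\<^sub>p\<close> on the first twisted cohomology group, with respect to
  the basis \<^const>\<open>phi\<close>.
\<close>

definition mult_matrix :: "'m idx \<Rightarrow> complex \<Rightarrow> complex ^ 'm::finite \<Rightarrow> complex \<Rightarrow> complex ^ 'm \<Rightarrow>
    complex ^ 'm option ^ 'm option" where
  "mult_matrix p a b c x = (\<chi> i l. case i of
       None \<Rightarrow> (case l of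
           None \<Rightarrow> 1 - pt x p + (c - a - (\<Sum>j\<in>UNIV. b $ j * x $ j)) / (a - 1)
         | Some j \<Rightarrow> b $ j * x $ j / (a - 1))
     | Some k \<Rightarrow> (case l of
           None \<Rightarrow> 1 - x $ k
         | Some j \<Rightarrow> if j = k then x $ k - pt x p else 0))"

section \<open>The multiplication matrix applied to the vector F\<close>

lemma sum_option: "(\<Sum>j\<in>UNIV. h j) = h None + (\<Sum>i\<in>UNIV. h (Some i))"
  for h :: "'m::finite option \<Rightarrow> complex"
  by (simp add: UNIV_option_conv sum.reindex)

lemma mult_matrix_None:
  "(mult_matrix p a b c x *v y) $ None = (1 - pt x p + (c - a - (\<Sum>j\<in>UNIV. b $ j * x $ j)) / (a - 1)) * y $ None +
    (\<Sum>j\<in>UNIV. b $ j * x $ j / (a - 1) * y $ Some j)"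
  unfolding matrix_vector_mult_def mult_matrix_def by (simp add: sum_option)

lemma mult_matrix_Some:
  "(mult_matrix p a b c x *v y) $ Some k = (1 - x $ k) * y $ None + (x $ k - pt x p) * y $ Some k"
proof -
  have "(\<Sum>j\<in>UNIV. (if j = k then x $ k - pt x p else 0) * y $ Some j) = (x $ k - pt x p) * y $ Some k"
    by (simp add: if_distrib[of "\<lambda>c. c * _"] cong: if_cong)
  then show ?thesis unfolding matrix_vector_mult_def mult_matrix_def by (simp add: sum_option)
qed

lemma Fvec_None: "Fvec a b c x $ None = FD a b c x"
  and Fvec_Some: "Fvec a b c x $ Some k = (x $ k - 1) / (- (b $ k)) * FD_partial a b c k x"
  unfolding Fvec_def by simp_all

lemma eq_divide_mult: "u \<noteq> 0 \<Longrightarrow> u * v = a * y \<Longrightarrow> v = a / u * y" for u v a y :: complex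
  by (simp add: nonzero_eq_divide_eq mult.commute)

lemma mat_mult_vec: "(mat s *v y) $ i = s * y $ i" for y :: "complex ^ 'n::finite"
  unfolding matrix_vector_mult_def mat_def by (simp add: if_distrib[of "\<lambda>c. c * _"] cong: if_cong)

text \<open>The normalization (x_j - 1)/(- b_j) of the vector turns the entry b_j x_j / a into x_j
  (1 - x_j) / a, which is how the Euler operator of \<open>euler_part\<close> arises. The matrix is
  taken at a + 1, so its denominator is a.\<close>

lemma mult_matrix_None_Fvec:
  fixes b x :: "complex ^ 'm::finite"
  assumes a: "a \<noteq> 0" and b: "\<And>k. b $ k \<noteq> 0" and c: "c \<notin> \<int>\<^sub>\<le>\<^sub>0" and x: "\<And>i. norm (x $ i) < 1"
  shows "a * (mult_matrix p (a + 1) b c x *v Fvec (a + 1) b c x) $ None =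
    (c - 1) * FD (a + 1) b c x + mseries (\<lambda>n. euler_part b (fd_coeff (a + 1) b c) n) x - a * pt x p * FD (a + 1) b c x"
proof -
  let ?A = "fd_coeff (a + 1) b c"
  let ?D = "\<lambda>j. mseries (mderiv j ?A) x"
  have D: "Fvec (a + 1) b c x $ Some j = (x $ j - 1) / (- (b $ j)) * ?D j" for j
    unfolding Fvec_Some FD_partial_mseries[OF c x] ..
  have h: "a * ((1 - P + Q / a) * F + S) = (a * (1 - P) + Q) * F + a * S" for P Q F S
    using a by (simp add: field_simps)
  have a1: "a + 1 - 1 = a" by simp
  have D': "a * (b $ j * x $ j / a * ((x $ j - 1) / (- (b $ j)) * ?D j)) = x $ j * (1 - x $ j) * ?D j" for j
    using a b[of j] by (simp add: field_simps)
  have "a * (mult_matrix p (a + 1) b c x *v Fvec (a + 1) b c x) $ None =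
      (a * (1 - pt x p) + (c - (a + 1) - (\<Sum>j\<in>UNIV. b $ j * x $ j))) * FD (a + 1) b c x +
      (\<Sum>j\<in>UNIV. a * (b $ j * x $ j / a * ((x $ j - 1) / (- (b $ j)) * ?D j)))"
    unfolding mult_matrix_None D a1 h Fvec_None sum_distrib_left ..
  also have "\<dots> = (c - 1 - a * pt x p) * FD (a + 1) b c x +
      (\<Sum>j\<in>UNIV. x $ j * (1 - x $ j) * ?D j - b $ j * x $ j * FD (a + 1) b c x)"
  proof -
    have h': "(a * (1 - P) + (c - (a + 1) - Q)) * F + S = (c - 1 - a * P) * F + (S - Q * F)" for P Q F S
      by (simp add: algebra_simps)
    show ?thesis unfolding D' h' sum_subtractf sum_distrib_right[symmetric] ..
  qed
  also have "(\<Sum>j\<in>UNIV. x $ j * (1 - x $ j) * ?D j - b $ j * x $ j * FD (a + 1) b c x) =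
      mseries (\<lambda>n. euler_part b ?A n) x"
    unfolding mseries_euler_part(1)[OF poly_bounded_fd_coeff[OF c] x] FD_mseries ..
  finally show ?thesis by (simp add: algebra_simps)
qed

text \<open>The entry 1 - x_k is b_k times the normalizing factor (x_k - 1)/(- b_k), so this factor
  comes out of the whole row.\<close>

lemma mult_matrix_Some_Fvec:
  fixes b x :: "complex ^ 'm::finite"
  assumes b: "b $ k \<noteq> 0" and c: "c \<notin> \<int>\<^sub>\<le>\<^sub>0" and x: "\<And>i. norm (x $ i) < 1"
  shows "(mult_matrix p a b c x *v Fvec a b c x) $ Some k = (x $ k - 1) / (- (b $ k)) *
    (b $ k * FD a b c x + (x $ k - pt x p) * mseries (mderiv k (fd_coeff a b c)) x)"
  unfolding mult_matrix_Some Fvec_def using b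
  by (simp add: FD_partial_mseries[OF c x] field_simps)

lemma Fvec_shift_a:
  fixes b x :: "complex ^ 'm::finite"
  assumes a: "a \<notin> \<int>" and b: "\<And>k. b $ k \<noteq> 0" and c: "c \<notin> \<int>\<^sub>\<le>\<^sub>0" and x: "\<And>i. norm (x $ i) < 1"
    and ca: "c - a - 1 \<noteq> 0"
  shows "Fvec a b c x = mat (a / (c - a - 1)) *v (mult_matrix Idx1 (a + 1) b c x *v Fvec (a + 1) b c x)"
proof (rule vec_eq_iff[THEN iffD2], rule allI)
  fix i :: "'m option"
  let ?A = "fd_coeff (a + 1) b c"
  have a0: "a \<noteq> 0" using a by auto
  have pA: "poly_bounded ?A" by (rule poly_bounded_fd_coeff[OF c])
  show "Fvec a b c x $ i =
      (mat (a / (c - a - 1)) *v (mult_matrix Idx1 (a + 1) b c x *v Fvec (a + 1) b c x)) $ i"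
  proof (cases i)
    case None
    have "(c - a - 1) * FD a b c x = mseries (\<lambda>n. (c - a - 1) * fd_coeff a b c n) x"
      unfolding FD_mseries mseries_cmult ..
    also have "\<dots> = (c - a - 1) * FD (a + 1) b c x + mseries (\<lambda>n. euler_part b ?A n) x"
      unfolding contiguous_coeff_a[OF a c]
      by (subst mseries_add[OF poly_bounded_mult[OF poly_bounded_const pA] mseries_euler_part(2)[OF pA x] x])
         (simp add: mseries_cmult FD_mseries)
    also have "\<dots> = a * (mult_matrix Idx1 (a + 1) b c x *v Fvec (a + 1) b c x) $ None"
      unfolding mult_matrix_None_Fvec[OF a0 b c x] by (simp add: algebra_simps)
    finally show ?thesis unfolding None mat_mult_vec Fvec_None by (rule eq_divide_mult[OF ca])
  next
    case (Some k)
    let ?D = "mseries (mderiv k ?A) x"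
    have "(c - a - 1) * mseries (mderiv k (fd_coeff a b c)) x = mseries (\<lambda>n. (c - a - 1) * mderiv k (fd_coeff a b c) n) x"
      unfolding mseries_cmult ..
    also have "\<dots> = a * (b $ k * FD (a + 1) b c x + (x $ k - 1) * ?D)"
      unfolding mderiv_coeff_a[OF a c] mseries_cmult
      by (subst mseries_add[OF mseries_linear_factor(2)[OF pA x] poly_bounded_mult[OF poly_bounded_const poly_bounded_mderiv[OF pA]] x])
         (simp only: mseries_cmult mseries_linear_factor(1)[OF pA x] FD_mseries, simp add: algebra_simps)
    finally have "mseries (mderiv k (fd_coeff a b c)) x = a / (c - a - 1) * (b $ k * FD (a + 1) b c x + (x $ k - 1) * ?D)"
      by (rule eq_divide_mult[OF ca])
    then show ?thesis
      unfolding Some mat_mult_vec mult_matrix_Some_Fvec[OF b c x] Fvec_Some FD_partial_mseries[OF c x]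
      by (simp only: pt.simps) (rule mult.left_commute)
  qed
qed

lemma Fvec_shift_ac:
  fixes b x :: "complex ^ 'm::finite"
  assumes a: "a \<notin> \<int>" and b: "\<And>k. b $ k \<noteq> 0" and c: "c \<notin> \<int>\<^sub>\<le>\<^sub>0" and x: "\<And>i. norm (x $ i) < 1"
  shows "Fvec a b c x = mat (a / c) *v (mult_matrix Idx0 (a + 1) b (c + 1) x *v Fvec (a + 1) b (c + 1) x)"
proof (rule vec_eq_iff[THEN iffD2], rule allI)
  fix i :: "'m option"
  let ?A = "fd_coeff (a + 1) b (c + 1)"
  have a0: "a \<noteq> 0" using a by auto
  have c0: "c \<noteq> 0" using c by auto
  have c1: "c + 1 \<notin> \<int>\<^sub>\<le>\<^sub>0" using c plus_one_in_nonpos_Ints_imp by blast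
  have pA: "poly_bounded ?A" by (rule poly_bounded_fd_coeff[OF c1])
  show "Fvec a b c x $ i =
      (mat (a / c) *v (mult_matrix Idx0 (a + 1) b (c + 1) x *v Fvec (a + 1) b (c + 1) x)) $ i"
  proof (cases i)
    case None
    have "c * FD a b c x = mseries (\<lambda>n. c * fd_coeff a b c n) x"
      unfolding FD_mseries mseries_cmult ..
    also have "\<dots> = c * FD (a + 1) b (c + 1) x + mseries (\<lambda>n. euler_part b ?A n) x"
      unfolding contiguous_coeff_ac[OF a c c1]
      by (subst mseries_add[OF poly_bounded_mult[OF poly_bounded_const pA] mseries_euler_part(2)[OF pA x] x])
         (simp add: mseries_cmult FD_mseries)
    also have "\<dots> = a * (mult_matrix Idx0 (a + 1) b (c + 1) x *v Fvec (a + 1) b (c + 1) x) $ None"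
      unfolding mult_matrix_None_Fvec[OF a0 b c1 x] by (simp add: algebra_simps)
    finally show ?thesis unfolding None mat_mult_vec Fvec_None by (rule eq_divide_mult[OF c0])
  next
    case (Some k)
    have "c * mseries (mderiv k (fd_coeff a b c)) x = mseries (\<lambda>n. c * mderiv k (fd_coeff a b c) n) x"
      unfolding mseries_cmult ..
    also have "\<dots> = a * (b $ k * FD (a + 1) b (c + 1) x + x $ k * mseries (mderiv k ?A) x)"
      unfolding mderiv_coeff_ac[OF a c c1] mseries_cmult mseries_linear_factor(1)[OF pA x] FD_mseries ..
    finally have "mseries (mderiv k (fd_coeff a b c)) x =
        a / c * (b $ k * FD (a + 1) b (c + 1) x + x $ k * mseries (mderiv k ?A) x)"
      by (rule eq_divide_mult[OF c0])
    then show ?thesis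
      unfolding Some mat_mult_vec mult_matrix_Some_Fvec[OF b c1 x] Fvec_Some FD_partial_mseries[OF c x]
      by (simp only: pt.simps diff_0_right) (rule mult.left_commute)
  qed
qed

lemma Fvec_shift_abc:
  fixes b x :: "complex ^ 'm::finite"
  assumes a: "a \<notin> \<int>" and b: "\<And>k. b $ k \<notin> \<int>" and c: "c \<notin> \<int>\<^sub>\<le>\<^sub>0" and x: "\<And>i. norm (x $ i) < 1"
  shows "Fvec a (b - axis k 1) c x =
    mat (a / c) *v (mult_matrix (Idx k) (a + 1) b (c + 1) x *v Fvec (a + 1) b (c + 1) x)"
proof (rule vec_eq_iff[THEN iffD2], rule allI)
  fix i :: "'m option"
  let ?A = "fd_coeff (a + 1) b (c + 1)"
  have a0: "a \<noteq> 0" using a by auto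
  have b0: "\<And>k. b $ k \<noteq> 0" using b by (metis Ints_0)
  have c0: "c \<noteq> 0" using c by auto
  have c1: "c + 1 \<notin> \<int>\<^sub>\<le>\<^sub>0" using c plus_one_in_nonpos_Ints_imp by blast
  have pA: "poly_bounded ?A" by (rule poly_bounded_fd_coeff[OF c1])
  show "Fvec a (b - axis k 1) c x $ i =
      (mat (a / c) *v (mult_matrix (Idx k) (a + 1) b (c + 1) x *v Fvec (a + 1) b (c + 1) x)) $ i"
  proof (cases i)
    case None
    have "c * FD a (b - axis k 1) c x = mseries (\<lambda>n. c * fd_coeff a (b - axis k 1) c n) x"
      unfolding FD_mseries mseries_cmult ..
    also have "\<dots> = (c * FD (a + 1) b (c + 1) x + mseries (\<lambda>n. euler_part b ?A n) x) + (- a) * (x $ k * FD (a + 1) b (c + 1) x)"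
      unfolding contiguous_coeff_abc[OF a c c1 b]
      by (subst mseries_add[OF poly_bounded_add[OF poly_bounded_mult[OF poly_bounded_const pA] mseries_euler_part(2)[OF pA x]]
            poly_bounded_mult[OF poly_bounded_const poly_bounded_mshift[OF pA]] x],
          subst mseries_add[OF poly_bounded_mult[OF poly_bounded_const pA] mseries_euler_part(2)[OF pA x] x])
         (simp only: mseries_cmult mseries_mshift FD_mseries)
    also have "\<dots> = a * (mult_matrix (Idx k) (a + 1) b (c + 1) x *v Fvec (a + 1) b (c + 1) x) $ None"
      unfolding mult_matrix_None_Fvec[OF a0 b0 c1 x] by (simp add: algebra_simps)
    finally show ?thesis unfolding None mat_mult_vec Fvec_None by (rule eq_divide_mult[OF c0])
  next
    case (Some j)
    let ?D = "mseries (mderiv j ?A) x"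
    have "c * mseries (mderiv j (fd_coeff a (b - axis k 1) c)) x = mseries (\<lambda>n. c * mderiv j (fd_coeff a (b - axis k 1) c) n) x"
      unfolding mseries_cmult ..
    note * = this
    show ?thesis
    proof (cases "j = k")
      case True
      have bk': "(b - axis k 1) $ j = b $ k - 1" using True by (simp add: axis_def)
      have "b $ k \<noteq> 1" using b[of k] by auto
      then have bk: "b $ k - 1 \<noteq> 0" by simp
      have "c * mseries (mderiv j (fd_coeff a (b - axis k 1) c)) x = a * (b $ k - 1) * FD (a + 1) b (c + 1) x"
        unfolding * unfolding True mderiv_coeff_abc_same[OF a c c1 b] mseries_cmult FD_mseries ..
      then have "c * mseries (mderiv j (fd_coeff a (b - axis k 1) c)) x = a * ((b $ k - 1) * FD (a + 1) b (c + 1) x)"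
        by (simp only: mult.assoc)
      then have e: "mseries (mderiv j (fd_coeff a (b - axis k 1) c)) x = a / c * ((b $ k - 1) * FD (a + 1) b (c + 1) x)"
        by (rule eq_divide_mult[OF c0])
      \<comment> \<open>The vector on the left is normalized with b_k - 1, the one on the right with
        b_k; each cancels against the same factor standing next to F.\<close>
      have h: "u / (- B) * (v * (B * F)) = v * (u * - F)" if "B \<noteq> 0" for u v B F :: complex
        using that by simp
      have h': "v * (u / (- B) * (B * F)) = v * (u * - F)" if "B \<noteq> 0" for u v B F :: complex
        using that by simp
      show ?thesis
        unfolding Some mat_mult_vec mult_matrix_Some_Fvec[OF b0 c1 x] Fvec_Some FD_partial_mseries[OF c x] bk' e
        by (simp only: True pt.simps diff_self mult_zero_left add_0_right h[OF bk] h'[OF b0])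
    next
      case False
      have bj: "(b - axis k 1) $ j = b $ j" using False by (simp add: axis_def)
      have "c * mseries (mderiv j (fd_coeff a (b - axis k 1) c)) x =
          a * (b $ j * FD (a + 1) b (c + 1) x + (x $ j - x $ k) * ?D)"
        unfolding * mderiv_coeff_abc_other[OF a c c1 b False] mseries_cmult
        by (subst mseries_add[OF mseries_linear_factor(2)[OF pA x]
              poly_bounded_mult[OF poly_bounded_const poly_bounded_mshift[OF poly_bounded_mderiv[OF pA]]] x])
           (simp only: mseries_cmult mseries_mshift mseries_linear_factor(1)[OF pA x] FD_mseries, simp add: algebra_simps)
      then have "mseries (mderiv j (fd_coeff a (b - axis k 1) c)) x =
          a / c * (b $ j * FD (a + 1) b (c + 1) x + (x $ j - x $ k) * ?D)"
        by (rule eq_divide_mult[OF c0])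
      then show ?thesis
        unfolding Some mat_mult_vec mult_matrix_Some_Fvec[OF b0 c1 x] Fvec_Some FD_partial_mseries[OF c x] bj
        by (simp only: pt.simps) (rule mult.left_commute)
    qed
  qed
qed

section \<open>Intersection matrices and the contiguity relations\<close>

lemma invertible_iff_ker: "invertible A \<longleftrightarrow> (\<forall>y. A *v y = 0 \<longrightarrow> y = 0)"
  for A :: "complex ^ 'n::finite ^ 'n"
  unfolding invertible_left_inverse matrix_left_invertible_ker ..

lemma matrix_inv_mult_vec:
  fixes A :: "complex ^ 'n::finite ^ 'n"
  assumes "invertible A"
  shows "matrix_inv A *v (A *v y) = y" "A *v (matrix_inv A *v y) = y"
proof -
  have "A ** matrix_inv A = mat 1 \<and> matrix_inv A ** A = mat 1"
    unfolding matrix_inv_def by (rule someI_ex) (use assms in \<open>simp add: invertible_def\<close>)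
  then show "matrix_inv A *v (A *v y) = y" "A *v (matrix_inv A *v y) = y"
    by (simp_all add: matrix_vector_mul_assoc matrix_vector_mul_lid)
qed

lemma mat_mult_vec_scalar: "mat s *v y = s *s y" for y :: "complex ^ 'n::finite"
  by (simp add: vec_eq_iff mat_mult_vec)

text \<open>Since s M' y is M' C applied to s times the C-preimage of y, the inverse of M' C
  recovers this preimage, and M C then returns s M y.\<close>

lemma quotient_matrix_mult_vec:
  fixes C M M' :: "complex ^ 'n::finite ^ 'n"
  assumes C: "invertible C" and M'C: "invertible (M' ** C)"
  shows "((M ** C) ** matrix_inv (M' ** C)) *v (mat s *v (M' *v y)) = mat s *v (M *v y)"
proof -
  let ?z = "s *s (matrix_inv C *v y)"
  have "mat s *v (M' *v y) = (M' ** C) *v ?z"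
    unfolding mat_mult_vec_scalar vector_scalar_commute matrix_vector_mul_assoc[symmetric] matrix_inv_mult_vec(2)[OF C] ..
  then have "((M ** C) ** matrix_inv (M' ** C)) *v (mat s *v (M' *v y)) = (M ** C) *v ?z"
    unfolding matrix_vector_mul_assoc[of "M ** C" "matrix_inv (M' ** C)", symmetric]
    by (simp only: matrix_inv_mult_vec(1)[OF M'C])
  also have "\<dots> = mat s *v (M *v y)"
    unfolding mat_mult_vec_scalar vector_scalar_commute matrix_vector_mul_assoc[symmetric] matrix_inv_mult_vec(2)[OF C] ..
  finally show ?thesis .
qed

lemma sum_idx: "(\<Sum>i\<in>UNIV. h i) = h Idx0 + h Idx1 + (\<Sum>k\<in>UNIV. h (Idx k))"
  for h :: "'m::finite idx \<Rightarrow> complex"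
proof -
  have "(UNIV :: 'm idx set) = insert Idx0 (insert Idx1 (range Idx))"
  proof -
    have "p \<in> insert Idx0 (insert Idx1 (range Idx))" for p :: "'m idx" by (cases p) simp_all
    then show ?thesis by blast
  qed
  then have "(\<Sum>i\<in>UNIV. h i) = (\<Sum>i\<in>insert Idx0 (insert Idx1 (range Idx)). h i)" by simp
  also have "\<dots> = h Idx0 + (h Idx1 + (\<Sum>i\<in>range Idx. h i))"
  proof -
    have "(Idx0 :: 'm idx) \<notin> insert Idx1 (range Idx)" "(Idx1 :: 'm idx) \<notin> range Idx" by blast+
    then show ?thesis by simp
  qed
  also have "(\<Sum>i\<in>range Idx. h i) = (\<Sum>k\<in>UNIV. h (Idx k))"
    by (subst sum.reindex) (auto simp: inj_on_def)
  finally show ?thesis by simp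
qed

lemma holomorphic_form_Z1:
  assumes "open T" "w holomorphic_on T" "\<phi> holomorphic_on T"
  shows "(\<lambda>z. (\<phi> z, 0)) \<in> Z1 T w"
proof -
  have "(\<lambda>z. (\<phi> z, 0) - nabla0 w (\<lambda>_. 0) z) \<in> Z1 T w"
    by (rule nabla1_holomorphic_minus_nabla0[OF assms smooth_const])
       (rule mixed_commute_holomorphic[OF open_UNIV UNIV_I holomorphic_on_const])
  then show ?thesis by (simp add: nabla0_zero)
qed

lemma log_connection_radii:
  fixes q :: "'i::finite \<Rightarrow> complex"
  assumes "inj q" "\<And>i. \<alpha> i \<notin> \<int>" "(\<Sum>i\<in>UNIV. \<alpha> i) \<notin> \<int>"
  obtains r R where "log_connection q \<alpha> r R"
proof -
  \<comment> \<open>The extra element 2 keeps the set nonempty when there is only one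
    puncture.\<close>
  let ?S = "insert 2 ((\<lambda>(i, j). dist (q i) (q j)) ` {(i, j). i \<noteq> j})"
  have fin: "finite ?S" by simp
  define r where "r = Min ?S / 2"
  have "\<forall>d\<in>?S. 0 < d" using assms(1) by (auto dest: injD)
  then have r: "0 < r" unfolding r_def using Min_in[OF fin] by auto
  have sep: "2 * r \<le> dist (q i) (q j)" if "i \<noteq> j" for i j
    unfolding r_def using that fin by (auto intro!: Min_le)
  define R where "R = 2 * ((\<Sum>i\<in>UNIV. norm (q i)) + r)"
  have R: "2 * (norm (q i) + r) \<le> R" for i
    unfolding R_def using member_le_sum[of i UNIV "\<lambda>i. norm (q i)"] by simp
  show ?thesis by (rule that[of r R]) (unfold_locales, use r sep R assms in auto)
qed

section \<open>Residues of the basis forms and of the connection form\<close>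

definition phi_residue :: "'m option \<Rightarrow> 'm idx \<Rightarrow> complex" where
  "phi_residue l p = (case p of
       Idx0 \<Rightarrow> 0
     | Idx1 \<Rightarrow> 1
     | Idx k \<Rightarrow> (if l = Some k then - 1 else 0))"

lemma phi_eq_eta: "phi x l t = eta (pt x) (phi_residue l) t"
proof (cases l)
  case None
  then show ?thesis unfolding eta_def sum_idx by (simp add: phi_def phi_residue_def)
next
  case (Some k)
  have "(\<Sum>j\<in>UNIV. (if k = j then - 1 else 0) / (t - x $ j)) = - 1 / (t - x $ k)"
    by (simp add: if_distrib[of "\<lambda>c. c / _"] cong: if_cong)
  then show ?thesis unfolding eta_def sum_idx using Some by (simp add: phi_def phi_residue_def)
qed

text \<open>Among the basis forms only \<phi>_0 has a residue at infinity.\<close>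

lemma sum_phi_residue: "(\<Sum>p\<in>UNIV. phi_residue l p) = (if l = None then 1 else 0)"
  for l :: "'m::finite option"
  unfolding sum_idx by (cases l) (simp_all add: phi_residue_def)

lemma omega_eq_eta: "omega a b c x = eta (pt x) (expo a b c)"
  unfolding omega_def[abs_def] eta_def[abs_def] ..

lemma sum_expo: "(\<Sum>p\<in>UNIV. expo a b c p) = - a"
  unfolding sum_idx by (simp add: sum_negf)

lemma eta_linear: "eta q (\<lambda>p. \<rho> p + u * \<sigma> p) z = eta q \<rho> z + u * eta q \<sigma> z"
  unfolding eta_def by (simp add: sum.distrib sum_distrib_left add_divide_distrib)

text \<open>The class of \<open>(t - x\<^sub>p) \<phi>\<^sub>0\<close> is reduced to the basis by means of the covariant derivative of \<open>t / (1 - a)\<close>.\<close>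

lemma mult_phi_reduction:
  fixes b x :: "complex ^ 'm::finite"
  assumes t: "t \<in> Tx x" and a: "a \<noteq> 1"
  shows "(t - pt x p) * phi x i t = (\<Sum>l\<in>UNIV. mult_matrix p a b c x $ i $ l * phi x l t) +
    (if i = None then (1 + omega a b c x t * t) / (1 - a) else 0)"
proof -
  have t1: "t - 1 \<noteq> 0" and t0: "t \<noteq> 0" and tk: "\<And>k. t - x $ k \<noteq> 0"
    using t unfolding Tx_def by (metis ComplD pt.simps(3) rangeI right_minus_eq,
        metis ComplD pt.simps(1) rangeI, metis ComplD pt.simps(2) rangeI right_minus_eq)
  show ?thesis
  proof (cases i)
    case (Some k)
    have "(\<Sum>j\<in>UNIV. (if j = k then x $ k - pt x p else 0) * phi x (Some j) t) = (x $ k - pt x p) * phi x (Some k) t"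
      by (simp add: if_distrib[of "\<lambda>c. c * _"] cong: if_cong)
    then have s: "(\<Sum>l\<in>UNIV. mult_matrix p a b c x $ i $ l * phi x l t) =
        (1 - x $ k) * phi x None t + (x $ k - pt x p) * phi x (Some k) t"
      unfolding sum_option Some by (simp add: mult_matrix_def)
    have "(t - P) * (1 / (t - 1) - 1 / (t - X)) = (1 - X) * (1 / (t - 1)) + (X - P) * (1 / (t - 1) - 1 / (t - X))"
      if "t - X \<noteq> 0" for P X
    proof -
      have "(t - P) * (1 / (t - 1) - 1 / (t - X)) = (X - P) * (1 / (t - 1) - 1 / (t - X)) + (t - X) * (1 / (t - 1) - 1 / (t - X))"
        unfolding distrib_right[symmetric] by simp
      also have "(t - X) * (1 / (t - 1) - 1 / (t - X)) = (t - X) / (t - 1) - 1"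
        using that by (simp add: right_diff_distrib)
      also have "\<dots> = (1 - X) * (1 / (t - 1))" using t1 by (simp add: divide_simps)
      finally show ?thesis by simp
    qed
    from this[OF tk] show ?thesis unfolding s unfolding Some by (simp add: phi_def)
  next
    case None
    let ?u = "1 / (t - 1)" and ?v = "\<lambda>j. 1 / (t - x $ j)" and ?y = "\<lambda>j. b $ j * x $ j"
    have a1: "a - 1 \<noteq> 0" using a by simp
    \<comment> \<open>Each t/(t - x_p) is 1 + x_p/(t - x_p), and the constants add up to the sum - a
      of the exponents. Hence 1 + \<omega> t has constant term 1 - a, which is why t is divided by 1
      - a.\<close>
    have w: "omega a b c x t * t = - a + (c - a) * ?u - (\<Sum>j\<in>UNIV. ?y j * ?v j)"
    proof -
      have "omega a b c x t * t = (\<Sum>p\<in>UNIV. expo a b c p * (t / (t - pt x p)))"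
        unfolding omega_def sum_distrib_right by simp
      also have "\<dots> = (\<Sum>p\<in>UNIV. expo a b c p + expo a b c p * pt x p * (1 / (t - pt x p)))"
      proof (rule sum.cong[OF refl])
        fix p
        have "t - pt x p \<noteq> 0" using t unfolding Tx_def by (metis ComplD rangeI right_minus_eq)
        then have "t / (t - pt x p) = 1 + pt x p * (1 / (t - pt x p))" by (simp add: field_simps)
        then show "expo a b c p * (t / (t - pt x p)) = expo a b c p + expo a b c p * pt x p * (1 / (t - pt x p))"
          by (simp add: distrib_left)
      qed
      also have "\<dots> = - a + (\<Sum>p\<in>UNIV. expo a b c p * pt x p * (1 / (t - pt x p)))"
        unfolding sum.distrib sum_expo ..
      finally show ?thesis unfolding sum_idx by (simp add: sum_negf)
    qed
    have "(\<Sum>l\<in>UNIV. mult_matrix p a b c x $ i $ l * phi x l t) =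
        (1 - pt x p + (c - a - (\<Sum>j\<in>UNIV. ?y j)) / (a - 1)) * ?u + (\<Sum>j\<in>UNIV. ?y j / (a - 1) * (?u - ?v j))"
      unfolding sum_option None by (simp add: mult_matrix_def phi_def)
    also have "(\<Sum>j\<in>UNIV. ?y j / (a - 1) * (?u - ?v j)) =
        ((\<Sum>j\<in>UNIV. ?y j) * ?u - (\<Sum>j\<in>UNIV. ?y j * ?v j)) / (a - 1)"
    proof -
      have h: "Y / A * (u - v) = (Y * u - Y * v) / A" for Y A u v :: complex
        by (simp add: right_diff_distrib diff_divide_distrib)
      show ?thesis unfolding h sum_divide_distrib[symmetric] sum_subtractf sum_distrib_right[symmetric] ..
    qed
    finally have s: "(\<Sum>l\<in>UNIV. mult_matrix p a b c x $ i $ l * phi x l t) =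
        (1 - pt x p + (c - a - (\<Sum>j\<in>UNIV. ?y j)) / (a - 1)) * ?u +
        ((\<Sum>j\<in>UNIV. ?y j) * ?u - (\<Sum>j\<in>UNIV. ?y j * ?v j)) / (a - 1)" .
    have lhs: "(t - pt x p) * phi x i t = 1 + (1 - pt x p) * ?u"
      unfolding None phi_def using t1 by (simp add: field_simps)
    have f: "(1 - P + (c - a - Y) / (a - 1)) * u + (Y * u - V) / (a - 1) + (1 + (- a + (c - a) * u - V)) / (1 - a) =
        1 + (1 - P) * u" for P Y V u
    proof -
      have e: "z / (1 - a) = - (z / (a - 1))" for z by (metis minus_diff_eq minus_divide_right)
      have "(1 - P + (c - a - Y) / (a - 1)) * u + (Y * u - V) / (a - 1) + (1 + (- a + (c - a) * u - V)) / (1 - a) =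
          (1 - P) * u + ((c - a - Y) * u + (Y * u - V) - (1 + (- a + (c - a) * u - V))) / (a - 1)"
      proof -
        have "(1 - P + Z / (a - 1)) * u + W / (a - 1) + - (X / (a - 1)) = (1 - P) * u + (Z * u + W - X) / (a - 1)"
          for Z W X by (simp add: add_divide_distrib diff_divide_distrib distrib_right)
        then show ?thesis unfolding e .
      qed
      also have "(c - a - Y) * u + (Y * u - V) - (1 + (- a + (c - a) * u - V)) = a - 1"
        by (simp add: algebra_simps)
      finally show ?thesis using a1 by simp
    qed
    show ?thesis unfolding s w lhs using f[of "pt x p" "\<Sum>j\<in>UNIV. ?y j" ?u "\<Sum>j\<in>UNIV. ?y j * ?v j"]
      by (simp only: None refl if_True)
  qed
qed

text \<open>The pairing is linear on compactly supported representatives, so a form cohomologous to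
  a combination of the \<phi>_l pairs like the same combination of the rows of C. For invertibility,
  C is a nonzero multiple of an all-ones matrix of rank one plus a diagonal one: a kernel vector is
  proportional to the exponents, and the remaining condition on the factor S is \<alpha>_0 S =
  0.\<close>

lemma intersection_matrices:
  fixes a c :: complex and b x :: "complex ^ 'm::finite"
  assumes a: "a \<notin> \<int>" and ca: "c - a \<notin> \<int>" and b: "\<And>k. b $ k \<notin> \<int>"
    and cb: "c - (\<Sum>j\<in>UNIV. b $ j) \<notin> \<int>" and inj: "inj (pt x)"
  shows "invertible (Cmat a b c x)"
    and "Qmat p a b c x = mult_matrix p a b c x ** Cmat a b c x"
proof -
  let ?q = "pt x" and ?\<alpha> = "expo a b c" and ?w = "omega a b c x"
  let ?T = "Tx x"
  have "- c + (\<Sum>j\<in>UNIV. b $ j) \<notin> \<int>" using cb minus_in_Ints_iff[of "c - (\<Sum>j\<in>UNIV. b $ j)"] by simp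
  then have ex: "?\<alpha> p \<notin> \<int>" for p using ca b by (cases p) (simp_all add: minus_in_Ints_iff)
  have sex: "(\<Sum>p\<in>UNIV. ?\<alpha> p) \<notin> \<int>" unfolding sum_expo using a by (simp add: minus_in_Ints_iff)
  obtain r R where "log_connection ?q ?\<alpha> r R" using log_connection_radii[OF inj ex sex] by blast
  then interpret log_connection ?q ?\<alpha> r R .
  have T: "- range (pt x) = ?T" unfolding Tx_def ..
  have w: "eta (pt x) ?\<alpha> = ?w" by (rule omega_eq_eta[symmetric])
  interpret tw: twisted_cohomology ?T ?w using twisted unfolding T w .
  have hw: "?w holomorphic_on ?T" "(\<lambda>t. - ?w t) holomorphic_on ?T"
    unfolding omega_eq_eta Tx_def by (intro holomorphic_intros holomorphic_eta)+
  have heta: "(\<lambda>t. eta ?q \<rho> t) holomorphic_on ?T" for \<rho> unfolding Tx_def by (rule holomorphic_eta)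
  note oT = tw.open_T
  define \<phi> where "\<phi> l = (\<lambda>t. (phi x l t, 0 :: complex))" for l
  have \<phi>_eta: "\<phi> l = (\<lambda>t. (eta ?q (phi_residue l) t, 0))" for l
    unfolding \<phi>_def phi_eq_eta ..
  have \<phi>Z: "\<phi> l \<in> Z1 ?T ?w" "\<phi> l \<in> Z1 ?T (\<lambda>t. - ?w t)" for l
    unfolding \<phi>_eta by (intro holomorphic_form_Z1 oT hw heta)+
  define C0 where "C0 = - 2 * \<i> * bump_total r"
  have C0: "C0 \<noteq> 0" unfolding C0_def using bump_total_nonzero[OF r] by simp
  define rep where "rep l \<kappa> \<longleftrightarrow> \<kappa> \<in> Z1c ?T ?w \<and> (\<phi> l, \<kappa>) \<in> cohom ?T ?w \<and> (\<forall>\<sigma>. (\<Sum>p\<in>UNIV. \<sigma> p) = 0 \<longrightarrow>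
      wedge_integral ?T \<kappa> (\<lambda>z. (eta ?q \<sigma> z, 0)) = C0 * (\<Sum>p\<in>UNIV. phi_residue l p * \<sigma> p / ?\<alpha> p))" for l \<kappa>
  have "\<exists>\<kappa>. rep l \<kappa>" for l unfolding rep_def
    by (rule compact_representative[of "phi_residue l", unfolded T w, folded \<phi>_eta C0_def]) blast
  then obtain \<kappa> where rep: "\<And>l. rep l (\<kappa> l)" by metis
  have \<kappa>: "\<kappa> l \<in> Z1c ?T ?w" "(\<phi> l, \<kappa> l) \<in> cohom ?T ?w" for l using rep[of l] unfolding rep_def by blast+
  have pair: "wedge_integral ?T (\<kappa> l) (\<lambda>z. (eta ?q \<sigma> z, 0)) = C0 * (\<Sum>p\<in>UNIV. phi_residue l p * \<sigma> p / ?\<alpha> p)"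
    if "(\<Sum>p\<in>UNIV. \<sigma> p) = 0" for l \<sigma> using rep[of l] that unfolding rep_def by blast
  define J where "J = (\<chi> i j. wedge_integral ?T (\<kappa> i) (\<phi> j))"
  \<comment> \<open>Stated for arbitrary coefficients: C takes unit coefficients, Q_p the rows of
    \<open>mult_matrix\<close>.\<close>
  have I_c: "I_c a b c x \<psi> (\<phi> j) = (\<Sum>l\<in>UNIV. d l * J $ l $ j)"
    if \<psi>: "(\<psi>, lincomb d \<phi>) \<in> cohom ?T ?w" for \<psi> d j
  proof -
    have 1: "(\<psi>, lincomb d \<kappa>) \<in> cohom ?T ?w"
      by (rule cohom_trans[OF oT \<psi> cohom_lincomb[OF oT \<kappa>(2)]])
    have 2: "lincomb d \<kappa> \<in> Z1c ?T ?w"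
      using Z1_lincomb[OF oT, of \<kappa> ?w] cpt_supp_lincomb[of ?T \<kappa>] \<kappa>(1) unfolding Z1c_def by auto
    have "I_c a b c x \<psi> (\<phi> j) = wedge_integral ?T (lincomb d \<kappa>) (\<phi> j)"
      unfolding I_c_def Let_def by (rule tw.intersection_eq[OF 2 1 \<phi>Z(2)])
    also have "\<dots> = (\<Sum>l\<in>UNIV. d l * wedge_integral ?T (\<kappa> l) (\<phi> j))"
      by (rule wedge_lincomb_left[OF oT \<kappa>(1) \<phi>Z(2)])
    finally show ?thesis unfolding J_def by simp
  qed
  have Cmat: "Cmat a b c x = J"
  proof -
    have "I_c a b c x (\<phi> i) (\<phi> j) = J $ i $ j" for i j
    proof -
      let ?d = "\<lambda>l. if l = i then 1 else 0 :: complex"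
      have "lincomb ?d \<phi> = \<phi> i"
        unfolding lincomb_def by (simp add: fun_eq_iff if_distrib[of "\<lambda>c. c * _"] cong: if_cong)
      then have "(\<phi> i, lincomb ?d \<phi>) \<in> cohom ?T ?w" using cohom_refl[OF \<phi>Z(1)] by simp
      from I_c[OF this] show ?thesis by (simp add: if_distrib[of "\<lambda>c. c * _"] cong: if_cong)
    qed
    then show ?thesis unfolding Cmat_def \<phi>_def by (simp add: vec_eq_iff)
  qed
  show "Qmat p a b c x = mult_matrix p a b c x ** Cmat a b c x"
  proof -
    have "I_c a b c x (\<lambda>t. ((t - pt x p) * phi x i t, 0)) (\<phi> j) = (mult_matrix p a b c x ** J) $ i $ j" for i j
    proof -
      let ?d = "\<lambda>l. mult_matrix p a b c x $ i $ l"
      \<comment> \<open>Only \<phi>_0 needs a correction term; the other products are combinations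
        of the basis as functions.\<close>
      let ?f = "\<lambda>t. if i = None then t / (1 - a) else 0"
      have a1: "a \<noteq> 1" using a by auto
      have "((\<lambda>t. ((t - pt x p) * phi x i t, 0)), lincomb ?d \<phi>) \<in> cohom ?T ?w"
      proof (rule cohomI[OF _ Z1_lincomb[OF oT \<phi>Z(1)]])
        show "(\<lambda>t. ((t - pt x p) * phi x i t, 0)) \<in> Z1 ?T ?w"
          unfolding phi_eq_eta by (intro holomorphic_form_Z1 oT hw holomorphic_intros heta)
        show "smooth ?T ?f"
          by (cases "i = None") (use a1 in \<open>auto intro!: smooth_holomorphic holomorphic_intros oT\<close>)
        fix t assume t: "t \<in> ?T"
        have "wirtinger ?f (if i = None then 1 / (1 - a) else 0) 0 t"
          by (cases "i = None") (use a1 in \<open>auto intro!: wirtinger_field_derivative derivative_eq_intros\<close>)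
        then have n: "nabla0 ?w ?f t = (if i = None then (1 + ?w t * t) / (1 - a) else 0, 0)"
          unfolding nabla0_def by (simp add: wirtinger_d_t wirtinger_d_tbar add_divide_distrib)
        show "((t - pt x p) * phi x i t, 0) = lincomb ?d \<phi> t + nabla0 ?w ?f t"
          unfolding n mult_phi_reduction[OF t a1, of p i b c] lincomb_def \<phi>_def by simp
      qed
      from I_c[OF this] show ?thesis by (simp add: matrix_matrix_mult_def)
    qed
    then show ?thesis unfolding Cmat unfolding Qmat_def \<phi>_def by (simp add: vec_eq_iff)
  qed
  have \<alpha>0: "?\<alpha> p \<noteq> 0" for p using ex[of p] by auto
  have a0: "a \<noteq> 0" using a by auto
  have J_Some: "J $ i $ Some k = C0 * (1 / (c - a) + (if i = Some k then 1 / ?\<alpha> (Idx k) else 0))" for i k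
  proof -
    have "J $ i $ Some k = C0 * (\<Sum>p\<in>UNIV. phi_residue i p * phi_residue (Some k) p / ?\<alpha> p)"
      unfolding J_def \<phi>_eta using pair[of "phi_residue (Some k)" i] by (simp add: sum_phi_residue)
    also have "(\<Sum>p\<in>UNIV. phi_residue i p * phi_residue (Some k) p / ?\<alpha> p) =
        1 / (c - a) + (\<Sum>j\<in>UNIV. if j = k then (if i = Some k then 1 / ?\<alpha> (Idx k) else 0) else 0)"
    proof -
      have "phi_residue i (Idx j) * phi_residue (Some k) (Idx j) / ?\<alpha> (Idx j) =
          (if j = k then (if i = Some k then 1 / ?\<alpha> (Idx k) else 0) else 0)" for j
        by (auto simp: phi_residue_def)
      then show ?thesis unfolding sum_idx by (simp add: phi_residue_def)
    qed
    finally show ?thesis by simp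
  qed
  have J_None: "J $ i $ None = C0 * (1 / (c - a) + (if i = None then 1 / a else 0))" for i
  proof -
    \<comment> \<open>The residues of \<phi>_0 sum to 1 and those of \<omega> to - a, so adding
      \<omega>/a removes the residue at infinity. The class is unchanged, \<omega>/a being up to
      sign the covariant derivative of the constant 1/a.\<close>
    let ?\<sigma> = "\<lambda>p. phi_residue None p + (1 / a) * ?\<alpha> p"
    have s: "(\<Sum>p\<in>UNIV. ?\<sigma> p) = 0"
      unfolding sum.distrib sum_distrib_left[symmetric] sum_expo sum_phi_residue using a0 by simp
    have "(\<phi> None, (\<lambda>t. (eta ?q ?\<sigma> t, 0))) \<in> cohom ?T (\<lambda>t. - ?w t)"
    proof (rule cohomI[OF \<phi>Z(2) holomorphic_form_Z1[OF oT hw(2) heta] smooth_const])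
      fix t
      show "\<phi> None t = (eta ?q ?\<sigma> t, 0) + nabla0 (\<lambda>t. - ?w t) (\<lambda>_. 1 / a) t"
        unfolding nabla0_def wirtinger_d_t[OF wirtinger_const] wirtinger_d_tbar[OF wirtinger_const] eta_linear \<phi>_eta w by simp
    qed
    from tw.wedge_integral_cohom[OF \<kappa>(1) \<kappa>(1) cohom_refl this, of i] \<kappa>(1)[of i]
    have "J $ i $ None = C0 * (\<Sum>p\<in>UNIV. phi_residue i p * ?\<sigma> p / ?\<alpha> p)"
      unfolding J_def using pair[OF s, of i] by (simp add: Z1c_def)
    also have "(\<Sum>p\<in>UNIV. phi_residue i p * ?\<sigma> p / ?\<alpha> p) =
        (\<Sum>p\<in>UNIV. phi_residue i p * phi_residue None p / ?\<alpha> p) + (\<Sum>p\<in>UNIV. phi_residue i p) / a"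
      unfolding sum.distrib[symmetric] sum_divide_distrib using \<alpha>0
      by (intro sum.cong refl) (simp add: add_divide_distrib distrib_left)
    also have "(\<Sum>p\<in>UNIV. phi_residue i p * phi_residue None p / ?\<alpha> p) = 1 / (c - a)"
      unfolding sum_idx by (simp add: phi_residue_def)
    finally show ?thesis by (simp add: sum_phi_residue)
  qed
  have J_sym: "J $ i $ j = J $ j $ i" for i j
    by (cases i; cases j) (auto simp: J_None J_Some)
  show "invertible (Cmat a b c x)" unfolding Cmat invertible_iff_ker
  proof (intro allI impI)
    fix y assume y: "J *v y = 0"
    \<comment> \<open>S is the contribution of the rank-one part, common to all rows.\<close>
    define S where "S = (\<Sum>l\<in>UNIV. y $ l) / (c - a)"
    have row: "(\<Sum>l\<in>UNIV. J $ l $ j * y $ l) = 0" for j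
      using arg_cong[OF y, of "\<lambda>v. v $ j"] unfolding matrix_vector_mult_def by (simp add: J_sym[of j])
    have yN: "y $ None = - (a * S)"
    proof -
      have "0 = C0 * (S + (\<Sum>l\<in>UNIV. if l = None then y $ l / a else 0))"
        using row[of None] unfolding J_None S_def
        by (simp add: mult.assoc sum_distrib_left[symmetric] distrib_right sum.distrib sum_divide_distrib if_distrib[of "\<lambda>c. c * _"] cong: if_cong)
      then have "S + y $ None / a = 0" using C0 by simp
      then show ?thesis using a0 by (simp add: field_simps add_eq_0_iff)
    qed
    have yS: "y $ Some k = - (?\<alpha> (Idx k) * S)" for k
    proof -
      have "0 = C0 * (S + (\<Sum>l\<in>UNIV. if l = Some k then y $ l / ?\<alpha> (Idx k) else 0))"
        using row[of "Some k"] unfolding J_Some S_def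
        by (simp add: mult.assoc sum_distrib_left[symmetric] distrib_right sum.distrib sum_divide_distrib if_distrib[of "\<lambda>c. c * _"] cong: if_cong)
      then have "S + y $ Some k / ?\<alpha> (Idx k) = 0" using C0 by simp
      then show ?thesis using \<alpha>0[of "Idx k"] by (simp add: field_simps add_eq_0_iff)
    qed
    \<comment> \<open>The coordinates sum to (c - a) S; inserting the values just found leaves an
      equation for S alone.\<close>
    have "(c - a) * S = - (a * S) + (\<Sum>k\<in>UNIV. - (?\<alpha> (Idx k) * S))"
      using \<alpha>0[of Idx1] unfolding S_def[symmetric] yN[symmetric] yS[symmetric] sum_option[symmetric] by (simp add: S_def)
    then have "(c - (\<Sum>j\<in>UNIV. b $ j)) * S = 0"
      by (simp add: sum_distrib_right[symmetric] left_diff_distrib)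
    moreover have "c - (\<Sum>j\<in>UNIV. b $ j) \<noteq> 0" using cb by auto
    ultimately have "S = 0" by simp
    with yN yS have "y $ l = 0" for l by (cases l) simp_all
    then show "y = 0" by (simp add: vec_eq_iff)
  qed
qed

text \<open>On a kernel vector the rows k \<ge> 1 force all coordinates to be equal, because x_k
  \<noteq> 1; the remaining row is then (c - a)/(a - 1) times the common value.\<close>

lemma invertible_mult_matrix_Idx1:
  fixes b x :: "complex ^ 'm::finite"
  assumes a: "a \<noteq> 1" and ca: "c \<noteq> a" and inj: "inj (pt x)"
  shows "invertible (mult_matrix Idx1 a b c x)"
  unfolding invertible_iff_ker
proof (intro allI impI)
  fix y assume y: "mult_matrix Idx1 a b c x *v y = 0"
  have "y $ Some k = y $ None" for k
  proof -
    have "x $ k \<noteq> 1" using injD[OF inj, of "Idx k" Idx1] by auto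
    moreover have "(1 - x $ k) * (y $ None - y $ Some k) = 0"
      using arg_cong[OF y, of "\<lambda>v. v $ Some k"] unfolding mult_matrix_Some by (simp add: algebra_simps)
    ultimately show ?thesis by simp
  qed
  note yk = this
  have "(c - a - (\<Sum>j\<in>UNIV. b $ j * x $ j)) / (a - 1) * y $ None + (\<Sum>j\<in>UNIV. b $ j * x $ j / (a - 1) * y $ None) = 0"
    using arg_cong[OF y, of "\<lambda>v. v $ None"] unfolding mult_matrix_None yk by simp
  then have "(c - a) / (a - 1) * y $ None = 0"
    unfolding sum_distrib_right[symmetric] sum_divide_distrib[symmetric] distrib_right[symmetric] add_divide_distrib[symmetric]
    by simp
  then have "y $ None = 0" using a ca by simp
  with yk have "y $ l = 0" for l by (cases l) simp_all
  then show "y = 0" by (simp add: vec_eq_iff)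
qed

text \<open>On a kernel vector the rows k \<ge> 1 give x_k y_k = - (1 - x_k) y_0. Inserted into the
  remaining row, whose entries contain x_k, this leaves (c - 1 - \<Sum> b_j)/(a - 1) times y_0;
  finally x_k \<noteq> 0 makes y_k vanish too.\<close>

lemma invertible_mult_matrix_Idx0:
  fixes b x :: "complex ^ 'm::finite"
  assumes a: "a \<noteq> 1" and cb: "c - 1 \<noteq> (\<Sum>j\<in>UNIV. b $ j)" and inj: "inj (pt x)"
  shows "invertible (mult_matrix Idx0 a b c x)"
  unfolding invertible_iff_ker
proof (intro allI impI)
  fix y assume y: "mult_matrix Idx0 a b c x *v y = 0"
  have x0: "x $ k \<noteq> 0" for k using injD[OF inj, of "Idx k" Idx0] by auto
  have yk: "x $ k * y $ Some k = - ((1 - x $ k) * y $ None)" for k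
    using arg_cong[OF y, of "\<lambda>v. v $ Some k"] unfolding mult_matrix_Some
    by (simp add: add_eq_0_iff)
  have a1: "a - 1 \<noteq> 0" using a by simp
  have "(1 + (c - a - (\<Sum>j\<in>UNIV. b $ j * x $ j)) / (a - 1)) * y $ None + (\<Sum>j\<in>UNIV. b $ j * x $ j / (a - 1) * y $ Some j) = 0"
    using arg_cong[OF y, of "\<lambda>v. v $ None"] unfolding mult_matrix_None by simp
  moreover have "(\<Sum>j\<in>UNIV. b $ j * x $ j / (a - 1) * y $ Some j) =
      ((\<Sum>j\<in>UNIV. b $ j * x $ j) - (\<Sum>j\<in>UNIV. b $ j)) / (a - 1) * y $ None"
  proof -
    have "b $ j * x $ j / (a - 1) * y $ Some j = (b $ j * x $ j - b $ j) / (a - 1) * y $ None" for j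
    proof -
      have "b $ j * x $ j / (a - 1) * y $ Some j = b $ j / (a - 1) * (x $ j * y $ Some j)" by simp
      also have "\<dots> = (b $ j * x $ j - b $ j) / (a - 1) * y $ None"
        unfolding yk by (simp add: diff_divide_distrib algebra_simps)
      finally show ?thesis .
    qed
    then show ?thesis
      by (simp only: sum_distrib_right[symmetric] sum_divide_distrib[symmetric] sum_subtractf)
  qed
  ultimately have "(1 + (c - a - Y) / (a - 1)) * y $ None + (Y - B) / (a - 1) * y $ None = 0"
    if "Y = (\<Sum>j\<in>UNIV. b $ j * x $ j)" "B = (\<Sum>j\<in>UNIV. b $ j)" for Y B
    unfolding that by simp
  note this[OF refl refl]
  moreover have "(1 + (c - a - Y) / (a - 1)) * z + (Y - B) / (a - 1) * z = (c - 1 - B) / (a - 1) * z" for Y B z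
  proof -
    have "1 + (c - a - Y) / (a - 1) + (Y - B) / (a - 1) = ((a - 1) + (c - a - Y) + (Y - B)) / (a - 1)"
      by (simp only: add_divide_distrib divide_self[OF a1])
    also have "(a - 1) + (c - a - Y) + (Y - B) = c - 1 - B" by simp
    finally show ?thesis by (simp only: distrib_right[symmetric])
  qed
  ultimately have "(c - 1 - (\<Sum>j\<in>UNIV. b $ j)) / (a - 1) * y $ None = 0" by simp
  then have "y $ None = 0" using a1 cb by simp
  with yk x0 have "y $ l = 0" for l by (cases l) (simp, metis mult_eq_0_iff neg_0_equal_iff_equal option.exhaust)
  then show "y = 0" by (simp add: vec_eq_iff)
qed

section \<open>Assembly of the three relations\<close>

lemma Ints_shift_iff: "a + 1 \<in> \<int> \<longleftrightarrow> a \<in> \<int>" for a :: complex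
  by (metis Ints_1 Ints_add Ints_diff add_diff_cancel_right')

text \<open>The invertibility claims ensure that every \<open>matrix_inv\<close> inside the three
  matrices is a genuine inverse.\<close>

theorem theorem4:
  fixes a c :: complex and b x :: "complex ^ 'm::finite"
  assumes "a \<notin> \<int>" and "c - a \<notin> \<int>" and "\<And>k. b $ k \<notin> \<int>"
    and "c - (\<Sum>j\<in>UNIV. b $ j) \<notin> \<int>" and "c \<notin> \<int>\<^sub>\<le>\<^sub>0"
    and "\<And>i. norm (x $ i) < 1" and "inj (pt x)"
  shows "(invertible (Cmat a b c x) \<and>
          Fvec (a - 1) b c x = D_a a b c x *v Fvec a b c x) \<and>
         (c - 1 \<notin> \<int>\<^sub>\<le>\<^sub>0 \<longrightarrow>
          invertible (Qmat Idx1 (a + 1) b c x) \<and>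
          Fvec a b (c - 1) x = D_c a b c x *v Fvec a b c x) \<and>
         (invertible (Qmat Idx0 (a + 1) b (c + 1) x) \<and>
          (\<forall>k. Fvec a (b - axis k 1) c x = D_b k a b c x *v Fvec a b c x))"
proof -
  note x = assms(6) and inj = assms(7)
  have b0: "b $ k \<noteq> 0" for k using assms(3)[of k] by auto
  have a0: "a \<noteq> 0" "a + 1 \<noteq> 1" "a - 1 \<notin> \<int>" "a + 1 \<notin> \<int>"
    using assms(1) Ints_shift_iff[of a] Ints_shift_iff[of "a - 1"] by auto
  have c0: "c \<noteq> 0" using assms(5) by auto
  have ca: "c - a \<noteq> 0" "c - a - 1 \<noteq> 0" "c - (a + 1) \<notin> \<int>" "c \<noteq> a + 1"
    using assms(2) Ints_shift_iff[of "c - a - 1"] by (auto simp: algebra_simps)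
  note m0 = intersection_matrices[OF assms(1-4) inj]
  note m1 = intersection_matrices[OF a0(4) ca(3) assms(3,4) inj]
  have "c + 1 - (a + 1) \<notin> \<int>" "c + 1 - (\<Sum>j\<in>UNIV. b $ j) \<notin> \<int>"
    using assms(2,4) Ints_shift_iff[of "c - (\<Sum>j\<in>UNIV. b $ j)"] by (simp_all add: algebra_simps)
  note m2 = intersection_matrices[OF a0(4) this(1) assms(3) this(2) inj]
  \<comment> \<open>The relation is used with a - 1 in place of a, so that its matrix sits at a
    itself and C cancels directly.\<close>
  have ma: "Fvec (a - 1) b c x = mat ((a - 1) / (c - a)) *v (mult_matrix Idx1 a b c x *v Fvec a b c x)"
    using Fvec_shift_a[OF a0(3) b0 assms(5) x, of] ca(1) by simp
  have Da: "Fvec (a - 1) b c x = D_a a b c x *v Fvec a b c x"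
    unfolding ma D_a_def m0(2) matrix_vector_mul_assoc[symmetric] matrix_inv_mult_vec(2)[OF m0(1)] ..
  have inv1: "invertible (Qmat Idx1 (a + 1) b c x)"
    unfolding m1(2) by (intro invertible_mult invertible_mult_matrix_Idx1 a0 ca inj m1(1))
  have Fa: "Fvec a b c x = mat (a / (c - a - 1)) *v (mult_matrix Idx1 (a + 1) b c x *v Fvec (a + 1) b c x)"
    by (rule Fvec_shift_a[OF assms(1) b0 assms(5) x ca(2)])
  have Dc: "Fvec a b (c - 1) x = D_c a b c x *v Fvec a b c x" if c1: "c - 1 \<notin> \<int>\<^sub>\<le>\<^sub>0"
  proof -
    have "c - 1 \<noteq> 0" using c1 by auto
    \<comment> \<open>The prefactor of \<open>D_c\<close> is the quotient of the scalar a/(c-1),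
      from lowering a and c together, by a/(c-a-1), from lowering a alone.\<close>
    then have s: "(c - a - 1) / (c - 1) * (a / (c - a - 1)) = a / (c - 1)" using ca(2) by simp
    have "D_c a b c x *v Fvec a b c x = mat ((c - a - 1) / (c - 1)) *v
        (((mult_matrix Idx0 (a + 1) b c x ** Cmat (a + 1) b c x) **
          matrix_inv (mult_matrix Idx1 (a + 1) b c x ** Cmat (a + 1) b c x)) *v Fvec a b c x)"
      unfolding D_c_def m1(2) by (simp only: matrix_vector_mul_assoc matrix_mul_assoc)
    also have "\<dots> = mat ((c - a - 1) / (c - 1)) *v (mat (a / (c - a - 1)) *v
        (mult_matrix Idx0 (a + 1) b c x *v Fvec (a + 1) b c x))"
      unfolding Fa by (subst quotient_matrix_mult_vec[OF m1(1) inv1[unfolded m1(2)]]) (rule refl)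
    also have "\<dots> = mat (a / (c - 1)) *v (mult_matrix Idx0 (a + 1) b c x *v Fvec (a + 1) b c x)"
      unfolding mat_mult_vec_scalar vector_smult_assoc s ..
    also have "\<dots> = Fvec a b (c - 1) x"
      using Fvec_shift_ac[OF assms(1) b0 c1 x] by simp
    finally show ?thesis ..
  qed
  have inv2: "invertible (Qmat Idx0 (a + 1) b (c + 1) x)"
    unfolding m2(2) by (intro invertible_mult invertible_mult_matrix_Idx0 a0 inj m2(1)) (use assms(4) in auto)
  \<comment> \<open>Both relations start from the vector at (a + 1, b, c + 1) with the same scalar
    a/c, which is why \<open>D_b\<close> has no prefactor.\<close>
  have Db: "Fvec a (b - axis k 1) c x = D_b k a b c x *v Fvec a b c x" for k
    unfolding D_b_def m2(2) Fvec_shift_abc[OF assms(1,3,5) x, of k] Fvec_shift_ac[OF assms(1) b0 assms(5) x]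
    by (rule quotient_matrix_mult_vec[OF m2(1) inv2[unfolded m2(2)], symmetric])
  show ?thesis using m0(1) Da inv1 Dc inv2 Db by blast
qed

end
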